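(* Let $f:\mathbb{R}\to\mathbb{R}$ be locally Lipschitz continuous, increasing and odd, with $f(0)=0$ and $xf(x)>0$ for all $x\neq 0$. Suppose that there exists $\epsilon_0\in(0,1)$ such that for every $\epsilon\in(0,\epsilon_0)$ $$\underline{\Phi}_f(\epsilon):=\liminf_{x\to 0^+}\frac{f((1-\epsilon)x)}{f(x)}>0,\qquad\text{and}\quad \underline{\Phi}_f(\epsilon)\to 1\ \text{ as } \epsilon\to 0^+,$$ and that $$\limsup_{x\to 0^+}\frac{f(\nu x)}{f(x)}<\nu\quad\text{for all }\nu\in(0,1).$$ Let $\sigma:[0,\infty)\to\mathbb{R}$ be continuous with $\sigma\in L^2(0,\infty)$ and $\int_t^\infty\sigma^2(s)\,ds>0$ for all $t\ge 0$. Let $B$ be a one-dimensional standard Brownian motion, let $\xi\in\mathbb{R}$ be deterministic, and let $X$ be the unique continuous adapted process satisfying $$dX(t)=-f(X(t))\,dt+\sigma(t)\,dB(t),\quad t\ge 0,\qquad X(0)=\xi.$$ Suppose that the limit $$\mu:=\lim_{t\to\infty}\frac{\int_t^\infty\sigma^2(s)\,ds}{F^{-1}(t)^2/\log\log\left(1/F^{-1}(t)^2\right)}\in[0,\infty]$$ exists. Then: (i) If $\mu=0$, then there exists an $\mathcal{F}^B(\infty)$-measurable random variable $\lambda$ with $\mathbb{P}[\lambda\in\{-1,0,1\}]=1$ such that $$\mathbb{P}\left[\lim_{t\to\infty}\frac{X(t)}{F^{-1}(t)}=\lambda\right]=1.$$ (ii) If $\mu\in(0,\infty)$, then $$\mathbb{P}\left[\lim_{t\to\infty}\frac{X(t)}{F^{-1}(t)}\in\{-1,0,1\}\right]=0$$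 (the event being that the limit exists and belongs to $\{-1,0,1\}$). (iii) If $\mu=+\infty$, then $$\mathbb{P}\left[\limsup_{t\to\infty}\frac{|X(t)|}{F^{-1}(t)}=+\infty\right]=1.$$
   Context: $F:(0,\infty)\to\mathbb{R}$ is defined by $F(x)=\int_x^1 \frac{1}{f(u)}\,du$. It is strictly decreasing, and $F^{-1}$ denotes its inverse function. Under the stated hypotheses $F(x)\to+\infty$ as $x\to0^+$, so $F^{-1}(t)$ is defined for all $t\ge 0$ and $F^{-1}(t)\to0$ as $t\to\infty$. "Adapted" refers to the natural filtration $\mathcal{F}^B(t)=\sigma\{B(s):0\le s\le t\}$ generated by $B$, and $\mathcal{F}^B(\infty)$ is the $\sigma$-algebra generated by $\{B(s):s\ge0\}$. *)

theory Defs
  imports "HOL-Probability.Probability"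
begin

text \<open>
  Processes are functions of type \<open>real \<Rightarrow> 'a \<Rightarrow> real\<close>; only times \<open>t \<ge> 0\<close> are meaningful.
  Path properties are required almost surely, so that the raw (not completed) natural
  filtration of a Brownian motion is large enough to carry solutions.
\<close>

definition natural_algebra :: "'a measure \<Rightarrow> (real \<Rightarrow> 'a \<Rightarrow> real) \<Rightarrow> real set \<Rightarrow> 'a measure" where
  "natural_algebra M B T =
     sigma (space M) (\<Union>s\<in>T. {B s -` A \<inter> space M | A. A \<in> sets borel})"

definition standard_brownian_motion :: "'a measure \<Rightarrow> (real \<Rightarrow> 'a \<Rightarrow> real) \<Rightarrow> bool" where
  "standard_brownian_motion M B \<longleftrightarrow>
     (\<forall>t\<ge>0. B t \<in> borel_measurable M) \<and>
     (AE \<omega> in M. B 0 \<omega> = 0) \<and>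
     (\<forall>s t. 0 \<le> s \<and> s < t \<longrightarrow>
        distributed M lborel (\<lambda>\<omega>. B t \<omega> - B s \<omega>) (normal_density 0 (sqrt (t - s)))) \<and>
     (\<forall>(n::nat) \<tau>. 0 \<le> \<tau> 0 \<and> mono_on {..n} \<tau> \<longrightarrow>
        prob_space.indep_vars M (\<lambda>_. borel) (\<lambda>i \<omega>. B (\<tau> (Suc i)) \<omega> - B (\<tau> i) \<omega>) {..<n}) \<and>
     (AE \<omega> in M. continuous_on {0..} (\<lambda>t. B t \<omega>))"

definition step_function :: "nat \<Rightarrow> (nat \<Rightarrow> real) \<Rightarrow> (nat \<Rightarrow> real) \<Rightarrow> real \<Rightarrow> real" where
  "step_function n \<tau> c s = (\<Sum>i<n. c i * indicator {\<tau> i<..\<tau> (Suc i)} s)"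

definition step_integral ::
    "(real \<Rightarrow> 'a \<Rightarrow> real) \<Rightarrow> nat \<Rightarrow> (nat \<Rightarrow> real) \<Rightarrow> (nat \<Rightarrow> real) \<Rightarrow> 'a \<Rightarrow> real" where
  "step_integral B n \<tau> c \<omega> = (\<Sum>i<n. c i * (B (\<tau> (Suc i)) \<omega> - B (\<tau> i) \<omega>))"

text \<open>
  \<open>Y\<close> is a version of the Ito integral of the deterministic integrand \<open>\<sigma>\<close> over \<open>[0, t]\<close>:
  the \<open>L\<^sup>2(P)\<close> limit of the integrals of step functions approximating \<open>\<sigma>\<close> in \<open>L\<^sup>2(0, t)\<close>.
  By the isometry on step functions, \<open>Y\<close> does not depend, up to null sets, on the
  approximating sequence.
\<close>

definition is_stochastic_integral ::
    "'a measure \<Rightarrow> (real \<Rightarrow> 'a \<Rightarrow> real) \<Rightarrow> (real \<Rightarrow> real) \<Rightarrow> real \<Rightarrow> ('a \<Rightarrow> real) \<Rightarrow> bool" where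
  "is_stochastic_integral M B \<sigma> t Y \<longleftrightarrow>
     Y \<in> borel_measurable M \<and>
     (\<exists>(n :: nat \<Rightarrow> nat) (\<tau> :: nat \<Rightarrow> nat \<Rightarrow> real) (c :: nat \<Rightarrow> nat \<Rightarrow> real).
        (\<forall>k. 0 \<le> \<tau> k 0 \<and> mono_on {..n k} (\<tau> k) \<and> \<tau> k (n k) \<le> t) \<and>
        (\<lambda>k. \<integral>\<^sup>+s\<in>{0..t}. ennreal ((step_function (n k) (\<tau> k) (c k) s - \<sigma> s)\<^sup>2) \<partial>lborel)
          \<longlonglongrightarrow> 0 \<and>
        (\<lambda>k. \<integral>\<^sup>+\<omega>. ennreal ((step_integral B (n k) (\<tau> k) (c k) \<omega> - Y \<omega>)\<^sup>2) \<partial>M)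
          \<longlonglongrightarrow> 0)"

text \<open>
  Continuous adapted solutions of \<open>dX(t) = -f(X(t)) dt + \<sigma>(t) dB(t)\<close>, \<open>X(0) = \<xi>\<close>; the process
  \<open>J\<close> is a continuous version of the stochastic integral of \<open>\<sigma>\<close>.
\<close>

definition is_sde_solution ::
    "'a measure \<Rightarrow> (real \<Rightarrow> 'a \<Rightarrow> real) \<Rightarrow> (real \<Rightarrow> real) \<Rightarrow> (real \<Rightarrow> real) \<Rightarrow> real \<Rightarrow>
     (real \<Rightarrow> 'a \<Rightarrow> real) \<Rightarrow> bool" where
  "is_sde_solution M B f \<sigma> \<xi> X \<longleftrightarrow>
     (\<forall>t\<ge>0. X t \<in> borel_measurable (natural_algebra M B {0..t})) \<and>
     (AE \<omega> in M. continuous_on {0..} (\<lambda>t. X t \<omega>)) \<and>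
     (\<exists>J. (\<forall>t\<ge>0. is_stochastic_integral M B \<sigma> t (J t)) \<and>
          (AE \<omega> in M. continuous_on {0..} (\<lambda>t. J t \<omega>)) \<and>
          (AE \<omega> in M. X 0 \<omega> = \<xi> \<and>
             (\<forall>t\<ge>0. X t \<omega> = \<xi> - integral {0..t} (\<lambda>s. f (X s \<omega>)) + J t \<omega>)))"

definition F_fun :: "(real \<Rightarrow> real) \<Rightarrow> real \<Rightarrow> real" where
  "F_fun f x = (LBINT u=ereal x..1. 1 / f u)"

definition F_inv :: "(real \<Rightarrow> real) \<Rightarrow> real \<Rightarrow> real" where
  "F_inv f = the_inv_into {0<..} (F_fun f)"

definition Phi_lower :: "(real \<Rightarrow> real) \<Rightarrow> real \<Rightarrow> ereal" where
  "Phi_lower f \<epsilon> = Liminf (at_right 0) (\<lambda>x. ereal (f ((1 - \<epsilon>) * x) / f x))"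

end

theory Submission
  imports Defs "HOL-Real_Asymp.Real_Asymp"
begin

text \<open>
  Put \<open>\<phi> = F\<^sup>-\<^sup>1\<close>, so that \<open>\<phi>' = - f \<phi>\<close>, let \<open>V t = \<integral>\<^sub>t\<^sup>\<infinity> \<sigma>\<^sup>2\<close>, and let \<open>J\<close> be the stochastic integral of \<open>\<sigma>\<close>.
  Up to constants, the law of the iterated logarithm says that the increments of \<open>J\<close> after time \<open>t\<close>
  have size \<open>\<surd>(V t ln ln (1 / V t))\<close>; the upper half comes from Ottaviani's inequality and the lower
  half from independence, both along times \<open>s n\<close> with \<open>V (s n) = V 0 / 2\<^sup>n\<close>. The limit \<open>\<mu>\<close> compares
  this size with \<open>\<phi> t\<close>.

  If \<open>X / \<phi>\<close> tends to \<open>-1\<close>, \<open>0\<close> or \<open>1\<close>, integrating the equation shows that the increments of \<open>J\<close> after \<open>t\<close>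
  are \<open>o(\<phi> t)\<close>; if \<open>X / \<phi>\<close> is bounded, they are \<open>O(\<phi> t)\<close>. The lower half excludes the former for \<open>\<mu> > 0\<close>
  and the latter for \<open>\<mu> = \<infinity>\<close>. If \<open>\<mu> = 0\<close>, then \<open>J\<close> converges with \<open>U t = J \<infinity> - J t = o(\<phi> t)\<close>, and
  \<open>Y = X + U\<close> solves \<open>Y' = - f (Y - U)\<close> pathwise. By the assumptions on \<open>f\<close>, for \<open>a \<notin> {-1, 0, 1}\<close> the graph of \<open>Y\<close>
  crosses that of \<open>a \<phi>\<close> in one direction only, so \<open>Y / \<phi>\<close> converges; limits other than \<open>-1\<close>, \<open>0\<close>, \<open>1\<close> are excluded by
  comparing \<open>Y\<close> with multiples of \<open>\<phi>\<close>.
\<close>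

section \<open>The deterministic equation\<close>

text \<open>The stochastic integral is known only through its definition: \<open>J t\<close> is an
  L2 limit of step integrals, while independence and normality are given for increments of
  \<open>B\<close>. Each probability estimate therefore replaces finitely many increments of
  \<open>J\<close> by independent normal sums \<open>G j\<close>, with an L2 error that is sent to 0
  at the end of the estimate. Path continuity then leads from dyadic grids to all times.

  Constants may be crude: for \<mu> = 0 the noise lies below every multiple of \<phi>, for 0 < \<mu>
  < \<infinity> some multiple of \<phi> is enough to contradict o(\<phi>), and for \<mu> =
  \<infinity> the noise beats every multiple.

  \<open>X\<close> is merely continuous, whereas \<open>Y\<close> is differentiable. The price is a
  drift evaluated at \<open>Y - U\<close>, so each strict inequality between f (a \<phi>) and a f
  \<phi> must survive a small change of a. The limit superior hypothesis gives strictness, and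
  \<open>Phi_lower\<close> tending to 1 gives the room. At a = 0 and a = 1, -1 there is equality,
  which is why these levels stay exceptional.\<close>

locale drift =
  fixes f :: "real \<Rightarrow> real"
  assumes lipschitz: "local_lipschitz (UNIV :: real set) UNIV (\<lambda>_. f)"
    and mono: "mono f"
    and odd: "f (- x) = - f x"
    and sign: "x \<noteq> 0 \<Longrightarrow> x * f x > 0"
    and Phi_lower_limit: "(Phi_lower f \<longlongrightarrow> 1) (at_right 0)"
    and Limsup_ratio: "\<lbrakk>0 < \<nu>; \<nu> < 1\<rbrakk> \<Longrightarrow> Limsup (at_right 0) (\<lambda>x. ereal (f (\<nu> * x) / f x)) < ereal \<nu>"
begin

lemma zero [simp]: "f 0 = 0"
  using odd[of 0] by simp

lemma pos: "x > 0 \<Longrightarrow> f x > 0"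
  using sign[of x] by (simp add: zero_less_mult_iff)

lemma cont: "continuous_on A f"
  using local_lipschitz_continuous_on[OF lipschitz, of 0] continuous_on_subset by blast

lemma isCont: "isCont f x"
  using cont[of UNIV] by (simp add: continuous_on_eq_continuous_at)

lemma abs_f: "\<bar>f x\<bar> = f \<bar>x\<bar>"
proof (cases "x = 0")
  case False
  then show ?thesis using pos[of x] pos[of "-x"] odd[of x] by (auto simp: abs_if)
qed simp

section \<open>The clock F and the unperturbed solution \<phi>\<close>

abbreviation F where "F \<equiv> F_fun f"
abbreviation \<phi> where "\<phi> \<equiv> F_inv f"

lemma F_DERIV:
  assumes "x > 0"
  shows "(F has_real_derivative - (1 / f x)) (at x)"
proof -
  \<comment> \<open>The base point 1 and, as an interior point, \<open>x\<close> must both lie in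
    \<open>{a..b}\<close>, on which 1 / f is continuous.\<close>
  define a b where "a = min x 1 / 2" and "b = max x 1 + 1"
  have ab: "0 < a" "a < x" "x < b" "a \<le> 1" "1 \<le> b" using assms by (auto simp: a_def b_def)
  have "continuous_on {a..b} (\<lambda>u. 1 / f u)"
    using ab by (intro continuous_on_divide continuous_on_const cont) (metis atLeastAtMost_iff less_le_trans less_irrefl pos)
  from interval_integral_FTC2[OF ab(4,5) this, of x]
  have "((\<lambda>u. LBINT y=1..u. 1 / f y) has_vector_derivative (1 / f x)) (at x within {a..b})"
    using ab by (simp add: one_ereal_def)
  then have "((\<lambda>u. LBINT y=1..u. 1 / f y) has_real_derivative (1 / f x)) (at x within {a..b})"
    by (simp add: has_real_derivative_iff_has_vector_derivative)
  moreover have "at x within {a..b} = at x" using ab by (intro at_within_interior) auto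
  ultimately have "((\<lambda>u. LBINT y=1..u. 1 / f y) has_real_derivative (1 / f x)) (at x)" by simp
  from DERIV_minus[OF this] show ?thesis
    unfolding F_fun_def by (subst interval_integral_endpoints_reverse) (simp add: one_ereal_def)
qed

lemma F_strict_decreasing:
  assumes "0 < x" "x < y" shows "F y < F x"
proof (rule DERIV_neg_imp_decreasing[OF assms(2)])
  fix z assume "x \<le> z" "z \<le> y"
  then have "z > 0" using assms by simp
  then show "\<exists>d. (F has_real_derivative d) (at z) \<and> d < 0"
    using F_DERIV[of z] pos[of z] by (intro exI[of _ "- (1 / f z)"]) auto
qed

lemma F_1 [simp]: "F 1 = 0"
  by (simp add: F_fun_def one_ereal_def)

text \<open>The Lipschitz bound around 0 and f 0 = 0; \<open>L + 1\<close> replaces \<open>L\<close>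
  to get a positive constant. This is what makes 1 / f non-integrable at 0.\<close>

lemma linear_bound_near_0: "\<exists>L u. 0 < L \<and> 0 < u \<and> (\<forall>x. 0 < x \<longrightarrow> x \<le> u \<longrightarrow> f x \<le> L * x)"
proof -
  obtain u L where u: "u > 0" and L: "L-lipschitz_on (cball 0 u) f"
    using local_lipschitzE[OF lipschitz UNIV_I UNIV_I, of 0 0]
    by (metis Int_UNIV_right centre_in_cball less_imp_le)
  have "f x \<le> (L + 1) * x" if "0 < x" "x \<le> u" for x
  proof -
    have "dist (f x) (f 0) \<le> L * dist x 0"
      using that by (intro lipschitz_onD[OF L]) auto
    then show ?thesis using that by (simp add: dist_real_def algebra_simps)
  qed
  moreover have "0 < L + 1" using lipschitz_on_nonneg[OF L] by simp
  ultimately show ?thesis using u by blast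
qed

text \<open>Since f x \<le> L x up to \<open>u\<close>, the function F x + ln x / L is nonincreasing
  there, so F grows at least like - ln x / L.\<close>

lemma F_at_top: "LIM x at_right 0. F x :> at_top"
proof -
  obtain L u where L: "0 < L" and u: "0 < u" and le: "\<And>x. 0 < x \<Longrightarrow> x \<le> u \<Longrightarrow> f x \<le> L * x"
    using linear_bound_near_0 by blast
  have lower: "F u + (ln u - ln x) / L \<le> F x" if "0 < x" "x < u" for x
  proof -
    have "F x + ln x / L \<ge> F u + ln u / L"
    proof (rule DERIV_nonpos_imp_nonincreasing[of x u "\<lambda>x. F x + ln x / L"])
      fix y assume y: "x \<le> y" "y \<le> u"
      then have "0 < y" using that by simp
      then have "((\<lambda>x. F x + ln x / L) has_real_derivative (- (1 / f y) + 1 / y / L)) (at y)"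
        using L by (auto intro!: derivative_eq_intros F_DERIV)
      moreover have "- (1 / f y) + 1 / y / L \<le> 0"
        using le[of y] y \<open>0 < y\<close> L pos[of y] by (simp add: field_simps)
      ultimately show "\<exists>d. ((\<lambda>x. F x + ln x / L) has_real_derivative d) (at y) \<and> d \<le> 0" by blast
    qed (use that in auto)
    then show ?thesis by (simp add: diff_divide_distrib)
  qed
  have "LIM x at_right 0. F u + (ln u - ln x) / L :> at_top"
  proof -
    have "LIM x at_right 0. - ln (x::real) :> at_top"
      using ln_at_0 by (simp add: filterlim_uminus_at_bot)
    then have "LIM x at_right 0. (1/L) * (- ln x) :> at_top"
      using L by (intro filterlim_tendsto_pos_mult_at_top[OF tendsto_const]) auto
    then have "LIM x at_right 0. (F u + ln u / L) + (1/L) * (- ln x) :> at_top"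
      by (intro filterlim_tendsto_add_at_top[OF tendsto_const])
    then show ?thesis by (simp add: diff_divide_distrib algebra_simps)
  qed
  then show ?thesis
  proof (rule filterlim_at_top_mono)
    show "\<forall>\<^sub>F x in at_right 0. F u + (ln u - ln x) / L \<le> F x"
      using eventually_at_right_real[OF u] by eventually_elim (use lower in auto)
  qed
qed

lemma inj_F: "inj_on F {0<..}"
  by (rule linorder_inj_onI) (use F_strict_decreasing in force)+

lemma \<phi>_F: "x > 0 \<Longrightarrow> \<phi> (F x) = x"
  unfolding F_inv_def by (rule the_inv_into_f_f[OF inj_F]) auto

lemma isCont_F: "x > 0 \<Longrightarrow> isCont F x"
  using F_DERIV DERIV_isCont by blast

lemma F_surj:
  assumes "t \<ge> 0" obtains x where "0 < x" "x \<le> 1" "F x = t"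
proof -
  have "\<forall>\<^sub>F x in at_right 0. F x \<ge> t" using F_at_top by (simp add: filterlim_at_top)
  moreover have "\<forall>\<^sub>F x in at_right 0. x \<in> {0<..<1::real}" by (rule eventually_at_right_real) simp
  ultimately have "\<forall>\<^sub>F x in at_right 0. F x \<ge> t \<and> x \<in> {0<..<1::real}" by eventually_elim simp
  then obtain y where y: "F y \<ge> t" "0 < y" "y < 1"
    using eventually_happens[of _ "at_right (0::real)"] by (force simp: trivial_limit_at_right_real)
  have "\<exists>x. y \<le> x \<and> x \<le> 1 \<and> F x = t"
    by (rule IVT2) (use y assms isCont_F in auto)
  then obtain x where "y \<le> x" "x \<le> 1" "F x = t" by blast
  then show ?thesis using y that[of x] by auto
qed

lemma F_\<phi>: "t \<ge> 0 \<Longrightarrow> F (\<phi> t) = t"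
  and \<phi>_pos: "t \<ge> 0 \<Longrightarrow> \<phi> t > 0"
  by (metis F_surj \<phi>_F)+

lemma \<phi>_strict_decreasing:
  assumes "0 \<le> s" "s < t" shows "\<phi> t < \<phi> s"
  using assms F_\<phi>[of s] F_\<phi>[of t] F_strict_decreasing[of "\<phi> s" "\<phi> t"] \<phi>_pos[of s]
  by (cases "\<phi> t" "\<phi> s" rule: linorder_cases) auto

lemma \<phi>_tendsto_0: "(\<phi> \<longlongrightarrow> 0) at_top"
proof (rule order_tendstoI)
  fix e :: real assume "0 < e"
  have "\<phi> t < e" if "t > max 0 (F e)" for t
  proof (rule ccontr)
    assume "\<not> \<phi> t < e"
    then have "F (\<phi> t) \<le> F e" using F_strict_decreasing[of e "\<phi> t"] \<open>0 < e\<close> by (cases "\<phi> t = e") auto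
    then show False using that F_\<phi>[of t] by simp
  qed
  then show "\<forall>\<^sub>F t in at_top. \<phi> t < e"
    using eventually_gt_at_top[of "max 0 (F e)"] by (rule eventually_mono[rotated])
next
  fix e :: real assume "e < 0"
  show "\<forall>\<^sub>F t in at_top. e < \<phi> t"
    using eventually_ge_at_top[of 0] by eventually_elim (metis \<phi>_pos \<open>e < 0\<close> less_trans)
qed

text \<open>Turns every eventual property of f at 0+ into one along \<phi> t for late t.\<close>

lemma \<phi>_at_right: "filterlim \<phi> (at_right 0) at_top"
proof -
  have "\<forall>\<^sub>F t in at_top. 0 < \<phi> t"
    using eventually_ge_at_top[of 0] by eventually_elim (use \<phi>_pos in auto)
  then show ?thesis unfolding filterlim_at using \<phi>_tendsto_0 by (auto elim!: eventually_mono)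
qed

lemma scaled_\<phi>_at_right: "c > 0 \<Longrightarrow> filterlim (\<lambda>t. c * \<phi> t) (at_right 0) at_top"
proof -
  assume c: "c > 0"
  have "((\<lambda>t. c * \<phi> t) \<longlongrightarrow> 0) at_top" using tendsto_mult_left[OF \<phi>_tendsto_0, of c] by simp
  moreover have "\<forall>\<^sub>F t in at_top. 0 < c * \<phi> t"
    using eventually_ge_at_top[of 0] by eventually_elim (use c \<phi>_pos in auto)
  ultimately show ?thesis unfolding filterlim_at by (auto elim!: eventually_mono)
qed

lemma \<phi>_DERIV:
  assumes "t > 0"
  shows "(\<phi> has_real_derivative - f (\<phi> t)) (at t)"
proof -
  define x where "x = \<phi> t"
  have x: "x > 0" "F x = t" using assms \<phi>_pos F_\<phi> by (auto simp: x_def)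
  have "isCont \<phi> (F x)"
    by (rule isCont_inverse_function2[of "x/2" x "2*x"]) (use x \<phi>_F isCont_F in auto)
  then have "(\<phi> has_real_derivative inverse (- (1 / f x))) (at t)"
    by (intro DERIV_inverse_function[where a = 0 and b = "t+1"])
      (use x assms F_\<phi> pos[of x] F_DERIV[of x] in \<open>auto simp: x_def[symmetric]\<close>)
  then show ?thesis using pos[OF x(1)] by (simp add: x_def)
qed

section \<open>Ratio bounds for f near 0\<close>

lemma eventually_scale_at_right:
  assumes "eventually P (at_right (0::real))" "c > 0"
  shows "\<forall>\<^sub>F x in at_right 0. P (c * x)"
proof -
  have "filterlim (\<lambda>x. c * x) (at_right 0) (at_right (0::real))"
    unfolding filterlim_at
    using assms(2) by (auto intro!: tendsto_eq_intros simp: eventually_at_filter)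
  then show ?thesis using assms(1) by (simp add: filterlim_iff)
qed

lemma eventually_pos: "\<forall>\<^sub>F x in at_right 0. 0 < (x::real)"
  by (simp add: eventually_at_filter)

text \<open>A real \<open>r\<close> fits strictly between the limit superior and \<nu>; the maximum
  with \<open>\<nu>/2\<close> only makes the factor positive.\<close>

lemma ratio_below:
  assumes "0 < \<nu>" "\<nu> < 1"
  obtains q where "0 < q" "q < \<nu>" "\<forall>\<^sub>F x in at_right 0. f (\<nu> * x) \<le> q * f x"
proof -
  obtain r where r: "Limsup (at_right 0) (\<lambda>x. ereal (f (\<nu> * x) / f x)) < ereal r" "ereal r < ereal \<nu>"
    using ereal_dense2[OF Limsup_ratio[OF assms]] by blast
  define q where "q = max r (\<nu>/2)"
  from Limsup_lessD[OF r(1)] eventually_pos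
  have "\<forall>\<^sub>F x in at_right 0. f (\<nu> * x) \<le> q * f x"
  proof eventually_elim
    case (elim x)
    then have "f (\<nu> * x) \<le> r * f x" using pos[of x] by (simp add: field_simps)
    also have "\<dots> \<le> q * f x" using pos[OF elim(2)] by (intro mult_right_mono) (auto simp: q_def)
    finally show ?case .
  qed
  then show ?thesis using that[of q] r assms by (auto simp: q_def)
qed

text \<open>As \<open>Phi_lower f\<close> tends to 1, some small \<epsilon> has its lower limit
  above 1 - \<eta>. This acts as a relative continuity of f at 0+.\<close>

lemma ratio_near_one:
  assumes "0 < \<eta>"
  obtains \<epsilon> where "0 < \<epsilon>" "\<epsilon> < 1" "\<forall>\<^sub>F x in at_right 0. (1 - \<eta>) * f x \<le> f ((1 - \<epsilon>) * x)"
proof -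
  have "\<forall>\<^sub>F e in at_right 0. ereal (1 - \<eta>) < Phi_lower f e"
    using Phi_lower_limit by (rule order_tendstoD) (use assms in \<open>simp add: one_ereal_def\<close>)
  moreover have "\<forall>\<^sub>F x in at_right 0. x \<in> {0<..<1::real}" by (rule eventually_at_right_real) simp
  ultimately have "\<forall>\<^sub>F e in at_right 0. ereal (1 - \<eta>) < Phi_lower f e \<and> e \<in> {0<..<1}" by eventually_elim simp
  then obtain e where e: "ereal (1 - \<eta>) < Phi_lower f e" "0 < e" "e < 1"
    using eventually_happens[of _ "at_right (0::real)"] by (force simp: trivial_limit_at_right_real)
  from less_LiminfD[OF e(1)[unfolded Phi_lower_def]] eventually_pos
  have "\<forall>\<^sub>F x in at_right 0. (1 - \<eta>) * f x \<le> f ((1 - e) * x)"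
  proof eventually_elim
    case (elim x)
    then have "1 - \<eta> < f ((1 - e) * x) / f x" by simp
    then show ?case using pos[OF elim(2)] by (simp only: pos_less_divide_eq)
  qed
  then show ?thesis using that e by blast
qed

text \<open>With b = a / (1 - e), \<open>ratio_near_one\<close> at the argument b x compares f (b x)
  with f (a x). The slack \<epsilon> = b - a later absorbs the perturbation
  \<open>U\<close>.\<close>

lemma ratio_below_perturbed:
  assumes "0 < a" "a < 1"
  obtains \<epsilon> q where "0 < \<epsilon>" "0 < q" "q < a" "\<forall>\<^sub>F x in at_right 0. f ((a + \<epsilon>) * x) \<le> q * f x"
proof -
  obtain q where q: "0 < q" "q < a" and ev: "\<forall>\<^sub>F x in at_right 0. f (a * x) \<le> q * f x"
    using ratio_below[OF assms] by blast
  \<comment> \<open>\<eta> satisfies 1 - \<eta> = q / r, so the loss from moving the argument raises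
    the factor from q exactly to r, halfway to a.\<close>
  define r \<eta> where "r = (q + a) / 2" and "\<eta> = 1 - q / r"
  have r: "q < r" "r < a" using q by (auto simp: r_def)
  then have \<eta>: "0 < \<eta>" "\<eta> < 1" using q by (auto simp: \<eta>_def field_simps)
  obtain e where e: "0 < e" "e < 1" and ev2: "\<forall>\<^sub>F x in at_right 0. (1 - \<eta>) * f x \<le> f ((1 - e) * x)"
    using ratio_near_one[OF \<eta>(1)] by blast
  define b where "b = a / (1 - e)"
  have b: "a < b" "(1 - e) * b = a" using e assms by (auto simp: b_def field_simps)
  have "b > 0" using b assms by simp
  from eventually_scale_at_right[OF ev2 this] ev
  have "\<forall>\<^sub>F x in at_right 0. f (b * x) \<le> r * f x"
  proof (eventually_elim)
    case (elim x)
    have "(1 - e) * (b * x) = a * x" by (simp only: b(2) mult.assoc[symmetric])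
    moreover have "1 - \<eta> = q / r" by (simp add: \<eta>_def)
    ultimately have "(q / r) * f (b * x) \<le> f (a * x)" using elim(1) by (simp only:)
    then have "(q / r) * f (b * x) \<le> q * f x" using elim(2) by linarith
    then show ?case using q r by (simp add: field_simps)
  qed
  then show ?thesis using that[of "b - a" r] q r b by auto
qed

text \<open>The bound for \<nu> = 1 / a, read at the argument a x, gives f (a x) \<ge> p f x with p
  = 1 / q > a. Lowering the argument by the factor 1 - e costs a factor r / p and leaves r >
  a.\<close>

lemma ratio_above_perturbed:
  assumes "1 < a"
  obtains \<epsilon> q where "0 < \<epsilon>" "\<epsilon> < a" "a < q" "\<forall>\<^sub>F x in at_right 0. q * f x \<le> f ((a - \<epsilon>) * x)"
proof -
  obtain q where q: "0 < q" "q < 1 / a" and ev: "\<forall>\<^sub>F x in at_right 0. f (1 / a * x) \<le> q * f x"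
    using ratio_below[of "1 / a"] assms by auto
  define p where "p = 1 / q"
  have p: "a < p" using q assms by (simp add: p_def field_simps)
  define r \<eta> where "r = (p + a) / 2" and "\<eta> = 1 - r / p"
  have r: "a < r" "r < p" using p by (auto simp: r_def)
  then have \<eta>: "0 < \<eta>" using p assms by (auto simp: \<eta>_def field_simps)
  obtain e where e: "0 < e" "e < 1" and ev2: "\<forall>\<^sub>F x in at_right 0. (1 - \<eta>) * f x \<le> f ((1 - e) * x)"
    using ratio_near_one[OF \<eta>(1)] by blast
  have "a > 0" using assms by simp
  from eventually_scale_at_right[OF ev this] eventually_scale_at_right[OF ev2 this]
  have "\<forall>\<^sub>F x in at_right 0. r * f x \<le> f ((a - a * e) * x)"
  proof (eventually_elim)
    case (elim x)
    have "p * f x \<le> f (a * x)" using elim(1) assms q by (simp add: p_def field_simps)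
    then have "r / p * (p * f x) \<le> r / p * f (a * x)" using p r assms by (intro mult_left_mono) auto
    also have "\<dots> \<le> f ((1 - e) * (a * x))" using elim(2) by (simp add: \<eta>_def)
    finally show ?case using p assms by (simp add: algebra_simps)
  qed
  then show ?thesis using that[of "a * e" r] e r assms by auto
qed

text \<open>Enlarging the argument by the fixed factor b > 1 at most doubles f, and finitely many
  such steps reach K.\<close>

lemma ratio_bounded:
  assumes "0 < K"
  obtains C where "0 < C" "\<forall>\<^sub>F x in at_right 0. f (K * x) \<le> C * f x"
proof -
  obtain e where e: "0 < e" "e < 1" and ev: "\<forall>\<^sub>F x in at_right 0. (1 - 1/2) * f x \<le> f ((1 - e) * x)"
    using ratio_near_one[of "1/2"] by auto
  define b where "b = 1 / (1 - e)"
  have b: "1 < b" "(1 - e) * b = 1" using e by (auto simp: b_def)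
  have step: "\<forall>\<^sub>F x in at_right 0. f (b ^ n * x) \<le> 2 ^ n * f x" for n
  proof (induction n)
    case (Suc n)
    from eventually_scale_at_right[OF ev, of "b ^ Suc n"] b(1)
    have "\<forall>\<^sub>F x in at_right 0. f (b ^ Suc n * x) \<le> 2 * f ((1 - e) * (b ^ Suc n * x))"
      by (auto elim!: eventually_mono)
    then show ?case using Suc
    proof eventually_elim
      case (elim x)
      have "(1 - e) * (b ^ Suc n * x) = ((1 - e) * b) * b ^ n * x" by simp
      then have "(1 - e) * (b ^ Suc n * x) = b ^ n * x" by (simp only: b(2))
      with elim(1) have "f (b ^ Suc n * x) \<le> 2 * f (b ^ n * x)" by (simp only:)
      with elim(2) show ?case by simp
    qed
  qed simp
  obtain n where n: "K < b ^ n" using real_arch_pow[OF b(1)] by blast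
  from step[of n] eventually_pos have "\<forall>\<^sub>F x in at_right 0. f (K * x) \<le> 2 ^ n * f x"
  proof eventually_elim
    case (elim x)
    have "f (K * x) \<le> f (b ^ n * x)" using n elim by (intro monoD[OF mono]) auto
    then show ?case using elim by linarith
  qed
  then show ?thesis using that[of "2 ^ n"] by auto
qed

end

section \<open>Crossings and convergence on the real line\<close>

text \<open>Suppose h t > 0. At the last time of [t1, t] with h \<le> 0, continuity forces h = 0,
  and the negative derivative there keeps h below 0 a little longer, a contradiction.\<close>

lemma downcrossing:
  fixes h :: "real \<Rightarrow> real"
  assumes h: "\<And>t. T \<le> t \<Longrightarrow> (h has_real_derivative h' t) (at t)"
    and neg: "\<And>t. T \<le> t \<Longrightarrow> h t = 0 \<Longrightarrow> h' t < 0"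
    and "T \<le> t1" "h t1 \<le> 0" "t1 \<le> t"
  shows "h t \<le> 0"
proof (rule ccontr)
  assume pos: "\<not> h t \<le> 0"
  define S where "S = {s \<in> {t1..t}. h s \<le> 0}"
  have cont: "continuous_on {t1..t} h"
    by (intro continuous_at_imp_continuous_on ballI DERIV_isCont[OF h]) (use assms in auto)
  then have "compact S" unfolding S_def
    by (intro compact_eq_bounded_closed[THEN iffD2] conjI bounded_subset[OF bounded_closed_interval[of t1 t]]
        continuous_closed_preimage[of _ h "{..0}", unfolded vimage_def Int_def, simplified] continuous_on_closed_Collect_le) auto
  moreover have "t1 \<in> S" using assms by (auto simp: S_def)
  ultimately obtain s where s: "s \<in> S" "\<And>u. u \<in> S \<Longrightarrow> u \<le> s"
    using compact_attains_sup[of S] by blast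
  have st: "t1 \<le> s" "s < t" "h s \<le> 0" using s(1) pos by (auto simp: S_def less_le)
  have "h s = 0"
  proof (rule ccontr)
    assume "h s \<noteq> 0"
    have "\<exists>u\<ge>s. u \<le> t \<and> h u = 0"
      using st pos assms by (intro IVT) (auto intro!: DERIV_isCont[OF h])
    then obtain u where "s \<le> u" "u \<le> t" "h u = 0" by blast
    then show False using s(2)[of u] st \<open>h s \<noteq> 0\<close> by (auto simp: S_def)
  qed
  then obtain d where d: "d > 0" "\<And>k. 0 < k \<Longrightarrow> k < d \<Longrightarrow> h (s + k) < h s"
    using DERIV_neg_dec_right[OF h[of s] neg[of s]] st assms by auto
  define k where "k = min (d/2) (t - s)"
  have k: "0 < k" "k < d" "s + k \<le> t" using d st by (auto simp: k_def)
  have "s + k \<in> S" using d(2)[OF k(1,2)] k st \<open>h s = 0\<close> by (auto simp: S_def)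
  then show False using s(2) k by fastforce
qed

text \<open>The limit is the supremum of the levels that Z eventually stays above. A finite
  exceptional set does no harm, because every interval above the supremum contains a level outside
  E.\<close>

lemma convergent_if_levels:
  fixes Z :: "real \<Rightarrow> real"
  assumes bound: "\<forall>\<^sub>F t in at_top. a \<le> Z t" "\<forall>\<^sub>F t in at_top. Z t \<le> b"
    and "finite E"
    and level: "\<And>x. x \<notin> E \<Longrightarrow> (\<forall>\<^sub>F t in at_top. x \<le> Z t) \<or> (\<forall>\<^sub>F t in at_top. Z t \<le> x)"
  shows "\<exists>l. (Z \<longlongrightarrow> l) at_top"
proof -
  define S where "S = {x. \<forall>\<^sub>F t in at_top. x \<le> Z t}"
  have a: "a \<in> S" using bound by (simp add: S_def)
  have le: "x \<le> b" if "x \<in> S" for x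
  proof -
    have "\<forall>\<^sub>F t in at_top. x \<le> Z t" using that by (simp add: S_def)
    then have "\<forall>\<^sub>F t in (at_top::real filter). x \<le> b" using bound(2) by eventually_elim simp
    then show ?thesis by simp
  qed
  then have bdd: "bdd_above S" by (rule bdd_aboveI)
  have "(Z \<longlongrightarrow> Sup S) at_top"
  proof (rule order_tendstoI)
    fix x assume "x < Sup S"
    then obtain y where "y \<in> S" "x < y" using less_cSup_iff[of S x] a bdd by blast
    then have "\<forall>\<^sub>F t in at_top. y \<le> Z t" by (simp add: S_def)
    then show "\<forall>\<^sub>F t in at_top. x < Z t" by eventually_elim (use \<open>x < y\<close> in simp)
  next
    fix x assume "Sup S < x"
    then have "infinite ({Sup S<..<x} - E)" using \<open>finite E\<close> by simp
    then obtain y where y: "y \<in> {Sup S<..<x} - E" using infinite_imp_nonempty by blast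
    then have "y \<notin> S" using cSup_upper[OF _ bdd, of y] by auto
    then have "\<forall>\<^sub>F t in at_top. Z t \<le> y" using level[of y] y by (auto simp: S_def)
    then show "\<forall>\<^sub>F t in at_top. Z t < x" by eventually_elim (use y in auto)
  qed
  then show ?thesis by blast
qed

section \<open>Noise increments read off from a given path\<close>

context drift begin

lemma integral_DERIV:
  assumes "continuous_on {0..} X" "t > 0"
  shows "((\<lambda>t. integral {0..t} (\<lambda>s. f (X s))) has_real_derivative f (X t)) (at t)"
proof -
  have "continuous_on {0..t+1} (\<lambda>s. f (X s))"
    by (rule continuous_on_compose2[OF cont[of UNIV] continuous_on_subset[OF assms(1)]]) auto
  from integral_has_real_derivative[OF this, of t]
  have "((\<lambda>t. integral {0..t} (\<lambda>s. f (X s))) has_real_derivative f (X t)) (at t within {0..t+1})"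
    using assms by simp
  moreover have "at t within {0..t+1} = at t" using assms by (intro at_within_interior) auto
  ultimately show ?thesis by simp
qed

text \<open>Because \<phi>' = - f \<phi>, the primitive \<open>H\<close> of f X - l f \<phi> changes
  by at most \<eta> (\<phi> s - \<phi> t), and J t - J s is the change of X - l \<phi> plus that of
  H. With l = 0 this covers mere boundedness, with l in {-1, 0, 1} convergence.\<close>

lemma noise_increment_bound:
  assumes X: "continuous_on {0..} X"
    and eq: "\<And>t. t \<ge> 0 \<Longrightarrow> X t = \<xi> - integral {0..t} (\<lambda>s. f (X s)) + J t"
    and near: "\<forall>\<^sub>F t in at_top. \<bar>X t - l * \<phi> t\<bar> \<le> \<kappa> * \<phi> t"
    and drift: "\<forall>\<^sub>F t in at_top. \<bar>f (X t) - l * f (\<phi> t)\<bar> \<le> \<eta> * f (\<phi> t)"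
  shows "\<forall>\<^sub>F s in at_top. \<forall>t\<ge>s. \<bar>J t - J s\<bar> \<le> (2 * \<kappa> + \<eta>) * \<phi> s"
proof -
  from near drift eventually_gt_at_top[of 0]
  have "\<forall>\<^sub>F t in at_top. \<bar>X t - l * \<phi> t\<bar> \<le> \<kappa> * \<phi> t \<and> \<bar>f (X t) - l * f (\<phi> t)\<bar> \<le> \<eta> * f (\<phi> t) \<and> 0 < t"
    by eventually_elim auto
  then obtain T where T: "\<And>t. t \<ge> T \<Longrightarrow> \<bar>X t - l * \<phi> t\<bar> \<le> \<kappa> * \<phi> t"
    "\<And>t. t \<ge> T \<Longrightarrow> \<bar>f (X t) - l * f (\<phi> t)\<bar> \<le> \<eta> * f (\<phi> t)" "\<And>t. t \<ge> T \<Longrightarrow> 0 < t"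
    by (auto simp: eventually_at_top_linorder)
  define H where "H t = integral {0..t} (\<lambda>s. f (X s)) + l * \<phi> t" for t
  have H: "(H has_real_derivative f (X t) - l * f (\<phi> t)) (at t)" if "t \<ge> T" for t
    unfolding H_def using T(3)[OF that]
    by (auto intro!: derivative_eq_intros integral_DERIV[OF X] \<phi>_DERIV)
  have main: "\<bar>J t - J s\<bar> \<le> (2 * \<kappa> + \<eta>) * \<phi> s" if st: "T \<le> s" "s \<le> t" for s t
  proof -
    have "H t + \<eta> * \<phi> t \<le> H s + \<eta> * \<phi> s"
    proof (rule DERIV_nonpos_imp_nonincreasing[OF st(2)])
      fix u assume "s \<le> u" "u \<le> t"
      then have u: "T \<le> u" using st by simp
      then have "((\<lambda>t. H t + \<eta> * \<phi> t) has_real_derivative (f (X u) - l * f (\<phi> u) + \<eta> * - f (\<phi> u))) (at u)"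
        using T(3)[OF u] by (auto intro!: derivative_eq_intros H \<phi>_DERIV)
      moreover have "f (X u) - l * f (\<phi> u) + \<eta> * - f (\<phi> u) \<le> 0" using T(2)[OF u] by auto
      ultimately show "\<exists>y. ((\<lambda>t. H t + \<eta> * \<phi> t) has_real_derivative y) (at u) \<and> y \<le> 0" by blast
    qed
    moreover have "H s - \<eta> * \<phi> s \<le> H t - \<eta> * \<phi> t"
    proof (rule DERIV_nonneg_imp_nondecreasing[OF st(2)])
      fix u assume "s \<le> u" "u \<le> t"
      then have u: "T \<le> u" using st by simp
      then have "((\<lambda>t. H t - \<eta> * \<phi> t) has_real_derivative (f (X u) - l * f (\<phi> u) - \<eta> * - f (\<phi> u))) (at u)"
        using T(3)[OF u] by (auto intro!: derivative_eq_intros H \<phi>_DERIV)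
      moreover have "f (X u) - l * f (\<phi> u) - \<eta> * - f (\<phi> u) \<ge> 0" using T(2)[OF u] by auto
      ultimately show "\<exists>y. ((\<lambda>t. H t - \<eta> * \<phi> t) has_real_derivative y) (at u) \<and> 0 \<le> y" by blast
    qed
    \<comment> \<open>The signs of \<eta> and \<kappa> are read off from the two bounds, whose left
      sides are nonnegative.\<close>
    moreover have "0 \<le> \<eta> * \<phi> t" "0 \<le> \<kappa> * \<phi> t"
    proof -
      have "0 < t" using T(3) st by simp
      have "0 \<le> \<eta> * f (\<phi> t)" using T(2)[of t] st by linarith
      then have "0 \<le> \<eta>" using pos[OF \<phi>_pos, of t] \<open>0 < t\<close> by (simp add: zero_le_mult_iff)
      then show "0 \<le> \<eta> * \<phi> t" using \<phi>_pos[of t] \<open>0 < t\<close> by simp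
      show "0 \<le> \<kappa> * \<phi> t" using T(1)[of t] st by linarith
    qed
    moreover have "\<kappa> * \<phi> t \<le> \<kappa> * \<phi> s"
    proof -
      have "0 < t" "0 < s" using T(3) st by auto
      then have "0 \<le> \<kappa>" using \<open>0 \<le> \<kappa> * \<phi> t\<close> \<phi>_pos[of t] by (simp add: zero_le_mult_iff)
      moreover have "\<phi> t \<le> \<phi> s" using \<phi>_strict_decreasing[of s t] st \<open>0 < s\<close> by (cases "s = t") auto
      ultimately show ?thesis by (simp add: mult_left_mono)
    qed
    moreover have "J t - J s = (X t - l * \<phi> t) - (X s - l * \<phi> s) + (H t - H s)"
      using eq[of t] eq[of s] T(3)[of s] T(3)[of t] st by (simp add: H_def)
    moreover have "\<bar>X t - l * \<phi> t\<bar> \<le> \<kappa> * \<phi> t" "\<bar>X s - l * \<phi> s\<bar> \<le> \<kappa> * \<phi> s" using T(1) st by auto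
    ultimately show ?thesis unfolding distrib_right by linarith
  qed
  then show ?thesis by (auto simp: eventually_at_top_linorder)
qed

text \<open>For these l one has f (l \<phi>) = l f \<phi>, so only continuity at that ratio is at
  stake. For l = 1, X lies between (1 - e) \<phi> and \<phi> / (1 - e), where f changes little;
  oddness gives l = -1. For l = 0, |X| \<le> \<nu> \<phi> makes |f X| at most q f \<phi> with q <
  \<nu> \<le> \<eta>.\<close>

lemma f_ratio_tendsto:
  assumes lim: "((\<lambda>t. X t / \<phi> t) \<longlongrightarrow> l) at_top" and l: "l \<in> {-1, 0, 1}"
    and "0 < \<eta>"
  shows "\<forall>\<^sub>F t in at_top. \<bar>f (X t) - l * f (\<phi> t)\<bar> \<le> \<eta> * f (\<phi> t)"
proof -
  have at_one: "\<forall>\<^sub>F t in at_top. \<bar>f (W t) - f (\<phi> t)\<bar> \<le> \<eta> * f (\<phi> t)"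
    if "((\<lambda>t. W t / \<phi> t) \<longlongrightarrow> 1) at_top" for W :: "real \<Rightarrow> real"
  proof -
    \<comment> \<open>Chosen so that 1 / (1 - \<delta>) = 1 + \<eta>, which is the factor lost in
      the upper bound at \<open>b * \<phi> t\<close>.\<close>
    define \<delta> where "\<delta> = \<eta> / (1 + \<eta>)"
    have \<delta>: "0 < \<delta>" "\<delta> \<le> \<eta>" "(1 + \<eta>) * (1 - \<delta>) = 1" using \<open>0 < \<eta>\<close> by (auto simp: \<delta>_def field_simps)
    obtain e where e: "0 < e" "e < 1" and ev: "\<forall>\<^sub>F x in at_right 0. (1 - \<delta>) * f x \<le> f ((1 - e) * x)"
      using ratio_near_one[OF \<delta>(1)] by blast
    define b where "b = 1 / (1 - e)"
    have b: "b > 1" "(1 - e) * b = 1" using e by (auto simp: b_def)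
    have "\<forall>\<^sub>F t in at_top. W t / \<phi> t < b" "\<forall>\<^sub>F t in at_top. 1 - e < W t / \<phi> t"
      using order_tendstoD[OF that] b e by auto
    moreover have "\<forall>\<^sub>F t in at_top. (1 - \<delta>) * f (\<phi> t) \<le> f ((1 - e) * \<phi> t)"
      by (rule eventually_compose_filterlim[OF ev \<phi>_at_right])
    moreover have "\<forall>\<^sub>F t in at_top. (1 - \<delta>) * f (b * \<phi> t) \<le> f ((1 - e) * (b * \<phi> t))"
      using eventually_compose_filterlim[OF ev scaled_\<phi>_at_right[of b]] b by simp
    ultimately show ?thesis using eventually_ge_at_top[of 0]
    proof eventually_elim
      case (elim t)
      have p: "\<phi> t > 0" and fp: "f (\<phi> t) > 0" using elim \<phi>_pos pos by auto
      have "(1 - e) * \<phi> t \<le> W t" "W t \<le> b * \<phi> t" using elim(1,2) p by (simp_all add: field_simps)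
      then have "f ((1 - e) * \<phi> t) \<le> f (W t)" "f (W t) \<le> f (b * \<phi> t)" using mono by (auto dest: monoD)
      moreover have "f (b * \<phi> t) \<le> (1 + \<eta>) * f (\<phi> t)"
      proof -
        have "(1 - e) * (b * \<phi> t) = \<phi> t" by (simp only: mult.assoc[symmetric] b(2) mult_1)
        then have "(1 - \<delta>) * f (b * \<phi> t) \<le> f (\<phi> t)" using elim(4) by (simp only:)
        then have "(1 + \<eta>) * ((1 - \<delta>) * f (b * \<phi> t)) \<le> (1 + \<eta>) * f (\<phi> t)"
          using \<open>0 < \<eta>\<close> by (intro mult_left_mono) auto
        then show ?thesis by (simp only: mult.assoc[symmetric] \<delta>(3) mult_1)
      qed
      moreover have "(1 - \<eta>) * f (\<phi> t) \<le> (1 - \<delta>) * f (\<phi> t)" using \<delta> fp by (intro mult_right_mono) auto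
      ultimately show ?case using elim(3) by (simp add: abs_le_iff algebra_simps)
    qed
  qed
  consider "l = 1" | "l = -1" | "l = 0" using l by auto
  then show ?thesis
  proof cases
    case 1
    then show ?thesis using at_one[of X] lim by simp
  next
    case 2
    have "((\<lambda>t. - X t / \<phi> t) \<longlongrightarrow> 1) at_top" using tendsto_minus[OF lim] 2 by simp
    from at_one[OF this] show ?thesis
      by (rule eventually_mono) (use 2 in \<open>auto simp: odd abs_if split: if_splits\<close>)
  next
    case 3
    define \<nu> where "\<nu> = min (\<eta> / 2) (1 / 2)"
    have \<nu>: "0 < \<nu>" "\<nu> < 1" "\<nu> \<le> \<eta>" using \<open>0 < \<eta>\<close> by (auto simp: \<nu>_def)
    obtain q where q: "0 < q" "q < \<nu>" and ev: "\<forall>\<^sub>F x in at_right 0. f (\<nu> * x) \<le> q * f x"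
      using ratio_below[OF \<nu>(1,2)] by blast
    have "\<forall>\<^sub>F t in at_top. f (\<nu> * \<phi> t) \<le> q * f (\<phi> t)"
      by (rule eventually_compose_filterlim[OF ev \<phi>_at_right])
    moreover have "\<forall>\<^sub>F t in at_top. X t / \<phi> t < \<nu>" "\<forall>\<^sub>F t in at_top. - \<nu> < X t / \<phi> t"
      using order_tendstoD[OF lim] 3 \<nu> by auto
    ultimately show ?thesis using eventually_ge_at_top[of 0]
    proof eventually_elim
      case (elim t)
      have p: "\<phi> t > 0" and fp: "f (\<phi> t) > 0" using elim \<phi>_pos pos by auto
      have "\<bar>X t\<bar> \<le> \<nu> * \<phi> t" using elim(2,3) p by (auto simp: field_simps abs_le_iff)
      then have "\<bar>f (X t)\<bar> \<le> f (\<nu> * \<phi> t)" unfolding abs_f by (rule monoD[OF mono])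
      also have "\<dots> \<le> q * f (\<phi> t)" by fact
      also have "\<dots> \<le> \<eta> * f (\<phi> t)" using fp q \<nu> by (intro mult_right_mono) auto
      finally show ?case using 3 by simp
    qed
  qed
qed

text \<open>\<open>noise_increment_bound\<close> with \<kappa> = \<epsilon> / 4 and \<eta> =
  \<epsilon> / 2, so that 2 \<kappa> + \<eta> = \<epsilon>.\<close>

lemma noise_increment_small:
  assumes X: "continuous_on {0..} X"
    and eq: "\<And>t. t \<ge> 0 \<Longrightarrow> X t = \<xi> - integral {0..t} (\<lambda>s. f (X s)) + J t"
    and lim: "((\<lambda>t. X t / \<phi> t) \<longlongrightarrow> l) at_top" and l: "l \<in> {-1, 0, 1}"
    and "0 < \<epsilon>"
  shows "\<forall>\<^sub>F s in at_top. \<forall>t\<ge>s. \<bar>J t - J s\<bar> \<le> \<epsilon> * \<phi> s"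
proof -
  have "\<forall>\<^sub>F t in at_top. dist (X t / \<phi> t) l < \<epsilon> / 4"
    using lim \<open>0 < \<epsilon>\<close> by (intro tendstoD) auto
  then have "\<forall>\<^sub>F t in at_top. \<bar>X t - l * \<phi> t\<bar> \<le> \<epsilon> / 4 * \<phi> t"
    using eventually_ge_at_top[of 0]
  proof eventually_elim
    case (elim t)
    then have "\<phi> t > 0" using \<phi>_pos by auto
    then have "X t - l * \<phi> t = (X t / \<phi> t - l) * \<phi> t" by (simp add: field_simps)
    then have "\<bar>X t - l * \<phi> t\<bar> = \<bar>X t / \<phi> t - l\<bar> * \<phi> t"
      using \<open>\<phi> t > 0\<close> by (simp add: abs_mult)
    then show ?case using elim(1) \<open>\<phi> t > 0\<close> by (simp add: dist_real_def)
  qed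
  from noise_increment_bound[OF X eq this f_ratio_tendsto[OF lim l, of "\<epsilon> / 2"]] \<open>0 < \<epsilon>\<close>
  show ?thesis by simp
qed

text \<open>The case l = 0, \<kappa> = K of \<open>noise_increment_bound\<close>;
  \<open>ratio_bounded\<close> controls f (K \<phi>) by a multiple of f \<phi>.\<close>

lemma noise_increment_bounded:
  assumes X: "continuous_on {0..} X"
    and eq: "\<And>t. t \<ge> 0 \<Longrightarrow> X t = \<xi> - integral {0..t} (\<lambda>s. f (X s)) + J t"
    and bound: "\<forall>\<^sub>F t in at_top. \<bar>X t\<bar> \<le> K * \<phi> t" and "0 < K"
  obtains C where "0 < C" "\<forall>\<^sub>F s in at_top. \<forall>t\<ge>s. \<bar>J t - J s\<bar> \<le> C * \<phi> s"
proof -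
  obtain C where C: "0 < C" and ev: "\<forall>\<^sub>F x in at_right 0. f (K * x) \<le> C * f x"
    using ratio_bounded[OF \<open>0 < K\<close>] by blast
  have "\<forall>\<^sub>F t in at_top. f (K * \<phi> t) \<le> C * f (\<phi> t)"
    by (rule eventually_compose_filterlim[OF ev \<phi>_at_right])
  with bound have "\<forall>\<^sub>F t in at_top. \<bar>f (X t) - 0 * f (\<phi> t)\<bar> \<le> C * f (\<phi> t)"
  proof eventually_elim
    case (elim t)
    have "\<bar>f (X t)\<bar> \<le> f (K * \<phi> t)" unfolding abs_f by (rule monoD[OF mono elim(1)])
    then show ?case using elim(2) by simp
  qed
  from noise_increment_bound[OF X eq _ this, of K] bound show ?thesis
    using that[of "2 * K + C"] C \<open>0 < K\<close> by simp
qed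

end

section \<open>Pathwise asymptotics of the perturbed equation\<close>

text \<open>Used for one path at a time with U = l - J and c = \<xi> + l, where l is the limit of J
  along that path.\<close>

locale perturbed_path = drift +
  fixes X U :: "real \<Rightarrow> real" and c :: real
  assumes X_cont: "continuous_on {0..} X"
    and X_eq: "t \<ge> 0 \<Longrightarrow> X t = c - integral {0..t} (\<lambda>s. f (X s)) - U t"
    and U_small: "((\<lambda>t. U t / \<phi> t) \<longlongrightarrow> 0) at_top"
begin

definition Y where "Y t = X t + U t"

text \<open>Since f is odd, the negated path satisfies an equation of the same form, so only
  positive levels have to be treated directly.\<close>

lemma reflected: "perturbed_path f (\<lambda>t. - X t) (\<lambda>t. - U t) (- c)"
  by unfold_locales (use X_cont X_eq tendsto_minus[OF U_small] in \<open>auto intro!: continuous_intros simp: odd\<close>)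

lemma Y_DERIV:
  assumes "t > 0" shows "(Y has_real_derivative - f (X t)) (at t)"
proof -
  have "((\<lambda>t. c - integral {0..t} (\<lambda>s. f (X s))) has_real_derivative - f (X t)) (at t)"
    using assms by (auto intro!: derivative_eq_intros integral_DERIV[OF X_cont])
  moreover have "\<forall>\<^sub>F t in nhds t. c - integral {0..t} (\<lambda>s. f (X s)) = Y t"
    using eventually_nhds_in_open[OF open_greaterThan, of t 0] assms
    by (auto elim!: eventually_mono simp: X_eq Y_def)
  ultimately show ?thesis using DERIV_cong_ev[OF refl _ refl] by fastforce
qed

lemma U_bound:
  assumes "0 < \<epsilon>" shows "\<forall>\<^sub>F t in at_top. \<bar>U t\<bar> \<le> \<epsilon> * \<phi> t"
  using tendstoD[OF U_small assms] eventually_ge_at_top[of 0]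
proof eventually_elim
  case (elim t)
  then show ?case using \<phi>_pos[of t] by (simp add: abs_divide field_simps)
qed

lemma U_tendsto_0: "(U \<longlongrightarrow> 0) at_top"
proof -
  have "((\<lambda>t. U t / \<phi> t * \<phi> t) \<longlongrightarrow> 0 * 0) at_top" by (intro tendsto_mult U_small \<phi>_tendsto_0)
  moreover have "\<forall>\<^sub>F t in at_top. U t / \<phi> t * \<phi> t = U t"
    using eventually_ge_at_top[of 0] by eventually_elim (use \<phi>_pos in force)
  ultimately show ?thesis by (simp add: tendsto_cong)
qed

text \<open>Once U < \<delta> / 2, Y \<ge> \<delta> forces X \<ge> \<delta> / 2, so Y falls at rate
  at least f (\<delta> / 2). It must reach \<delta> in finite time and cannot cross that level
  upwards afterwards.\<close>

lemma Y_eventually_le: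
  assumes "0 < \<delta>" shows "\<forall>\<^sub>F t in at_top. Y t \<le> \<delta>"
proof -
  have "\<forall>\<^sub>F t in at_top. U t < \<delta> / 2" using order_tendstoD(2)[OF U_tendsto_0, of "\<delta>/2"] assms by simp
  with eventually_gt_at_top[of 0] have "\<forall>\<^sub>F t in at_top. U t < \<delta> / 2 \<and> 0 < t" by eventually_elim simp
  then obtain T where T: "\<And>t. t \<ge> T \<Longrightarrow> U t < \<delta> / 2" "\<And>t. t \<ge> T \<Longrightarrow> 0 < t"
    by (auto simp: eventually_at_top_linorder)
  have fX: "f (\<delta> / 2) \<le> f (X t)" if "t \<ge> T" "Y t \<ge> \<delta>" for t
    using T(1)[OF that(1)] that(2) by (intro monoD[OF mono]) (auto simp: Y_def)
  have fd: "f (\<delta> / 2) > 0" using assms pos by simp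
  obtain t1 where t1: "t1 \<ge> T" "Y t1 \<le> \<delta>"
  proof (rule ccontr)
    assume "\<not> thesis"
    then have above: "Y t > \<delta>" if "t \<ge> T" for t using that \<open>\<And>t1. T \<le> t1 \<Longrightarrow> Y t1 \<le> \<delta> \<Longrightarrow> thesis\<close> by force
    \<comment> \<open>The time by which a decrease at the constant rate f (\<delta> / 2) brings Y
      down to \<delta>.\<close>
    define t where "t = T + (Y T - \<delta>) / f (\<delta> / 2)"
    have "t \<ge> T" using above[of T] fd by (auto simp: t_def)
    have "Y t + f (\<delta> / 2) * t \<le> Y T + f (\<delta> / 2) * T"
    proof (rule DERIV_nonpos_imp_nonincreasing[OF \<open>t \<ge> T\<close>])
      fix u assume "T \<le> u" "u \<le> t"
      then have "((\<lambda>t. Y t + f (\<delta> / 2) * t) has_real_derivative (- f (X u) + f (\<delta> / 2))) (at u)"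
        using T(2) by (auto intro!: derivative_eq_intros Y_DERIV)
      moreover have "- f (X u) + f (\<delta> / 2) \<le> 0" using fX[of u] above[of u] \<open>T \<le> u\<close> by auto
      ultimately show "\<exists>y. ((\<lambda>t. Y t + f (\<delta> / 2) * t) has_real_derivative y) (at u) \<and> y \<le> 0" by blast
    qed
    moreover have "f (\<delta> / 2) * t = f (\<delta> / 2) * T + (Y T - \<delta>)" using fd by (simp add: t_def field_simps)
    ultimately show False using above[OF \<open>t \<ge> T\<close>] by simp
  qed
  have "Y t - \<delta> \<le> 0" if "t \<ge> t1" for t
  proof (rule downcrossing[where h = "\<lambda>t. Y t - \<delta>" and h' = "\<lambda>t. - f (X t)" and T = T and ?t1.0 = t1])
    fix u assume u: "T \<le> u"
    then show "((\<lambda>t. Y t - \<delta>) has_real_derivative - f (X u)) (at u)"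
      using T(2) by (auto intro!: derivative_eq_intros Y_DERIV)
    assume "Y u - \<delta> = 0"
    then show "- f (X u) < 0" using fX[OF u] fd by auto
  qed (use t1 that in auto)
  then show ?thesis by (auto simp: eventually_at_top_linorder)
qed

lemma Y_tendsto_0: "(Y \<longlongrightarrow> 0) at_top"
proof (rule tendstoI)
  interpret neg: perturbed_path f "\<lambda>t. - X t" "\<lambda>t. - U t" "- c" by (rule reflected)
  fix e :: real assume "0 < e"
  then have "0 < e / 2" by simp
  from Y_eventually_le[OF this] neg.Y_eventually_le[OF this]
  show "\<forall>\<^sub>F t in at_top. dist (Y t) 0 < e" by eventually_elim (use \<open>0 < e\<close> in \<open>auto simp: dist_real_def Y_def neg.Y_def\<close>)
qed

text \<open>At a contact Y = a \<phi>, the bound on U gives X \<ge> (a - e) \<phi>, hence f X \<ge>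
  q f \<phi> > a f \<phi>. So Y falls faster than a \<phi>, and the contact can only be a downward
  crossing.\<close>

lemma level_above_one:
  assumes "1 < a" shows "(\<forall>\<^sub>F t in at_top. Y t \<le> a * \<phi> t) \<or> (\<forall>\<^sub>F t in at_top. a * \<phi> t < Y t)"
proof -
  obtain e q where e: "0 < e" "e < a" "a < q" and ev: "\<forall>\<^sub>F x in at_right 0. q * f x \<le> f ((a - e) * x)"
    using ratio_above_perturbed[OF assms] by blast
  have "\<forall>\<^sub>F t in at_top. q * f (\<phi> t) \<le> f ((a - e) * \<phi> t)"
    by (rule eventually_compose_filterlim[OF ev \<phi>_at_right])
  with U_bound[OF e(1)] eventually_gt_at_top[of 0]
  have "\<forall>\<^sub>F t in at_top. \<bar>U t\<bar> \<le> e * \<phi> t \<and> q * f (\<phi> t) \<le> f ((a - e) * \<phi> t) \<and> 0 < t" by eventually_elim simp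
  then obtain T where T: "\<And>t. t \<ge> T \<Longrightarrow> \<bar>U t\<bar> \<le> e * \<phi> t"
    "\<And>t. t \<ge> T \<Longrightarrow> q * f (\<phi> t) \<le> f ((a - e) * \<phi> t)" "\<And>t. t \<ge> T \<Longrightarrow> 0 < t"
    by (auto simp: eventually_at_top_linorder)
  have cross: "Y t - a * \<phi> t \<le> 0" if "T \<le> t1" "Y t1 - a * \<phi> t1 \<le> 0" "t1 \<le> t" for t1 t
  proof (rule downcrossing[where h = "\<lambda>t. Y t - a * \<phi> t" and h' = "\<lambda>t. - f (X t) + a * f (\<phi> t)", OF _ _ that])
    fix u assume u: "T \<le> u"
    then show "((\<lambda>t. Y t - a * \<phi> t) has_real_derivative - f (X u) + a * f (\<phi> u)) (at u)"
      using T(3) by (auto intro!: derivative_eq_intros Y_DERIV \<phi>_DERIV)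
    assume "Y u - a * \<phi> u = 0"
    then have "(a - e) * \<phi> u \<le> X u" using T(1)[OF u] by (simp add: Y_def abs_le_iff algebra_simps)
    then have "f ((a - e) * \<phi> u) \<le> f (X u)" by (rule monoD[OF mono])
    moreover have "a * f (\<phi> u) < q * f (\<phi> u)" using e pos[OF \<phi>_pos, of u] T(3)[OF u] by simp
    ultimately show "- f (X u) + a * f (\<phi> u) < 0" using T(2)[OF u] by simp
  qed
  show ?thesis
  proof (cases "\<exists>t1\<ge>T. Y t1 - a * \<phi> t1 \<le> 0")
    case True
    then show ?thesis using cross by (auto simp: eventually_at_top_linorder)
  next
    case False
    then have "\<forall>t\<ge>T. a * \<phi> t < Y t" by force
    then show ?thesis by (auto simp: eventually_at_top_linorder)
  qed
qed

text \<open>The mirror image of \<open>level_above_one\<close>: at a contact, f X \<le> q f \<phi> <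
  a f \<phi>, so Y falls more slowly than a \<phi> and can only cross upwards.\<close>

lemma level_below_one:
  assumes "0 < a" "a < 1" shows "(\<forall>\<^sub>F t in at_top. a * \<phi> t \<le> Y t) \<or> (\<forall>\<^sub>F t in at_top. Y t < a * \<phi> t)"
proof -
  obtain e q where e: "0 < e" "0 < q" "q < a" and ev: "\<forall>\<^sub>F x in at_right 0. f ((a + e) * x) \<le> q * f x"
    using ratio_below_perturbed[OF assms] by blast
  have "\<forall>\<^sub>F t in at_top. f ((a + e) * \<phi> t) \<le> q * f (\<phi> t)"
    by (rule eventually_compose_filterlim[OF ev \<phi>_at_right])
  with U_bound[OF e(1)] eventually_gt_at_top[of 0]
  have "\<forall>\<^sub>F t in at_top. \<bar>U t\<bar> \<le> e * \<phi> t \<and> f ((a + e) * \<phi> t) \<le> q * f (\<phi> t) \<and> 0 < t" by eventually_elim simp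
  then obtain T where T: "\<And>t. t \<ge> T \<Longrightarrow> \<bar>U t\<bar> \<le> e * \<phi> t"
    "\<And>t. t \<ge> T \<Longrightarrow> f ((a + e) * \<phi> t) \<le> q * f (\<phi> t)" "\<And>t. t \<ge> T \<Longrightarrow> 0 < t"
    by (auto simp: eventually_at_top_linorder)
  have cross: "a * \<phi> t - Y t \<le> 0" if "T \<le> t1" "a * \<phi> t1 - Y t1 \<le> 0" "t1 \<le> t" for t1 t
  proof (rule downcrossing[where h = "\<lambda>t. a * \<phi> t - Y t" and h' = "\<lambda>t. f (X t) - a * f (\<phi> t)", OF _ _ that])
    fix u assume u: "T \<le> u"
    then show "((\<lambda>t. a * \<phi> t - Y t) has_real_derivative f (X u) - a * f (\<phi> u)) (at u)"
      using T(3) by (auto intro!: derivative_eq_intros Y_DERIV \<phi>_DERIV)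
    assume "a * \<phi> u - Y u = 0"
    then have "X u \<le> (a + e) * \<phi> u" using T(1)[OF u] by (simp add: Y_def abs_le_iff algebra_simps)
    then have "f (X u) \<le> f ((a + e) * \<phi> u)" by (rule monoD[OF mono])
    moreover have "q * f (\<phi> u) < a * f (\<phi> u)" using e pos[OF \<phi>_pos, of u] T(3)[OF u] by simp
    ultimately show "f (X u) - a * f (\<phi> u) < 0" using T(2)[OF u] by simp
  qed
  show ?thesis
  proof (cases "\<exists>t1\<ge>T. a * \<phi> t1 - Y t1 \<le> 0")
    case True
    then show ?thesis using cross by (auto simp: eventually_at_top_linorder)
  next
    case False
    then have "\<forall>t\<ge>T. Y t < a * \<phi> t" by force
    then show ?thesis by (auto simp: eventually_at_top_linorder)
  qed
qed

text \<open>As long as \<open>Y\<close> stays above \<open>a \<phi>\<close> with \<open>a > 1\<close>, the clock \<open>F (Y / b)\<close> with \<open>1 < b < a\<close> runs faster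
  than \<open>F (\<phi> t) = t\<close> by a constant factor.\<close>

lemma Y_eventually_le_above_one:
  assumes "1 < a" shows "\<forall>\<^sub>F t in at_top. Y t \<le> a * \<phi> t"
proof (rule disjE[OF level_above_one[OF assms]])
  assume above: "\<forall>\<^sub>F t in at_top. a * \<phi> t < Y t"
  \<comment> \<open>An intermediate level: the ratio bound is used at \<open>Y / b\<close>, and the
    gap between b and a produces the contradiction at the end.\<close>
  define b where "b = (1 + a) / 2"
  have b: "1 < b" "b < a" using assms by (auto simp: b_def)
  obtain e r where e: "0 < e" "e < b" "b < r" and ev: "\<forall>\<^sub>F x in at_right 0. r * f x \<le> f ((b - e) * x)"
    using ratio_above_perturbed[OF b(1)] by blast
  have "filterlim (\<lambda>t. Y t / b) (at_right 0) at_top"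
  proof -
    have "((\<lambda>t. Y t / b) \<longlongrightarrow> 0) at_top" using tendsto_divide[OF Y_tendsto_0 tendsto_const, of b] b by simp
    moreover have "\<forall>\<^sub>F t in at_top. 0 < Y t / b" using above eventually_ge_at_top[of 0]
    proof eventually_elim
      case (elim t)
      have "0 < a * \<phi> t" using \<phi>_pos[of t] elim assms by simp
      then show ?case using elim b by (intro divide_pos_pos) auto
    qed
    ultimately show ?thesis unfolding filterlim_at by (auto elim!: eventually_mono)
  qed
  from eventually_compose_filterlim[OF ev this]
  have "\<forall>\<^sub>F t in at_top. r * f (Y t / b) \<le> f ((b - e) * (Y t / b))" .
  moreover have "0 < e / b" using e b by simp
  note U_bound[OF this]
  ultimately have "\<forall>\<^sub>F t in at_top. r * f (Y t / b) \<le> f ((b - e) * (Y t / b)) \<and> \<bar>U t\<bar> \<le> e / b * \<phi> t \<and> a * \<phi> t < Y t \<and> 0 < t"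
    using above eventually_gt_at_top[of 0] by eventually_elim simp
  then obtain T where T: "\<And>t. t \<ge> T \<Longrightarrow> r * f (Y t / b) \<le> f ((b - e) * (Y t / b))"
    "\<And>t. t \<ge> T \<Longrightarrow> \<bar>U t\<bar> \<le> e / b * \<phi> t" "\<And>t. t \<ge> T \<Longrightarrow> a * \<phi> t < Y t" "\<And>t. t \<ge> T \<Longrightarrow> 0 < t"
    by (auto simp: eventually_at_top_linorder)
  have fast: "F (Y T / b) + r / b * (t - T) \<le> F (Y t / b)" if "T \<le> t" for t
  proof -
    have "F (Y T / b) - r / b * T \<le> F (Y t / b) - r / b * t"
    proof (rule DERIV_nonneg_imp_nondecreasing[OF that])
      fix u assume "T \<le> u" "u \<le> t"
      note Tu = T[OF \<open>T \<le> u\<close>]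
      have p: "0 < \<phi> u" using Tu \<phi>_pos by simp
      then have "\<phi> u < a * \<phi> u" using assms by simp
      then have "\<phi> u < Y u" using Tu by simp
      then have Yu: "0 < Y u / b" using p b by simp
      have "((\<lambda>t. F (Y t / b) - r / b * t) has_real_derivative (- (1 / f (Y u / b)) * (- f (X u) / b) - r / b)) (at u)"
      proof -
        have "((\<lambda>t. Y t / b) has_real_derivative (- f (X u) / b)) (at u)"
          using Tu b by (auto intro!: derivative_eq_intros Y_DERIV)
        from DERIV_chain2[where f = F and g = "\<lambda>t. Y t / b", OF F_DERIV[OF Yu] this]
        have "((\<lambda>t. F (Y t / b)) has_real_derivative (- (1 / f (Y u / b)) * (- f (X u) / b))) (at u)" .
        then show ?thesis using b by (auto intro!: derivative_eq_intros)
      qed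
      moreover have "0 \<le> - (1 / f (Y u / b)) * (- f (X u) / b) - r / b"
      proof -
        \<comment> \<open>Above \<phi> the perturbation is small relative to Y as well, so X = Y - U
          is at least b - e times Y / b.\<close>
        have "e / b * \<phi> u \<le> e / b * Y u" using \<open>\<phi> u < Y u\<close> e b by (intro mult_left_mono) auto
        then have "(b - e) * (Y u / b) \<le> X u" using Tu(2) b by (simp add: Y_def field_simps abs_le_iff)
        then have "f ((b - e) * (Y u / b)) \<le> f (X u)" by (rule monoD[OF mono])
        then have "r * f (Y u / b) \<le> f (X u)" using Tu(1) by simp
        then show ?thesis using pos[OF Yu] b by (simp add: field_simps)
      qed
      ultimately show "\<exists>y. ((\<lambda>t. F (Y t / b) - r / b * t) has_real_derivative y) (at u) \<and> 0 \<le> y" by blast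
    qed
    then show ?thesis unfolding right_diff_distrib by linarith
  qed
  define C where "C = F (Y T / b) - r / b * T"
  \<comment> \<open>Late enough for the surplus slope r / b - 1 to outweigh C. Then F (Y t / b)
    \<ge> t = F (\<phi> t), which forces Y t \<le> b \<phi> t.\<close>
  define t where "t = max T (\<bar>C\<bar> / (r / b - 1))"
  have rb: "r / b - 1 > 0" using e b by (simp add: field_simps)
  have "\<bar>C\<bar> / (r / b - 1) \<le> t" "T \<le> t" by (auto simp: t_def)
  then have t: "T \<le> t" "0 < t" "\<bar>C\<bar> \<le> (r / b - 1) * t"
    using T(4) pos_divide_le_eq[OF rb] by (simp_all add: mult.commute)
  have "t \<le> F (Y t / b)"
  proof -
    have "F (Y T / b) + r / b * (t - T) = t + (C + (r / b - 1) * t)" by (simp add: C_def algebra_simps flip: add_divide_distrib)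
    moreover have "0 \<le> C + (r / b - 1) * t" using t(3) by linarith
    ultimately show ?thesis using fast[OF t(1)] by linarith
  qed
  have p: "0 < \<phi> t" using t \<phi>_pos by simp
  have "b * \<phi> t < a * \<phi> t" using b p by simp
  then have "\<phi> t < Y t / b" using T(3)[OF t(1)] b by (simp add: field_simps)
  from F_strict_decreasing[OF p this] show ?thesis using F_\<phi>[of t] t \<open>t \<le> F (Y t / b)\<close> by simp
qed

text \<open>The drift would eventually be at most q f \<phi> with q < l, making Y - q \<phi>
  nondecreasing. It would also be positive and tend to 0, which is impossible.\<close>

lemma limit_not_in_unit_interval:
  assumes lim: "((\<lambda>t. Y t / \<phi> t) \<longlongrightarrow> l) at_top" and "0 < l" "l < 1"
  shows False
proof -
  obtain e q where e: "0 < e" "0 < q" "q < l" and ev: "\<forall>\<^sub>F x in at_right 0. f ((l + e) * x) \<le> q * f x"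
    using ratio_below_perturbed[OF assms(2,3)] by blast
  have "\<forall>\<^sub>F t in at_top. f ((l + e) * \<phi> t) \<le> q * f (\<phi> t)"
    by (rule eventually_compose_filterlim[OF ev \<phi>_at_right])
  moreover have "\<forall>\<^sub>F t in at_top. Y t / \<phi> t < l + e / 2" "\<forall>\<^sub>F t in at_top. q < Y t / \<phi> t"
    using order_tendstoD[OF lim] e by auto
  moreover have "\<forall>\<^sub>F t in at_top. \<bar>U t\<bar> \<le> e / 2 * \<phi> t" using U_bound[of "e/2"] e by simp
  ultimately have "\<forall>\<^sub>F t in at_top. f (X t) \<le> q * f (\<phi> t) \<and> q * \<phi> t < Y t \<and> 0 < t"
    using eventually_gt_at_top[of 0]
  proof eventually_elim
    case (elim t)
    then have p: "0 < \<phi> t" using \<phi>_pos by simp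
    have "Y t \<le> (l + e / 2) * \<phi> t" "q * \<phi> t < Y t" using elim(2,3) p by (simp_all add: field_simps)
    then have "X t \<le> (l + e) * \<phi> t" using elim(4) by (simp add: Y_def algebra_simps abs_le_iff)
    then have "f (X t) \<le> f ((l + e) * \<phi> t)" by (rule monoD[OF mono])
    then show ?case using elim \<open>q * \<phi> t < Y t\<close> by simp
  qed
  then obtain T where T: "\<And>t. t \<ge> T \<Longrightarrow> f (X t) \<le> q * f (\<phi> t)"
    "\<And>t. t \<ge> T \<Longrightarrow> q * \<phi> t < Y t" "\<And>t. t \<ge> T \<Longrightarrow> 0 < t"
    by (auto simp: eventually_at_top_linorder)
  have mono: "Y T - q * \<phi> T \<le> Y t - q * \<phi> t" if "T \<le> t" for t
  proof (rule DERIV_nonneg_imp_nondecreasing[OF that])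
    fix u assume "T \<le> u" "u \<le> t"
    then have "((\<lambda>t. Y t - q * \<phi> t) has_real_derivative (- f (X u) + q * f (\<phi> u))) (at u)"
      using T(3) by (auto intro!: derivative_eq_intros Y_DERIV \<phi>_DERIV)
    then show "\<exists>y. ((\<lambda>t. Y t - q * \<phi> t) has_real_derivative y) (at u) \<and> 0 \<le> y"
      using T(1)[OF \<open>T \<le> u\<close>] by force
  qed
  have "((\<lambda>t. Y t - q * \<phi> t) \<longlongrightarrow> 0 - q * 0) at_top"
    by (intro tendsto_intros Y_tendsto_0 \<phi>_tendsto_0)
  moreover have "\<forall>\<^sub>F t in at_top. Y T - q * \<phi> T \<le> Y t - q * \<phi> t"
    using eventually_ge_at_top[of T] by eventually_elim (rule mono)
  ultimately have "Y T - q * \<phi> T \<le> 0 - q * 0"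
    by (intro tendsto_lowerbound[where F = at_top]) auto
  then show False using T(2)[of T] by simp
qed

text \<open>Levels of modulus above 1 are decided by the eventual bounds on both sides, and the two
  open unit intervals by the one-way crossings. Finally X / \<phi> and Y / \<phi> share their limit
  because U / \<phi> tends to 0.\<close>

lemma ratio_converges: "\<exists>l\<in>{-1, 0, 1}. ((\<lambda>t. X t / \<phi> t) \<longlongrightarrow> l) at_top"
proof -
  interpret neg: perturbed_path f "\<lambda>t. - X t" "\<lambda>t. - U t" "- c" by (rule reflected)
  have neg_Y: "neg.Y t = - Y t" for t by (simp add: Y_def neg.Y_def)
  have upper: "\<forall>\<^sub>F t in at_top. Y t / \<phi> t \<le> a" if "1 < a" for a
    using Y_eventually_le_above_one[OF that] eventually_ge_at_top[of 0]
    by eventually_elim (use \<phi>_pos in \<open>simp add: divide_le_eq\<close>)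
  have lower: "\<forall>\<^sub>F t in at_top. a \<le> Y t / \<phi> t" if "a < -1" for a
  proof -
    have "1 < - a" using that by simp
    from neg.Y_eventually_le_above_one[OF this] eventually_ge_at_top[of 0]
    show ?thesis
      by eventually_elim (use \<phi>_pos in \<open>auto simp: neg_Y le_divide_eq\<close>)
  qed
  have "\<exists>l. ((\<lambda>t. Y t / \<phi> t) \<longlongrightarrow> l) at_top"
  proof (rule convergent_if_levels[OF lower[of "-2"] upper[of 2], where E = "{-1, 0, 1}"])
    fix x :: real assume "x \<notin> {-1, 0, 1}"
    then consider "1 < x" | "x < -1" | "0 < x" "x < 1" | "0 < - x" "- x < 1" by fastforce
    then show "(\<forall>\<^sub>F t in at_top. x \<le> Y t / \<phi> t) \<or> (\<forall>\<^sub>F t in at_top. Y t / \<phi> t \<le> x)"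
    proof cases
      case 3
      from level_below_one[OF this] show ?thesis
      proof (rule disj_forward)
        show "\<forall>\<^sub>F t in at_top. x \<le> Y t / \<phi> t" if "\<forall>\<^sub>F t in at_top. x * \<phi> t \<le> Y t"
          using that eventually_ge_at_top[of 0] by eventually_elim (use \<phi>_pos in \<open>simp add: le_divide_eq\<close>)
        show "\<forall>\<^sub>F t in at_top. Y t / \<phi> t \<le> x" if "\<forall>\<^sub>F t in at_top. Y t < x * \<phi> t"
          using that eventually_ge_at_top[of 0] by eventually_elim (use \<phi>_pos in \<open>simp add: divide_le_eq\<close>)
      qed
    next
      case 4
      from neg.level_below_one[OF this] have "(\<forall>\<^sub>F t in at_top. Y t / \<phi> t \<le> x) \<or> (\<forall>\<^sub>F t in at_top. x \<le> Y t / \<phi> t)"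
      proof (rule disj_forward)
        show "\<forall>\<^sub>F t in at_top. Y t / \<phi> t \<le> x" if "\<forall>\<^sub>F t in at_top. - x * \<phi> t \<le> neg.Y t"
          using that eventually_ge_at_top[of 0] by eventually_elim (use \<phi>_pos in \<open>auto simp: neg_Y divide_le_eq\<close>)
        show "\<forall>\<^sub>F t in at_top. x \<le> Y t / \<phi> t" if "\<forall>\<^sub>F t in at_top. neg.Y t < - x * \<phi> t"
          using that eventually_ge_at_top[of 0] by eventually_elim (use \<phi>_pos in \<open>auto simp: neg_Y le_divide_eq\<close>)
      qed
      then show ?thesis by blast
    qed (use upper lower in auto)
  qed auto
  then obtain l where l: "((\<lambda>t. Y t / \<phi> t) \<longlongrightarrow> l) at_top" by blast
  have "l \<le> a" if "1 < a" for a using tendsto_upperbound[OF l upper[OF that]] by simp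
  then have "l \<le> 1" by (rule dense_ge)
  have "a \<le> l" if "a < -1" for a using tendsto_lowerbound[OF l lower[OF that]] by simp
  then have "-1 \<le> l" by (rule dense_le)
  have "\<not> (0 < l \<and> l < 1)" using limit_not_in_unit_interval[OF l] by blast
  moreover have "((\<lambda>t. neg.Y t / \<phi> t) \<longlongrightarrow> - l) at_top"
    using tendsto_minus[OF l] by (simp add: neg_Y)
  then have "\<not> (0 < - l \<and> - l < 1)" using neg.limit_not_in_unit_interval by blast
  ultimately have "l \<in> {-1, 0, 1}" using \<open>l \<le> 1\<close> \<open>-1 \<le> l\<close> by auto
  moreover have "((\<lambda>t. X t / \<phi> t) \<longlongrightarrow> l) at_top"
    using tendsto_diff[OF l U_small] by (simp add: Y_def add_divide_distrib)
  ultimately show ?thesis by blast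
qed

end

section \<open>Step integrals and their limits\<close>

context prob_space begin

text \<open>For x \<ge> a \<ge> 0 one has x^2 \<ge> a^2 + (x - a)^2, so the density at x is at most
  exp (- a^2 / 2) times the density at x - a, whose total mass is 1.\<close>

lemma std_normal_upper_tail:
  assumes D: "distributed M lborel Z std_normal_density" and "0 \<le> a"
  shows "prob {\<omega> \<in> space M. a \<le> Z \<omega>} \<le> exp (- a\<^sup>2 / 2)"
proof -
  have "emeasure M (Z -` {a..} \<inter> space M) = (\<integral>\<^sup>+x. ennreal (std_normal_density x) * indicator {a..} x \<partial>lborel)"
    by (rule distributed_emeasure[OF D]) simp
  also have "\<dots> \<le> (\<integral>\<^sup>+x. ennreal (exp (- a\<^sup>2 / 2)) * ennreal (std_normal_density (- a + 1 * x)) \<partial>lborel)"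
  proof (rule nn_integral_mono)
    fix x
    show "ennreal (std_normal_density x) * indicator {a..} x \<le> ennreal (exp (- a\<^sup>2 / 2)) * ennreal (std_normal_density (- a + 1 * x))"
    proof (cases "a \<le> x")
      case True
      have "0 \<le> a * (x - a)" using True \<open>0 \<le> a\<close> by simp
      then have "- x\<^sup>2 / 2 \<le> - a\<^sup>2 / 2 + - (- a + 1 * x)\<^sup>2 / 2"
        by (simp add: power2_eq_square algebra_simps)
      then have "exp (- x\<^sup>2 / 2) \<le> exp (- a\<^sup>2 / 2) * exp (- (- a + 1 * x)\<^sup>2 / 2)"
        by (simp only: exp_add[symmetric] exp_le_cancel_iff)
      then have "std_normal_density x \<le> exp (- a\<^sup>2 / 2) * std_normal_density (- a + 1 * x)"
        by (simp add: std_normal_density_def divide_right_mono)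
      then show ?thesis using True by (simp add: ennreal_mult'[symmetric] ennreal_leI)
    qed simp
  qed
  also have "\<dots> = ennreal (exp (- a\<^sup>2 / 2)) * (\<integral>\<^sup>+x. ennreal (std_normal_density (- a + 1 * x)) \<partial>lborel)"
    by (rule nn_integral_cmult) simp
  also have "(\<integral>\<^sup>+x. ennreal (std_normal_density (- a + 1 * x)) \<partial>lborel) = (\<integral>\<^sup>+x. ennreal (std_normal_density x) \<partial>lborel)"
    using nn_integral_real_affine[of "\<lambda>x. ennreal (std_normal_density x)" 1 "-a"] by simp
  also have "\<dots> = 1" by (subst nn_integral_eq_integral) auto
  finally have "emeasure M (Z -` {a..} \<inter> space M) \<le> ennreal (exp (- a\<^sup>2 / 2))" by simp
  moreover have "Z -` {a..} \<inter> space M = {\<omega> \<in> space M. a \<le> Z \<omega>}" by auto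
  ultimately show ?thesis by (simp add: emeasure_eq_measure)
qed

lemma normal_tail_upper:
  assumes D: "distributed M lborel Z (normal_density 0 w)" and "0 < w" "0 \<le> a"
  shows "prob {\<omega> \<in> space M. a \<le> \<bar>Z \<omega>\<bar>} \<le> 2 * exp (- a\<^sup>2 / (2 * w\<^sup>2))"
proof -
  have [measurable]: "Z \<in> borel_measurable M" using distributed_measurable[OF D] by simp
  have D1: "distributed M lborel (\<lambda>\<omega>. Z \<omega> / w) std_normal_density"
    using D normal_standard_normal_convert[OF \<open>0 < w\<close>, of Z 0] by simp
  have D2: "distributed M lborel (\<lambda>\<omega>. - (Z \<omega> / w)) std_normal_density"
    using normal_density_affine[OF D1, of "-1" 0] by simp
  have e: "(a / w)\<^sup>2 / 2 = a\<^sup>2 / (2 * w\<^sup>2)" by (simp add: power_divide)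
  have sub: "{\<omega> \<in> space M. a \<le> \<bar>Z \<omega>\<bar>} = {\<omega> \<in> space M. a / w \<le> Z \<omega> / w} \<union> {\<omega> \<in> space M. a / w \<le> - (Z \<omega> / w)}"
    using \<open>0 < w\<close> by (auto simp: field_simps abs_if split: if_splits)
  have "prob {\<omega> \<in> space M. a \<le> \<bar>Z \<omega>\<bar>} \<le> prob {\<omega> \<in> space M. a / w \<le> Z \<omega> / w} + prob {\<omega> \<in> space M. a / w \<le> - (Z \<omega> / w)}"
    unfolding sub by (rule measure_subadditive) auto
  also have "\<dots> \<le> exp (- (a / w)\<^sup>2 / 2) + exp (- (a / w)\<^sup>2 / 2)"
    using assms by (intro add_mono std_normal_upper_tail D1 D2) auto
  finally show ?thesis using e by simp
qed

text \<open>On [a, a + 1], an interval of length 1, the density is at least its value at the right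
  end. The loss in the exponent is affordable: at a = sqrt (ln (n + 1)) the bounds still have a
  divergent sum.\<close>

lemma normal_tail_lower:
  assumes D: "distributed M lborel Z (normal_density 0 w)" and "0 < w" "0 \<le> a"
  shows "exp (- (a + 1)\<^sup>2 / 2) / sqrt (2 * pi) \<le> prob {\<omega> \<in> space M. a * w \<le> \<bar>Z \<omega>\<bar>}"
proof -
  have [measurable]: "Z \<in> borel_measurable M" using distributed_measurable[OF D] by simp
  have D1: "distributed M lborel (\<lambda>\<omega>. Z \<omega> / w) std_normal_density"
    using D normal_standard_normal_convert[OF \<open>0 < w\<close>, of Z 0] by simp
  let ?k = "exp (- (a + 1)\<^sup>2 / 2) / sqrt (2 * pi)"
  have "ennreal ?k = (\<integral>\<^sup>+x. ennreal ?k * indicator {a..a+1} x \<partial>lborel)"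
    by (subst nn_integral_cmult) auto
  also have "\<dots> \<le> (\<integral>\<^sup>+x. ennreal (std_normal_density x) * indicator {a..a+1} x \<partial>lborel)"
  proof (intro nn_integral_mono)
    fix x
    show "ennreal ?k * indicator {a..a+1} x \<le> ennreal (std_normal_density x) * indicator {a..a+1} x"
    proof (cases "x \<in> {a..a+1}")
      case True
      then have "x\<^sup>2 \<le> (a + 1)\<^sup>2" using \<open>0 \<le> a\<close> by (intro power_mono) auto
      then show ?thesis using True by (auto simp: std_normal_density_def divide_right_mono intro!: ennreal_leI)
    qed simp
  qed
  also have "\<dots> = emeasure M ((\<lambda>\<omega>. Z \<omega> / w) -` {a..a+1} \<inter> space M)"
    by (rule distributed_emeasure[OF D1, symmetric]) simp
  also have "\<dots> \<le> emeasure M {\<omega> \<in> space M. a * w \<le> \<bar>Z \<omega>\<bar>}"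
    using \<open>0 < w\<close> by (intro emeasure_mono) (auto simp: field_simps)
  finally show ?thesis by (simp add: emeasure_eq_measure)
qed

end

section \<open>Brownian motion and Wiener integrals of step functions\<close>

locale brownian = prob_space M for M :: "'a measure" +
  fixes B :: "real \<Rightarrow> 'a \<Rightarrow> real"
  assumes bm: "standard_brownian_motion M B"
begin

lemma B_measurable [measurable]: "0 \<le> t \<Longrightarrow> B t \<in> borel_measurable M"
  using bm by (simp add: standard_brownian_motion_def)

lemma B_increment: "0 \<le> s \<Longrightarrow> s < t \<Longrightarrow>
    distributed M lborel (\<lambda>\<omega>. B t \<omega> - B s \<omega>) (normal_density 0 (sqrt (t - s)))"
  using bm by (simp add: standard_brownian_motion_def)

text \<open>The absolute value frees the formula from the order of the two times, as the
  polarization in \<open>increment_covariance\<close> requires.\<close>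

lemma B_square_increment:
  assumes "0 \<le> s" "0 \<le> t"
  shows "has_bochner_integral M (\<lambda>\<omega>. (B t \<omega> - B s \<omega>)\<^sup>2) \<bar>t - s\<bar>"
proof -
  have *: "has_bochner_integral M (\<lambda>\<omega>. (B t \<omega> - B s \<omega>)\<^sup>2) (t - s)" if "0 \<le> s" "s < t" for s t
  proof -
    note D = B_increment[OF that]
    have sd: "0 < sqrt (t - s)" using that by simp
    have "integrable lborel (\<lambda>x. normal_density 0 (sqrt (t - s)) x * x\<^sup>2)"
      using integrable_normal_moment[OF sd, of 0 2] by simp
    then have "integrable M (\<lambda>\<omega>. (B t \<omega> - B s \<omega>)\<^sup>2)"
      using distributed_integrable[OF D, of "\<lambda>x. x\<^sup>2"] by simp
    moreover have "expectation (\<lambda>\<omega>. (B t \<omega> - B s \<omega>)\<^sup>2) = t - s"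
      using normal_distributed_variance[OF sd D] normal_distributed_expectation[OF sd D] that by simp
    ultimately show ?thesis by (simp add: has_bochner_integral_iff)
  qed
  show ?thesis
  proof (cases s t rule: linorder_cases)
    case greater
    then show ?thesis using *[of t s] assms by (simp add: power2_commute)
  qed (use *[of s t] assms in \<open>auto simp: has_bochner_integral_zero\<close>)
qed

text \<open>\<open>elementary g Z\<close>: the random variable \<open>Z\<close> is the Wiener integral of the step function \<open>g\<close>.\<close>

inductive elementary :: "(real \<Rightarrow> real) \<Rightarrow> ('a \<Rightarrow> real) \<Rightarrow> bool" where
  zero: "elementary (\<lambda>_. 0) (\<lambda>_. 0)"
| add: "\<lbrakk>elementary g Z; 0 \<le> a; a \<le> b\<rbrakk> \<Longrightarrow>
    elementary (\<lambda>s. g s + k * indicator {a<..b} s) (\<lambda>\<omega>. Z \<omega> + k * (B b \<omega> - B a \<omega>))"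

lemma elementary_plus:
  assumes "elementary g Z" "elementary g' Z'"
  shows "elementary (\<lambda>s. g s + g' s) (\<lambda>\<omega>. Z \<omega> + Z' \<omega>)"
  using assms(2,1)
proof induction
  case (add g' Z' a b k)
  from elementary.add[OF add.IH[OF add.prems] add.hyps(2,3), of k]
  show ?case by (simp add: add.assoc)
qed simp

lemma elementary_scale:
  assumes "elementary g Z"
  shows "elementary (\<lambda>s. r * g s) (\<lambda>\<omega>. r * Z \<omega>)"
  using assms
proof induction
  case (add g' Z' a b k)
  from elementary.add[OF add.IH add.hyps(2,3), of "r * k"]
  show ?case by (simp add: algebra_simps)
qed (simp add: elementary.zero)

lemma elementary_minus:
  assumes "elementary g Z" "elementary g' Z'"
  shows "elementary (\<lambda>s. g s - g' s) (\<lambda>\<omega>. Z \<omega> - Z' \<omega>)"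
  using elementary_plus[OF assms(1) elementary_scale[OF assms(2), of "-1"]] by simp

lemma elementary_sum:
  assumes "finite I" "\<And>i. i \<in> I \<Longrightarrow> 0 \<le> a i \<and> a i \<le> b i"
  shows "elementary (\<lambda>s. \<Sum>i\<in>I. k i * indicator {a i<..b i} s) (\<lambda>\<omega>. \<Sum>i\<in>I. k i * (B (b i) \<omega> - B (a i) \<omega>))"
  using assms
proof (induction I rule: finite_induct)
  case (insert i I)
  then have "elementary (\<lambda>s. (\<Sum>i\<in>I. k i * indicator {a i<..b i} s) + k i * indicator {a i<..b i} s)
      (\<lambda>\<omega>. (\<Sum>i\<in>I. k i * (B (b i) \<omega> - B (a i) \<omega>)) + k i * (B (b i) \<omega> - B (a i) \<omega>))"
    by (intro elementary.add) auto
  then show ?case using insert.hyps by (simp only: sum.insert[OF insert.hyps] add.commute)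
qed (simp add: elementary.zero)

lemma elementary_step:
  assumes "0 \<le> \<tau> 0" "mono_on {..n} \<tau>"
  shows "elementary (step_function n \<tau> c) (step_integral B n \<tau> c)"
proof -
  have "0 \<le> \<tau> i \<and> \<tau> i \<le> \<tau> (Suc i)" if "i < n" for i
    using that assms mono_onD[OF assms(2), of 0 i] mono_onD[OF assms(2), of i "Suc i"] by auto
  then show ?thesis
    unfolding step_function_def[abs_def] step_integral_def[abs_def] by (intro elementary_sum) auto
qed

lemma elementary_measurable:
  assumes "elementary g Z" shows "g \<in> borel_measurable borel" "Z \<in> borel_measurable M"
  using assms by induction auto

text \<open>Polarization writes the product as a combination of four squared increments, whose
  expectations are absolute time differences. The combination \<open>?v\<close> is the length of the
  overlap of the two intervals, however they are placed.\<close>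

lemma increment_covariance:
  assumes "0 \<le> a" "a \<le> b" "0 \<le> c" "c \<le> d"
  obtains v where "has_bochner_integral M (\<lambda>\<omega>. (B b \<omega> - B a \<omega>) * (B d \<omega> - B c \<omega>)) v"
    "has_bochner_integral lborel (\<lambda>s. indicator {a<..b} s * indicator {c<..d} s) v"
proof -
  let ?v = "1/2 * (\<bar>b - c\<bar> + \<bar>a - d\<bar> - \<bar>b - d\<bar> - \<bar>a - c\<bar>)"
  have "has_bochner_integral M (\<lambda>\<omega>. 1/2 * ((B b \<omega> - B c \<omega>)\<^sup>2 + (B a \<omega> - B d \<omega>)\<^sup>2 - (B b \<omega> - B d \<omega>)\<^sup>2 - (B a \<omega> - B c \<omega>)\<^sup>2)) ?v"
    using assms by (intro has_bochner_integral_mult_right has_bochner_integral_diff has_bochner_integral_add B_square_increment) auto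
  moreover have "1/2 * ((B b \<omega> - B c \<omega>)\<^sup>2 + (B a \<omega> - B d \<omega>)\<^sup>2 - (B b \<omega> - B d \<omega>)\<^sup>2 - (B a \<omega> - B c \<omega>)\<^sup>2)
      = (B b \<omega> - B a \<omega>) * (B d \<omega> - B c \<omega>)" for \<omega>
    by (simp add: power2_eq_square field_simps)
  ultimately have 1: "has_bochner_integral M (\<lambda>\<omega>. (B b \<omega> - B a \<omega>) * (B d \<omega> - B c \<omega>)) ?v" by simp
  have "emeasure lborel {max a c<..min b d} < \<infinity>" by (cases "max a c \<le> min b d") auto
  then have "has_bochner_integral lborel (indicator {max a c<..min b d}) (measure lborel {max a c<..min b d})"
    by (intro has_bochner_integral_real_indicator) auto
  moreover have "measure lborel {max a c<..min b d} = ?v"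
    using assms by (auto simp: measure_lborel_Ioc min_def max_def abs_if)
  moreover have "indicator {max a c<..min b d} = (\<lambda>s. indicator {a<..b} s * indicator {c<..d} s :: real)"
    by (auto simp: indicator_def fun_eq_iff)
  ultimately have "has_bochner_integral lborel (\<lambda>s. indicator {a<..b} s * indicator {c<..d} s) ?v" by simp
  then show ?thesis using 1 that by blast
qed

text \<open>Both sides are bilinear, so an induction over each argument reduces the claim to two
  increments of B. The common value v carries integrability along with the equality.\<close>

lemma elementary_isometry:
  assumes "elementary g Z" "elementary g' Z'"
  shows "\<exists>v. has_bochner_integral M (\<lambda>\<omega>. Z \<omega> * Z' \<omega>) v \<and> has_bochner_integral lborel (\<lambda>s. g s * g' s) v"
  using assms(2,1)
proof (induction arbitrary: g Z)
  case zero
  then show ?case by (auto intro!: exI[of _ 0] simp: has_bochner_integral_zero)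
next
  case (add g' Z' a b k)
  have "\<exists>v. has_bochner_integral M (\<lambda>\<omega>. Z \<omega> * (B b \<omega> - B a \<omega>)) v
      \<and> has_bochner_integral lborel (\<lambda>s. g s * indicator {a<..b} s) v"
    using \<open>elementary g Z\<close>
  proof induction
    case zero
    then show ?case by (auto intro!: exI[of _ 0] simp: has_bochner_integral_zero)
  next
    case (add h Y c d r)
    obtain v where v: "has_bochner_integral M (\<lambda>\<omega>. (B d \<omega> - B c \<omega>) * (B b \<omega> - B a \<omega>)) v"
      "has_bochner_integral lborel (\<lambda>s. indicator {c<..d} s * indicator {a<..b} s) v"
      using increment_covariance[OF add.hyps(2,3) \<open>0 \<le> a\<close> \<open>a \<le> b\<close>] by blast
    from add.IH obtain u where u: "has_bochner_integral M (\<lambda>\<omega>. Y \<omega> * (B b \<omega> - B a \<omega>)) u"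
      "has_bochner_integral lborel (\<lambda>s. h s * indicator {a<..b} s) u" by blast
    show ?case
      using has_bochner_integral_add[OF u(1) has_bochner_integral_mult_right[OF v(1), of r]]
        has_bochner_integral_add[OF u(2) has_bochner_integral_mult_right[OF v(2), of r]]
      by (auto simp: algebra_simps)
  qed
  then obtain v where v: "has_bochner_integral M (\<lambda>\<omega>. Z \<omega> * (B b \<omega> - B a \<omega>)) v"
      "has_bochner_integral lborel (\<lambda>s. g s * indicator {a<..b} s) v" by blast
  from add.IH[OF add.prems] obtain u where u: "has_bochner_integral M (\<lambda>\<omega>. Z \<omega> * Z' \<omega>) u"
      "has_bochner_integral lborel (\<lambda>s. g s * g' s) u" by blast
  show ?case
    using has_bochner_integral_add[OF u(1) has_bochner_integral_mult_right[OF v(1), of k]]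
      has_bochner_integral_add[OF u(2) has_bochner_integral_mult_right[OF v(2), of k]]
    by (auto simp: algebra_simps)
qed

text \<open>In this form the isometry can be chained with inequalities free of integrability side
  conditions.\<close>

lemma elementary_isometry_nn:
  assumes "elementary g Z"
  shows "(\<integral>\<^sup>+\<omega>. ennreal ((Z \<omega>)\<^sup>2) \<partial>M) = (\<integral>\<^sup>+s. ennreal ((g s)\<^sup>2) \<partial>lborel)"
proof -
  obtain v where "has_bochner_integral M (\<lambda>\<omega>. Z \<omega> * Z \<omega>) v" "has_bochner_integral lborel (\<lambda>s. g s * g s) v"
    using elementary_isometry[OF assms assms] by blast
  then show ?thesis
    by (simp add: has_bochner_integral_iff nn_integral_eq_integral power2_eq_square)
qed

end

lemma square_sum3_le: "(a + b + c)\<^sup>2 \<le> 3 * (a\<^sup>2 + b\<^sup>2 + (c::real)\<^sup>2)"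
proof -
  have "0 \<le> (a - b)\<^sup>2 + (b - c)\<^sup>2 + (a - c)\<^sup>2" by simp
  then show ?thesis by (simp add: power2_eq_square algebra_simps)
qed

lemma ennreal_square_sum3_le:
  "ennreal ((a + b + c)\<^sup>2) \<le> 3 * (ennreal (a\<^sup>2) + ennreal (b\<^sup>2) + ennreal (c\<^sup>2))"
proof -
  have "ennreal ((a + b + c)\<^sup>2) \<le> ennreal (3 * (a\<^sup>2 + b\<^sup>2 + c\<^sup>2))" by (intro ennreal_leI square_sum3_le)
  also have "\<dots> = 3 * (ennreal (a\<^sup>2) + ennreal (b\<^sup>2) + ennreal (c\<^sup>2))"
    by (simp only: ennreal_mult' ennreal_numeral ennreal_plus zero_le_power2 add_nonneg_nonneg zero_le_numeral)
  finally show ?thesis .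
qed

section \<open>The stochastic integral and its remaining variance V\<close>

locale ito_process = brownian M B for M :: "'a measure" and B +
  fixes \<sigma> :: "real \<Rightarrow> real" and J :: "real \<Rightarrow> 'a \<Rightarrow> real"
  assumes \<sigma>_cont: "continuous_on {0..} \<sigma>"
    and \<sigma>_square_integrable: "set_integrable lborel {0..} (\<lambda>s. (\<sigma> s)\<^sup>2)"
    and \<sigma>_tail_pos: "t \<ge> 0 \<Longrightarrow> (LINT s:{t..}|lborel. (\<sigma> s)\<^sup>2) > 0"
    and J_integral: "t \<ge> 0 \<Longrightarrow> is_stochastic_integral M B \<sigma> t (J t)"
    and J_cont: "AE \<omega> in M. continuous_on {0..} (\<lambda>t. J t \<omega>)"
begin

definition V :: "real \<Rightarrow> real" where "V t = (LINT s:{t..}|lborel. (\<sigma> s)\<^sup>2)"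

lemma J_measurable [measurable]: "t \<ge> 0 \<Longrightarrow> J t \<in> borel_measurable M"
  using J_integral by (simp add: is_stochastic_integral_def)

text \<open>\<sigma> may be arbitrary at negative times, so measurability is shown for its extension
  by 0, which agrees with it on A.\<close>

lemma L2_error_measurable:
  assumes "g \<in> borel_measurable borel" "A \<in> sets borel" "A \<subseteq> {0..}"
  shows "(\<lambda>s. ennreal ((g s - \<sigma> s)\<^sup>2) * indicator A s) \<in> borel_measurable lborel"
proof -
  define \<sigma>' where "\<sigma>' s = indicator {0..} s *\<^sub>R \<sigma> s" for s
  have [measurable]: "\<sigma>' \<in> borel_measurable borel"
    unfolding \<sigma>'_def[abs_def] by (rule borel_measurable_continuous_on_indicator) (use \<sigma>_cont in auto)
  note assms(1,2)[measurable]
  have "(\<lambda>s. ennreal ((g s - \<sigma>' s)\<^sup>2) * indicator A s) \<in> borel_measurable lborel" by measurable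
  moreover have "(\<lambda>s. ennreal ((g s - \<sigma>' s)\<^sup>2) * indicator A s) = (\<lambda>s. ennreal ((g s - \<sigma> s)\<^sup>2) * indicator A s)"
    using assms(3) by (auto simp: fun_eq_iff \<sigma>'_def indicator_def subset_iff)
  ultimately show ?thesis by simp
qed

lemma step_function_outside:
  assumes "0 \<le> \<tau> 0" "mono_on {..n} \<tau>" "\<tau> n \<le> t" "s \<notin> {0<..t}"
  shows "step_function n \<tau> c s = 0"
proof -
  have "s \<notin> {\<tau> i<..\<tau> (Suc i)}" if "i < n" for i
    using that assms mono_onD[OF assms(2), of 0 i] mono_onD[OF assms(2), of "Suc i" n] by auto
  then show ?thesis by (simp add: step_function_def)
qed

text \<open>J t and J s come with unrelated approximating sequences, so their difference is compared
  with S k - S' k. The remaining term S k - S' k - Z is elementary, and the isometry moves it to the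
  time axis, where \<sigma> is inserted between the step functions. Each of the two splittings into
  three squares costs a factor 3, hence 9.\<close>

lemma increment_approximation:
  assumes g: "elementary g Z" and st: "0 \<le> s" "s \<le> t"
    and outside: "\<And>x. x \<notin> {s<..t} \<Longrightarrow> g x = 0"
  shows "(\<integral>\<^sup>+\<omega>. ennreal ((J t \<omega> - J s \<omega> - Z \<omega>)\<^sup>2) \<partial>M)
    \<le> 9 * (\<integral>\<^sup>+x\<in>{s<..t}. ennreal ((g x - \<sigma> x)\<^sup>2) \<partial>lborel)"
proof -
  obtain n \<tau> c where n: "\<And>k. 0 \<le> \<tau> k 0" "\<And>k. mono_on {..n k} (\<tau> k)" "\<And>k. \<tau> k (n k) \<le> t"
    and E: "(\<lambda>k. \<integral>\<^sup>+x\<in>{0..t}. ennreal ((step_function (n k) (\<tau> k) (c k) x - \<sigma> x)\<^sup>2) \<partial>lborel) \<longlonglongrightarrow> 0"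
    and e: "(\<lambda>k. \<integral>\<^sup>+\<omega>. ennreal ((step_integral B (n k) (\<tau> k) (c k) \<omega> - J t \<omega>)\<^sup>2) \<partial>M) \<longlonglongrightarrow> 0"
    using J_integral[of t] st unfolding is_stochastic_integral_def by auto
  obtain n' \<tau>' c' where n': "\<And>k. 0 \<le> \<tau>' k 0" "\<And>k. mono_on {..n' k} (\<tau>' k)" "\<And>k. \<tau>' k (n' k) \<le> s"
    and E': "(\<lambda>k. \<integral>\<^sup>+x\<in>{0..s}. ennreal ((step_function (n' k) (\<tau>' k) (c' k) x - \<sigma> x)\<^sup>2) \<partial>lborel) \<longlonglongrightarrow> 0"
    and e': "(\<lambda>k. \<integral>\<^sup>+\<omega>. ennreal ((step_integral B (n' k) (\<tau>' k) (c' k) \<omega> - J s \<omega>)\<^sup>2) \<partial>M) \<longlonglongrightarrow> 0"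
    using J_integral[of s] st unfolding is_stochastic_integral_def by auto
  define h S h' S' where "h k = step_function (n k) (\<tau> k) (c k)" and "S k = step_integral B (n k) (\<tau> k) (c k)"
    and "h' k = step_function (n' k) (\<tau>' k) (c' k)" and "S' k = step_integral B (n' k) (\<tau>' k) (c' k)" for k
  have el: "elementary (h k) (S k)" "elementary (h' k) (S' k)" for k
    unfolding h_def S_def h'_def S'_def by (intro elementary_step n n')+
  have h0: "h k x = 0" if "x \<notin> {0<..t}" for k x
    unfolding h_def using n that by (intro step_function_outside[of _ _ t]) auto
  have h'0: "h' k x = 0" if "x \<notin> {0<..s}" for k x
    unfolding h'_def using n' that by (intro step_function_outside[of _ _ s]) auto
  have mble[measurable]: "Z \<in> borel_measurable M" "S k \<in> borel_measurable M" "S' k \<in> borel_measurable M"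
    "J t \<in> borel_measurable M" "J s \<in> borel_measurable M" for k
    using elementary_measurable[OF g] elementary_measurable[OF el(1)] elementary_measurable[OF el(2)] st by auto
  have gm: "g \<in> borel_measurable borel" "h k \<in> borel_measurable borel" "h' k \<in> borel_measurable borel" for k
    using elementary_measurable[OF g] elementary_measurable[OF el(1)] elementary_measurable[OF el(2)] by auto
  define Ek Ek' ek ek' Eg where "Ek k = (\<integral>\<^sup>+x\<in>{0..t}. ennreal ((h k x - \<sigma> x)\<^sup>2) \<partial>lborel)"
    and "Ek' k = (\<integral>\<^sup>+x\<in>{0..s}. ennreal ((h' k x - \<sigma> x)\<^sup>2) \<partial>lborel)"
    and "ek k = (\<integral>\<^sup>+\<omega>. ennreal ((S k \<omega> - J t \<omega>)\<^sup>2) \<partial>M)"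
    and "ek' k = (\<integral>\<^sup>+\<omega>. ennreal ((S' k \<omega> - J s \<omega>)\<^sup>2) \<partial>M)"
    and "Eg = (\<integral>\<^sup>+x\<in>{s<..t}. ennreal ((g x - \<sigma> x)\<^sup>2) \<partial>lborel)" for k
  note defs = Ek_def Ek'_def ek_def ek'_def Eg_def
  have bound: "(\<integral>\<^sup>+\<omega>. ennreal ((J t \<omega> - J s \<omega> - Z \<omega>)\<^sup>2) \<partial>M) \<le> 3 * (ek k + ek' k + 3 * (Ek k + Ek' k + Eg))" for k
  proof -
    have "(\<integral>\<^sup>+\<omega>. ennreal ((J t \<omega> - J s \<omega> - Z \<omega>)\<^sup>2) \<partial>M)
        \<le> (\<integral>\<^sup>+\<omega>. 3 * (ennreal ((S k \<omega> - J t \<omega>)\<^sup>2) + ennreal ((S' k \<omega> - J s \<omega>)\<^sup>2) + ennreal ((S k \<omega> - S' k \<omega> - Z \<omega>)\<^sup>2)) \<partial>M)"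
    proof (rule nn_integral_mono)
      fix \<omega>
      show "ennreal ((J t \<omega> - J s \<omega> - Z \<omega>)\<^sup>2)
        \<le> 3 * (ennreal ((S k \<omega> - J t \<omega>)\<^sup>2) + ennreal ((S' k \<omega> - J s \<omega>)\<^sup>2) + ennreal ((S k \<omega> - S' k \<omega> - Z \<omega>)\<^sup>2))"
        using ennreal_square_sum3_le[of "J t \<omega> - S k \<omega>" "S' k \<omega> - J s \<omega>" "S k \<omega> - S' k \<omega> - Z \<omega>"]
        by (simp add: power2_commute algebra_simps)
    qed
    also have "\<dots> = 3 * (ek k + ek' k + (\<integral>\<^sup>+\<omega>. ennreal ((S k \<omega> - S' k \<omega> - Z \<omega>)\<^sup>2) \<partial>M))"
      unfolding defs by (simp add: nn_integral_cmult nn_integral_add)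
    also have "(\<integral>\<^sup>+\<omega>. ennreal ((S k \<omega> - S' k \<omega> - Z \<omega>)\<^sup>2) \<partial>M) = (\<integral>\<^sup>+x. ennreal ((h k x - h' k x - g x)\<^sup>2) \<partial>lborel)"
      by (rule elementary_isometry_nn) (intro elementary_minus el g)
    also have "\<dots> \<le> (\<integral>\<^sup>+x. 3 * (ennreal ((h k x - \<sigma> x)\<^sup>2) * indicator {0..t} x + ennreal ((h' k x - \<sigma> x)\<^sup>2) * indicator {0..s} x
        + ennreal ((g x - \<sigma> x)\<^sup>2) * indicator {s<..t} x) \<partial>lborel)"
    proof (rule nn_integral_mono)
      fix x
      \<comment> \<open>Outside [0, t] all three step functions vanish. On [0, s] g vanishes and on
        (s, t] h' does; the remaining pair is joined through \<sigma>.\<close>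
      consider "x \<notin> {0..t}" | "x \<in> {0..s}" | "x \<in> {s<..t}" using st by fastforce
      then show "ennreal ((h k x - h' k x - g x)\<^sup>2) \<le> 3 * (ennreal ((h k x - \<sigma> x)\<^sup>2) * indicator {0..t} x
        + ennreal ((h' k x - \<sigma> x)\<^sup>2) * indicator {0..s} x + ennreal ((g x - \<sigma> x)\<^sup>2) * indicator {s<..t} x)"
      proof cases
        case 1
        then show ?thesis using h0[of x k] h'0[of x k] outside[of x] st by auto
      next
        case 2
        then show ?thesis
          using ennreal_square_sum3_le[of "h k x - \<sigma> x" "\<sigma> x - h' k x" 0] outside[of x] st
          by (simp add: power2_commute)
      next
        case 3
        then show ?thesis
          using ennreal_square_sum3_le[of "h k x - \<sigma> x" 0 "\<sigma> x - g x"] h'0[of x k] st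
          by (simp add: power2_commute)
      qed
    qed
    also have "\<dots> = 3 * (Ek k + Ek' k + Eg)"
    proof -
      have m: "(\<lambda>x. ennreal ((h k x - \<sigma> x)\<^sup>2) * indicator {0..t} x) \<in> borel_measurable lborel"
        "(\<lambda>x. ennreal ((h' k x - \<sigma> x)\<^sup>2) * indicator {0..s} x) \<in> borel_measurable lborel"
        "(\<lambda>x. ennreal ((g x - \<sigma> x)\<^sup>2) * indicator {s<..t} x) \<in> borel_measurable lborel"
        using st by (intro L2_error_measurable gm; force)+
      show ?thesis unfolding defs
        by (subst nn_integral_cmult, intro borel_measurable_add m)
          (simp only: nn_integral_add m borel_measurable_add)
    qed
    finally show ?thesis by (simp add: add_mono mult_left_mono)
  qed
  have "(\<lambda>k. 3 * (ek k + ek' k + 3 * (Ek k + Ek' k + Eg))) \<longlonglongrightarrow> 3 * (0 + 0 + 3 * (0 + 0 + Eg))"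
    using E E' e e' unfolding defs h_def h'_def S_def S'_def
    by (intro tendsto_intros ennreal_tendsto_cmult) auto
  then have "(\<integral>\<^sup>+\<omega>. ennreal ((J t \<omega> - J s \<omega> - Z \<omega>)\<^sup>2) \<partial>M) \<le> 3 * (0 + 0 + 3 * (0 + 0 + Eg))"
    using bound by (intro LIMSEQ_le_const) auto
  then show ?thesis unfolding Eg_def by (simp add: mult.assoc[symmetric])
qed

lemma V_pos: "t \<ge> 0 \<Longrightarrow> V t > 0"
  using \<sigma>_tail_pos by (simp add: V_def)

lemma \<sigma>_integrable_on:
  assumes "A \<in> sets lborel" "A \<subseteq> {0..}"
  shows "set_integrable lborel A (\<lambda>s. (\<sigma> s)\<^sup>2)"
  using \<sigma>_square_integrable assms by (rule set_integrable_subset)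

lemma V_diff:
  assumes "0 \<le> s" "s \<le> t"
  shows "V s - V t = (LINT x:{s..<t}|lborel. (\<sigma> x)\<^sup>2)"
proof -
  have "(LINT x:{s..<t} \<union> {t..}|lborel. (\<sigma> x)\<^sup>2) = (LINT x:{s..<t}|lborel. (\<sigma> x)\<^sup>2) + V t"
    unfolding V_def using assms by (intro set_integral_Un \<sigma>_integrable_on) auto
  moreover have "{s..<t} \<union> {t..} = {s..}" using assms by auto
  ultimately show ?thesis by (simp add: V_def)
qed

text \<open>Endpoints have measure 0, so the half-open interval may be exchanged for an open or
  closed one.\<close>

lemma V_diff_interval:
  assumes "0 \<le> s" "s \<le> t" "sym_diff {s..<t} A \<subseteq> {s, t}"
  shows "V s - V t = (LINT x:A|lborel. (\<sigma> x)\<^sup>2)"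
proof -
  have "(LINT x:{s..<t}|lborel. (\<sigma> x)\<^sup>2) = (LINT x:A|lborel. (\<sigma> x)\<^sup>2)"
    by (rule set_integral_discrete_difference[OF _ assms(3)]) auto
  then show ?thesis using V_diff[OF assms(1,2)] by simp
qed

lemma V_antimono: "0 \<le> s \<Longrightarrow> s \<le> t \<Longrightarrow> V t \<le> V s"
proof -
  assume "0 \<le> s" "s \<le> t"
  moreover have "0 \<le> (LINT x:{s..<t}|lborel. (\<sigma> x)\<^sup>2)"
    unfolding set_lebesgue_integral_def by (rule integral_nonneg_AE) auto
  ultimately show ?thesis using V_diff[of s t] by simp
qed

lemma V_tendsto_0: "(V \<longlongrightarrow> 0) at_top"
proof -
  have "((\<lambda>t. LINT x:{0..t}|lborel. (\<sigma> x)\<^sup>2) \<longlongrightarrow> V 0) at_top"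
    unfolding V_def by (rule tendsto_set_lebesgue_integral_at_top[OF _ \<sigma>_square_integrable]) auto
  then have "((\<lambda>t. V 0 - (LINT x:{0..t}|lborel. (\<sigma> x)\<^sup>2)) \<longlongrightarrow> V 0 - V 0) at_top" by (intro tendsto_intros)
  moreover have "\<forall>\<^sub>F t in at_top. V 0 - (LINT x:{0..t}|lborel. (\<sigma> x)\<^sup>2) = V t"
    using eventually_ge_at_top[of 0]
  proof eventually_elim
    case (elim t)
    moreover have "sym_diff {0..<t} {0..t} \<subseteq> {0, t}" by auto
    ultimately show ?case using V_diff_interval[of 0 t "{0..t}"] by simp
  qed
  ultimately show ?thesis by (simp add: tendsto_cong)
qed

lemma V_cont: "continuous_on {0..b} V"
proof -
  have int: "set_integrable lborel {0..t} (\<lambda>s. (\<sigma> s)\<^sup>2)" for t by (rule \<sigma>_integrable_on) auto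
  have "continuous_on {0..b} (\<lambda>t. V 0 - integral {0..t} (\<lambda>s. (\<sigma> s)\<^sup>2))"
    using set_borel_integral_eq_integral(1)[OF int[of b]]
    by (intro continuous_intros indefinite_integral_continuous_1)
  moreover have "V 0 - integral {0..t} (\<lambda>s. (\<sigma> s)\<^sup>2) = V t" if "t \<in> {0..b}" for t
  proof -
    have "sym_diff {0..<t} {0..t} \<subseteq> {0, t}" by auto
    then show ?thesis using V_diff_interval[of 0 t "{0..t}"] set_borel_integral_eq_integral(2)[OF int[of t]] that
      by simp
  qed
  ultimately show ?thesis by (rule continuous_on_eq)
qed

end

section \<open>Refined grids and independent normal blocks\<close>

lemma strict_mono_Ioc_cover:
  fixes \<tau> :: "nat \<Rightarrow> real"
  assumes "a \<le> b" "x \<in> {\<tau> a<..\<tau> b}"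
  shows "\<exists>i\<in>{a..<b}. x \<in> {\<tau> i<..\<tau> (Suc i)}"
  using assms
proof (induction b rule: dec_induct)
  case (step n)
  show ?case
  proof (cases "x \<le> \<tau> n")
    case True
    then obtain i where "i \<in> {a..<n}" "x \<in> {\<tau> i<..\<tau> (Suc i)}" using step by auto
    then show ?thesis by (intro bexI[of _ i]) auto
  next
    case False
    then show ?thesis using step by (intro bexI[of _ n]) auto
  qed
qed simp

lemma strict_mono_Ioc_sum:
  fixes \<tau> c :: "nat \<Rightarrow> real"
  assumes "strict_mono \<tau>" "i \<in> {a..<b}" "x \<in> {\<tau> i<..\<tau> (Suc i)}"
  shows "(\<Sum>k\<in>{a..<b}. c k * indicator {\<tau> k<..\<tau> (Suc k)} x) = c i"
proof -
  have "x \<notin> {\<tau> k<..\<tau> (Suc k)}" if "k \<noteq> i" for k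
  proof (cases "k < i")
    case True
    then have "\<tau> (Suc k) \<le> \<tau> i" using assms(1) by (simp add: strict_mono_less_eq)
    then show ?thesis using assms(3) by auto
  next
    case False
    then have "\<tau> (Suc i) \<le> \<tau> k" using assms(1) that by (simp add: strict_mono_less_eq)
    then show ?thesis using assms(3) by auto
  qed
  then have "(\<Sum>k\<in>{a..<b}. c k * indicator {\<tau> k<..\<tau> (Suc k)} x) = (\<Sum>k\<in>{a..<b}. if k = i then c i else 0)"
    using assms(3) by (intro sum.cong) auto
  then show ?thesis using assms(2) by simp
qed

text \<open>Each [t j, t (j + 1)] is cut into m equal pieces. Numbering them consecutively gives
  block j the indices from j m to (j + 1) m - 1, which is what quotient and remainder by m
  decode.\<close>

lemma grid_refinement:
  fixes t :: "nat \<Rightarrow> real"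
  assumes "strict_mono t" "0 < m"
  obtains \<tau> where "strict_mono \<tau>" "\<And>j. \<tau> (j * m) = t j"
    "\<And>i. \<tau> (Suc i) - \<tau> i = (t (Suc (i div m)) - t (i div m)) / real m"
proof -
  define \<tau> where "\<tau> i = t (i div m) + real (i mod m) / real m * (t (Suc (i div m)) - t (i div m))" for i
  have step: "\<tau> (Suc i) - \<tau> i = (t (Suc (i div m)) - t (i div m)) / real m" for i
  proof (cases "Suc (i mod m) < m")
    case True
    then have "Suc i mod m = Suc (i mod m)" "Suc i div m = i div m" by (auto simp: mod_Suc div_Suc)
    then show ?thesis by (simp add: \<tau>_def algebra_simps flip: diff_divide_distrib add_divide_distrib)
  next
    case False
    then have e: "Suc (i mod m) = m" using \<open>0 < m\<close> by (meson Suc_lessI mod_less_divisor)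
    then have "Suc i mod m = 0" "Suc i div m = Suc (i div m)" by (auto simp: mod_Suc div_Suc)
    moreover have "real (i mod m) / real m = 1 - 1 / real m"
    proof -
      have "real (i mod m) = real m - 1" using e by linarith
      then show ?thesis using \<open>0 < m\<close> by (simp add: diff_divide_distrib)
    qed
    ultimately show ?thesis by (simp add: \<tau>_def left_diff_distrib)
  qed
  have "\<tau> i < \<tau> (Suc i)" for i
    using step[of i] strict_monoD[OF assms(1), of "i div m" "Suc (i div m)"] \<open>0 < m\<close>
    by (metis diff_gt_0_iff_gt divide_pos_pos lessI of_nat_0_less_iff)
  then have "strict_mono \<tau>" by (simp add: strict_mono_Suc_iff)
  moreover have "\<tau> (j * m) = t j" for j using \<open>0 < m\<close> by (simp add: \<tau>_def)
  ultimately show ?thesis using step that by blast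
qed

context brownian begin

text \<open>Blocks use disjoint sets of independent increments of B. Nonzero coefficients and m > 0
  keep each variance positive, since \<open>normal_density\<close> with deviation 0 is not a
  probability density.\<close>

lemma block_sums_normal:
  fixes c :: "nat \<Rightarrow> real"
  assumes \<tau>: "strict_mono \<tau>" "0 \<le> \<tau> 0" and c: "\<And>i. c i \<noteq> 0" and "0 < m"
  defines "G \<equiv> \<lambda>j \<omega>. \<Sum>i\<in>{j * m..<Suc j * m}. c i * (B (\<tau> (Suc i)) \<omega> - B (\<tau> i) \<omega>)"
  shows "indep_vars (\<lambda>_. borel) G {..<N}"
    and "\<exists>w>0. distributed M lborel (G j) (normal_density 0 w)"
proof -
  let ?X = "\<lambda>i \<omega>. B (\<tau> (Suc i)) \<omega> - B (\<tau> i) \<omega>"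
  let ?K = "\<lambda>j. {j * m..<Suc j * m}"
  have X: "indep_vars (\<lambda>_. borel) ?X {..<n}" for n
  proof -
    have "mono_on {..n} \<tau>" using \<tau>(1) by (auto intro!: mono_onI simp: strict_mono_less_eq)
    then show ?thesis using bm \<tau>(2) unfolding standard_brownian_motion_def by blast
  qed
  have disj: "disjoint_family_on ?K {..<N}"
  unfolding disjoint_family_on_def
  proof (intro ballI impI)
    fix i j :: nat assume "i \<noteq> j"
    moreover have "{a * m..<Suc a * m} \<inter> {b * m..<Suc b * m} = {}" if "a < b" for a b
    proof -
      have "Suc a * m \<le> b * m" using that by (intro mult_right_mono) auto
      then show ?thesis by auto
    qed
    ultimately show "?K i \<inter> ?K j = {}" by (cases i j rule: linorder_cases) (auto simp: Int_commute)
  qed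
  have sub: "?K j \<subseteq> {..<N * m}" if "j \<in> {..<N}" for j
  proof -
    have "Suc j * m \<le> N * m" using that by (intro mult_right_mono) auto
    then show ?thesis by auto
  qed
  have "indep_vars (\<lambda>j. borel) (\<lambda>j \<omega>. (\<lambda>x. \<Sum>i\<in>?K j. c i * x i) (restrict (\<lambda>i. ?X i \<omega>) (?K j))) {..<N}"
    by (rule indep_vars_compose2[OF indep_vars_restrict[OF X[of "N * m"] sub disj]])
      (auto intro!: borel_measurable_sum borel_measurable_times measurable_component_singleton)
  then show "indep_vars (\<lambda>_. borel) G {..<N}"
    by (rule indep_vars_cong[THEN iffD1, rotated -1]) (auto simp: G_def intro!: sum.cong)
  let ?w = "\<lambda>i. \<bar>c i\<bar> * sqrt (\<tau> (Suc i) - \<tau> i)"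
  have w: "0 < ?w i" for i using c[of i] strict_monoD[OF \<tau>(1), of i "Suc i"] by simp
  have ge: "0 \<le> \<tau> i" for i using \<tau> strict_mono_less_eq[OF \<tau>(1), of 0 i] by simp
  have "distributed M lborel (\<lambda>\<omega>. \<Sum>i\<in>?K j. c i * ?X i \<omega>)
     (normal_density (\<Sum>i\<in>?K j. 0) (sqrt (\<Sum>i\<in>?K j. (?w i)\<^sup>2)))"
  proof (rule sum_indep_normal)
    show "indep_vars (\<lambda>i. borel) (\<lambda>i \<omega>. c i * ?X i \<omega>) (?K j)"
      by (rule indep_vars_compose2[OF indep_vars_subset[OF X[of "Suc j * m"]]]) auto
    fix i
    show "distributed M lborel (\<lambda>\<omega>. c i * ?X i \<omega>) (normal_density 0 (?w i))"
      using normal_density_affine[OF B_increment[OF ge, of i "\<tau> (Suc i)"] _ c[of i], of 0]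
        strict_monoD[OF \<tau>(1), of i "Suc i"] by simp
  qed (use w \<open>0 < m\<close> in auto)
  moreover have "0 < sqrt (\<Sum>i\<in>?K j. (?w i)\<^sup>2)"
  proof -
    have "0 < (?w i)\<^sup>2" for i using w[of i] by (intro zero_less_power)
    then show ?thesis using \<open>0 < m\<close> by (intro real_sqrt_gt_zero sum_pos) auto
  qed
  ultimately show "\<exists>w>0. distributed M lborel (G j) (normal_density 0 w)"
    unfolding G_def by (intro exI conjI) (assumption, simp)
qed

text \<open>The second moment of Z is w^2 and, by the isometry, also the integral of g^2. This
  identifies w without a computation from the coefficients.\<close>

lemma elementary_normal_variance:
  assumes "elementary g Z" "distributed M lborel Z (normal_density 0 w)" "0 < w"
  shows "has_bochner_integral lborel (\<lambda>x. (g x)\<^sup>2) (w\<^sup>2)"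
proof -
  obtain v where v: "has_bochner_integral M (\<lambda>\<omega>. Z \<omega> * Z \<omega>) v" "has_bochner_integral lborel (\<lambda>s. g s * g s) v"
    using elementary_isometry[OF assms(1,1)] by blast
  have "expectation (\<lambda>\<omega>. (Z \<omega>)\<^sup>2) = w\<^sup>2"
    using normal_distributed_variance[OF assms(3,2)] normal_distributed_expectation[OF assms(3,2)] by simp
  then have "v = w\<^sup>2" using v(1) by (simp add: has_bochner_integral_iff power2_eq_square)
  then show ?thesis using v(2) by (simp add: power2_eq_square)
qed

end

context ito_process begin

text \<open>Uniform continuity on [0, t N] lets a step function \<open>g j\<close> follow \<sigma>
  within e on block j. Then \<open>increment_approximation\<close> bounds the L2 error, and |g^2 -
  \<sigma>^2| \<le> e (e + 2 K) bounds the variance error.\<close>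

lemma block_approximation:
  fixes t :: "nat \<Rightarrow> real"
  assumes t: "strict_mono t" "0 \<le> t 0" and "0 < \<eta>"
  obtains G where "indep_vars (\<lambda>_. borel) G {..<N}"
    "\<And>j. j < N \<Longrightarrow> \<exists>w>0. distributed M lborel (G j) (normal_density 0 w) \<and> \<bar>w\<^sup>2 - (V (t j) - V (t (Suc j)))\<bar> \<le> \<eta>"
    "\<And>j. j < N \<Longrightarrow> (\<integral>\<^sup>+\<omega>. ennreal ((J (t (Suc j)) \<omega> - J (t j) \<omega> - G j \<omega>)\<^sup>2) \<partial>M) \<le> ennreal \<eta>"
proof -
  define T where "T = t N"
  have t_ge: "0 \<le> t j" for j using t strict_mono_less_eq[OF t(1), of 0 j] by simp
  then have "0 \<le> T" by (simp add: T_def)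
  have \<sigma>T: "continuous_on {0..T} \<sigma>" by (rule continuous_on_subset[OF \<sigma>_cont]) auto
  have "bounded (\<sigma> ` {0..T})" by (intro compact_imp_bounded compact_continuous_image \<sigma>T) simp
  then obtain K where K: "0 < K" "\<And>x. x \<in> {0..T} \<Longrightarrow> \<bar>\<sigma> x\<bar> \<le> K"
    unfolding bounded_pos by (auto simp: image_iff)
  \<comment> \<open>As e \<le> 1, the product of e and (9 + 2 K) (T + 1) dominates both errors, 9
    e^2 T and e (e + 2 K) T.\<close>
  define e where "e = min 1 (\<eta> / ((9 + 2 * K) * (T + 1)))"
  have e: "0 < e" "e \<le> 1" using \<open>0 < \<eta>\<close> \<open>0 \<le> T\<close> K by (auto simp: e_def)
  have "e \<le> \<eta> / ((9 + 2 * K) * (T + 1))" by (simp add: e_def)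
  then have e_le: "e * ((9 + 2 * K) * (T + 1)) \<le> \<eta>"
    using K \<open>0 \<le> T\<close> by (simp add: pos_le_divide_eq)
  have e1: "9 * e\<^sup>2 * T \<le> \<eta>"
  proof -
    have "9 * e\<^sup>2 * T \<le> e * ((9 + 2 * K) * (T + 1))"
      unfolding power2_eq_square
    proof -
      have "9 * (e * e) * T = e * ((9 * e) * T)" by simp
      also have "\<dots> \<le> e * ((9 + 2 * K) * (T + 1))" using e K \<open>0 \<le> T\<close> by (intro mult_left_mono mult_mono) auto
      finally show "9 * (e * e) * T \<le> e * ((9 + 2 * K) * (T + 1))" .
    qed
    then show ?thesis using e_le by simp
  qed
  have e2: "e * (e + 2 * K) * T \<le> \<eta>"
  proof -
    have "e * (e + 2 * K) * T = e * ((e + 2 * K) * T)" by simp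
    also have "\<dots> \<le> e * ((9 + 2 * K) * (T + 1))" using e K \<open>0 \<le> T\<close> by (intro mult_left_mono mult_mono) auto
    finally show ?thesis using e_le by simp
  qed
  have "uniformly_continuous_on {0..T} \<sigma>" by (intro compact_uniformly_continuous \<sigma>T) simp
  then obtain \<delta> where \<delta>: "0 < \<delta>" "\<And>x y. x \<in> {0..T} \<Longrightarrow> y \<in> {0..T} \<Longrightarrow> \<bar>y - x\<bar> < \<delta> \<Longrightarrow> \<bar>\<sigma> y - \<sigma> x\<bar> < e / 3"
    unfolding uniformly_continuous_on_def dist_real_def using e(1) by (metis zero_less_divide_iff zero_less_numeral)
  obtain m where m: "T / \<delta> < real m" "0 < m"
    using reals_Archimedean2[of "max (T / \<delta>) 0"] by (metis max_less_iff_conj of_nat_0_less_iff)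
  obtain \<tau> where \<tau>: "strict_mono \<tau>" "\<And>j. \<tau> (j * m) = t j"
    "\<And>i. \<tau> (Suc i) - \<tau> i = (t (Suc (i div m)) - t (i div m)) / real m"
    using grid_refinement[OF t(1) m(2)] by blast
  have \<tau>_ge: "0 \<le> \<tau> i" for i
    using t(2) \<tau>(2)[of 0] strict_mono_less_eq[OF \<tau>(1), of 0 i] by simp
  \<comment> \<open>Coefficients must be nonzero for \<open>block_sums_normal\<close>, so small
    values of \<sigma> are replaced by e / 3. This costs at most 2 e / 3, and the oscillation of
    \<sigma> between grid points less than e / 3.\<close>
  define c where "c i = (if \<bar>\<sigma> (\<tau> i)\<bar> < e / 3 then e / 3 else \<sigma> (\<tau> i))" for i
  have c: "c i \<noteq> 0" "\<bar>c i - \<sigma> (\<tau> i)\<bar> \<le> 2 * e / 3" for i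
    using e by (auto simp: c_def)
  define G where "G j \<omega> = (\<Sum>i\<in>{j * m..<Suc j * m}. c i * (B (\<tau> (Suc i)) \<omega> - B (\<tau> i) \<omega>))" for j \<omega>
  define g where "g j x = (\<Sum>i\<in>{j * m..<Suc j * m}. c i * indicator {\<tau> i<..\<tau> (Suc i)} x)" for j x
  have G_def': "G = (\<lambda>j \<omega>. \<Sum>i\<in>{j * m..<Suc j * m}. c i * (B (\<tau> (Suc i)) \<omega> - B (\<tau> i) \<omega>))"
    by (simp add: G_def fun_eq_iff)
  note blocks = block_sums_normal[where c = c and m = m, OF \<tau>(1) \<tau>_ge c(1) m(2), folded G_def']
  have gG: "elementary (g j) (G j)" for j
    unfolding g_def[abs_def] G_def[abs_def]
    using \<tau>_ge strict_monoD[OF \<tau>(1)] by (intro elementary_sum) (auto intro: less_imp_le)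
  have g0: "g j x = 0" if "x \<notin> {t j<..t (Suc j)}" for j x
  proof -
    have "x \<notin> {\<tau> i<..\<tau> (Suc i)}" if "i \<in> {j * m..<Suc j * m}" for i
    proof -
      have "\<tau> (j * m) \<le> \<tau> i" "\<tau> (Suc i) \<le> \<tau> (Suc j * m)"
        using that \<tau>(1) by (auto simp: strict_mono_less_eq)
      then show ?thesis using \<open>x \<notin> {t j<..t (Suc j)}\<close> \<tau>(2)[of j] \<tau>(2)[of "Suc j"] by auto
    qed
    then show ?thesis by (simp add: g_def)
  qed
  have close: "\<bar>g j x - \<sigma> x\<bar> \<le> e" if "j < N" "x \<in> {t j<..t (Suc j)}" for j x
  proof -
    have "j * m \<le> Suc j * m" by simp
    moreover have "x \<in> {\<tau> (j * m)<..\<tau> (Suc j * m)}" using that \<tau>(2) by metis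
    ultimately obtain i where i: "i \<in> {j * m..<Suc j * m}" "x \<in> {\<tau> i<..\<tau> (Suc i)}"
      using strict_mono_Ioc_cover by blast
    have gx: "g j x = c i" unfolding g_def by (rule strict_mono_Ioc_sum[OF \<tau>(1) i])
    have idiv: "i div m = j" using i(1) m(2) by (intro div_nat_eqI) (auto simp: algebra_simps)
    have tN: "t (Suc j) \<le> T" unfolding T_def using that t(1) by (simp add: strict_mono_less_eq)
    have "\<tau> (Suc i) - \<tau> i \<le> T / real m"
      using \<tau>(3)[of i] idiv tN t_ge[of j] by (auto intro!: divide_right_mono)
    also have "\<dots> < \<delta>" using m \<delta>(1) by (simp add: field_simps)
    finally have "\<bar>x - \<tau> i\<bar> < \<delta>" using i(2) by auto
    moreover have "x \<in> {0..T}" "\<tau> i \<in> {0..T}" using that tN t_ge[of j] \<tau>_ge[of i] i(2) by auto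
    ultimately have "\<bar>\<sigma> x - \<sigma> (\<tau> i)\<bar> < e / 3" using \<delta>(2) by blast
    then show ?thesis using c(2)[of i] gx by linarith
  qed
  have len: "t (Suc j) - t j \<le> T" "0 \<le> t (Suc j) - t j" if "j < N" for j
    using that t_ge[of j] strict_mono_less_eq[OF t(1), of "Suc j" N] strict_mono_less_eq[OF t(1), of j "Suc j"]
    unfolding T_def by auto
  have "(\<integral>\<^sup>+\<omega>. ennreal ((J (t (Suc j)) \<omega> - J (t j) \<omega> - G j \<omega>)\<^sup>2) \<partial>M) \<le> ennreal \<eta>" if "j < N" for j
  proof -
    have "(\<integral>\<^sup>+\<omega>. ennreal ((J (t (Suc j)) \<omega> - J (t j) \<omega> - G j \<omega>)\<^sup>2) \<partial>M)
      \<le> 9 * (\<integral>\<^sup>+x\<in>{t j<..t (Suc j)}. ennreal ((g j x - \<sigma> x)\<^sup>2) \<partial>lborel)"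
      using len[OF that] t_ge g0 by (intro increment_approximation gG) auto
    also have "(\<integral>\<^sup>+x\<in>{t j<..t (Suc j)}. ennreal ((g j x - \<sigma> x)\<^sup>2) \<partial>lborel)
      \<le> (\<integral>\<^sup>+x. ennreal (e\<^sup>2) * indicator {t j<..t (Suc j)} x \<partial>lborel)"
    proof (rule nn_integral_mono)
      fix x
      show "ennreal ((g j x - \<sigma> x)\<^sup>2) * indicator {t j<..t (Suc j)} x \<le> ennreal (e\<^sup>2) * indicator {t j<..t (Suc j)} x"
      proof (cases "x \<in> {t j<..t (Suc j)}")
        case True
        have "(g j x - \<sigma> x)\<^sup>2 \<le> e\<^sup>2" using power_mono[OF close[OF that True], of 2] by simp
        then show ?thesis using True by (simp add: ennreal_leI)
      qed simp
    qed
    also have "\<dots> = ennreal (e\<^sup>2 * (t (Suc j) - t j))"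
      using len[OF that] by (simp add: nn_integral_cmult_indicator ennreal_mult)
    also have "9 * \<dots> = ennreal (9 * (e\<^sup>2 * (t (Suc j) - t j)))"
      using len[OF that] by (subst ennreal_mult') auto
    also have "\<dots> \<le> ennreal \<eta>"
    proof (rule ennreal_leI)
      have "9 * (e\<^sup>2 * (t (Suc j) - t j)) \<le> 9 * (e\<^sup>2 * T)" using len[OF that] by (intro mult_left_mono) auto
      then show "9 * (e\<^sup>2 * (t (Suc j) - t j)) \<le> \<eta>" using e1 by simp
    qed
    finally show ?thesis by (simp add: mult_left_mono)
  qed
  moreover have "\<exists>w>0. distributed M lborel (G j) (normal_density 0 w) \<and> \<bar>w\<^sup>2 - (V (t j) - V (t (Suc j)))\<bar> \<le> \<eta>"
    if "j < N" for j
  proof -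
    obtain w where w: "0 < w" "distributed M lborel (G j) (normal_density 0 w)" using blocks(2)[of j] unfolding G_def' by (elim exE conjE)
    let ?A = "{t j<..t (Suc j)}"
    have sub: "?A \<subseteq> {0..T}" using t_ge[of j] len[OF that] strict_mono_less_eq[OF t(1), of "Suc j" N] that
      by (auto simp: T_def)
    have int: "has_bochner_integral lborel (\<lambda>x. (g j x)\<^sup>2) (w\<^sup>2)" by (rule elementary_normal_variance[OF gG w(2,1)])
    have i\<sigma>: "integrable lborel (\<lambda>x. indicator ?A x * (\<sigma> x)\<^sup>2)"
      using \<sigma>_integrable_on[of ?A] sub unfolding set_integrable_def by force
    have "V (t j) - V (t (Suc j)) = (LINT x:?A|lborel. (\<sigma> x)\<^sup>2)"
      using t_ge len[OF that] by (intro V_diff_interval) auto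
    then have "w\<^sup>2 - (V (t j) - V (t (Suc j))) = (LINT x|lborel. (g j x)\<^sup>2 - indicator ?A x * (\<sigma> x)\<^sup>2)"
      using int i\<sigma> unfolding set_lebesgue_integral_def has_bochner_integral_iff
      by (simp add: Bochner_Integration.integral_diff)
    also have "\<bar>\<dots>\<bar> \<le> (LINT x|lborel. \<bar>(g j x)\<^sup>2 - indicator ?A x * (\<sigma> x)\<^sup>2\<bar>)"
      by (rule integral_abs_bound)
    also have "\<dots> \<le> (LINT x|lborel. e * (e + 2 * K) * indicator ?A x)"
    proof (rule integral_mono)
      show "integrable lborel (\<lambda>x. \<bar>(g j x)\<^sup>2 - indicator ?A x * (\<sigma> x)\<^sup>2\<bar>)"
        using int i\<sigma> unfolding has_bochner_integral_iff by (intro integrable_abs Bochner_Integration.integrable_diff) auto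
      show "integrable lborel (\<lambda>x. e * (e + 2 * K) * indicator ?A x)"
        using len[OF that] by (intro integrable_mult_right integrable_real_indicator) auto
      fix x
      show "\<bar>(g j x)\<^sup>2 - indicator ?A x * (\<sigma> x)\<^sup>2\<bar> \<le> e * (e + 2 * K) * indicator ?A x"
      proof (cases "x \<in> ?A")
        case True
        have 1: "\<bar>g j x - \<sigma> x\<bar> \<le> e" by (rule close[OF that True])
        have 2: "\<bar>\<sigma> x\<bar> \<le> K" using K(2) True sub by blast
        have "(g j x)\<^sup>2 - (\<sigma> x)\<^sup>2 = (g j x - \<sigma> x) * (g j x + \<sigma> x)" by (simp add: power2_eq_square algebra_simps)
        then have "\<bar>(g j x)\<^sup>2 - (\<sigma> x)\<^sup>2\<bar> = \<bar>g j x - \<sigma> x\<bar> * \<bar>g j x + \<sigma> x\<bar>" by (simp add: abs_mult)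
        also have "\<dots> \<le> e * (e + 2 * K)" using 1 2 e by (intro mult_mono) auto
        finally show ?thesis using True by simp
      qed (use g0 in simp)
    qed
    also have "\<dots> = e * (e + 2 * K) * (t (Suc j) - t j)" using len[OF that] by simp
    also have "\<dots> \<le> e * (e + 2 * K) * T" using len[OF that] e K by (intro mult_left_mono) auto
    also have "\<dots> \<le> \<eta>" by (rule e2)
    finally show ?thesis using w by (intro exI[of _ w] conjI)
  qed
  ultimately show ?thesis by (intro that[of G] blocks(1))
qed

end

section \<open>The iterated logarithm\<close>

context prob_space begin

text \<open>Ottaviani's inequality, by decomposition along the first exceedance.\<close>

lemma maximal_inequality:
  fixes G :: "nat \<Rightarrow> 'a \<Rightarrow> real"
  assumes ind: "indep_vars (\<lambda>_. borel) G {..<N}" and "0 \<le> a"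
    and tail: "\<And>j. j \<le> N \<Longrightarrow> prob {\<omega> \<in> space M. a < \<bar>\<Sum>i\<in>{j..<N}. G i \<omega>\<bar>} \<le> 1 / 2"
  shows "prob {\<omega> \<in> space M. \<exists>j\<le>N. 2 * a < \<bar>\<Sum>i<j. G i \<omega>\<bar>} \<le> 2 * prob {\<omega> \<in> space M. a < \<bar>\<Sum>i<N. G i \<omega>\<bar>}"
proof -
  have Gm [measurable]: "G i \<in> borel_measurable M" if "i < N" for i
    using ind that by (auto simp: indep_vars_def)
  define S where "S j \<omega> = (\<Sum>i<j. G i \<omega>)" for j \<omega>
  have S [measurable]: "S j \<in> borel_measurable M" if "j \<le> N" for j
    unfolding S_def[abs_def] using that by (intro borel_measurable_sum Gm) auto
  \<comment> \<open>\<open>A j\<close> depends only on the summands before j and \<open>C j\<close>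
    only on those from j on. On their intersection the final sum still exceeds 2 a - a = a.\<close>
  define A C where "A j = {\<omega> \<in> space M. 2 * a < \<bar>S j \<omega>\<bar> \<and> (\<forall>k\<in>{..<j}. \<bar>S k \<omega>\<bar> \<le> 2 * a)}"
    and "C j = {\<omega> \<in> space M. \<bar>\<Sum>i\<in>{j..<N}. G i \<omega>\<bar> \<le> a}" for j
  have A_sets: "A j \<in> events" if "j \<le> N" for j
  proof -
    have [measurable]: "S k \<in> borel_measurable M" if "k \<in> insert j {..<j}" for k using that \<open>j \<le> N\<close> S by auto
    show ?thesis unfolding A_def by measurable
  qed
  have T [measurable]: "(\<lambda>\<omega>. \<Sum>i\<in>{j..<N}. G i \<omega>) \<in> borel_measurable M" for j
    by (intro borel_measurable_sum Gm) auto
  have C_sets: "C j \<in> events" for j unfolding C_def by measurable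
  have indep: "prob (A j \<inter> C j) = prob (A j) * prob (C j)" if "j \<le> N" for j
  proof -
    let ?P = "PiM {..<j} (\<lambda>_. borel :: real measure)" and ?Q = "PiM {j..<N} (\<lambda>_. borel :: real measure)"
    let ?U = "{x \<in> space ?P. 2 * a < \<bar>\<Sum>i<j. x i\<bar> \<and> (\<forall>k\<in>{..<j}. \<bar>\<Sum>i<k. x i\<bar> \<le> 2 * a)}"
    let ?W = "{x \<in> space ?Q. \<bar>\<Sum>i\<in>{j..<N}. x i\<bar> \<le> a}"
    have [measurable]: "(\<lambda>x. \<Sum>i<k. x i) \<in> borel_measurable ?P" if "k \<le> j" for k
      using that by (intro borel_measurable_sum measurable_component_singleton) auto
    have [measurable]: "(\<lambda>x. \<Sum>i<k. x i) \<in> borel_measurable ?P" if "k \<in> {..<j}" for k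
      using that by (intro borel_measurable_sum measurable_component_singleton) auto
    have [measurable]: "(\<lambda>x. \<Sum>i\<in>{j..<N}. x i) \<in> borel_measurable ?Q"
      by (intro borel_measurable_sum measurable_component_singleton) auto
    have U: "?U \<in> sets ?P" by measurable
    have W: "?W \<in> sets ?Q" by measurable
    have iv: "indep_var ?P (\<lambda>\<omega>. restrict (\<lambda>i. G i \<omega>) {..<j}) ?Q (\<lambda>\<omega>. restrict (\<lambda>i. G i \<omega>) {j..<N})"
      using that by (intro indep_var_restrict[OF ind]) auto
    have eA: "(\<lambda>\<omega>. restrict (\<lambda>i. G i \<omega>) {..<j}) -` ?U \<inter> space M = A j"
      by (auto simp: A_def S_def space_PiM)
    have eC: "(\<lambda>\<omega>. restrict (\<lambda>i. G i \<omega>) {j..<N}) -` ?W \<inter> space M = C j"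
      by (auto simp: C_def space_PiM)
    have "(\<lambda>x. (restrict (\<lambda>i. G i x) {..<j}, restrict (\<lambda>i. G i x) {j..<N})) -` (?U \<times> ?W) \<inter> space M = A j \<inter> C j"
      unfolding eA[symmetric] eC[symmetric] by auto
    with indep_varD[OF iv U W] show ?thesis unfolding eA eC by simp
  qed
  have C_half: "1 / 2 \<le> prob (C j)" if "j \<le> N" for j
  proof -
    have "{\<omega> \<in> space M. a < \<bar>\<Sum>i\<in>{j..<N}. G i \<omega>\<bar>} = space M - C j" by (auto simp: C_def)
    then have "prob {\<omega> \<in> space M. a < \<bar>\<Sum>i\<in>{j..<N}. G i \<omega>\<bar>} = 1 - prob (C j)"
      using prob_compl[OF C_sets] by simp
    then show ?thesis using tail[OF that] by simp
  qed
  have disj: "disjoint_family_on A {..N}"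
    unfolding disjoint_family_on_def
  proof (intro ballI impI)
    fix i j :: nat assume "i \<noteq> j"
    moreover have "A i \<inter> A j = {}" if "i < j" for i j
      using that unfolding A_def by (force simp: not_less)
    ultimately show "A i \<inter> A j = {}" by (cases i j rule: linorder_cases) (auto simp: Int_commute)
  qed
  have "{\<omega> \<in> space M. \<exists>j\<le>N. 2 * a < \<bar>S j \<omega>\<bar>} = (\<Union>j\<in>{..N}. A j)"
  proof safe
    fix \<omega> j assume w: "\<omega> \<in> space M" "j \<le> N" "2 * a < \<bar>S j \<omega>\<bar>"
    define k where "k = (LEAST j. 2 * a < \<bar>S j \<omega>\<bar>)"
    have "2 * a < \<bar>S k \<omega>\<bar>" "k \<le> j" unfolding k_def using w(3) by (auto intro: LeastI Least_le)
    moreover have "\<bar>S i \<omega>\<bar> \<le> 2 * a" if "i < k" for i using not_less_Least[of i "\<lambda>j. 2 * a < \<bar>S j \<omega>\<bar>"] that by (auto simp: k_def not_less)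
    ultimately show "\<omega> \<in> (\<Union>j\<in>{..N}. A j)" using w by (intro UN_I[of k]) (auto simp: A_def)
  qed (auto simp: A_def)
  then have "prob {\<omega> \<in> space M. \<exists>j\<le>N. 2 * a < \<bar>S j \<omega>\<bar>} = (\<Sum>j\<le>N. prob (A j))"
    using A_sets disj by (simp add: finite_measure_finite_Union image_subset_iff)
  also have "\<dots> \<le> (\<Sum>j\<le>N. 2 * prob (A j \<inter> C j))"
  proof (rule sum_mono)
    fix j assume "j \<in> {..N}"
    then show "prob (A j) \<le> 2 * prob (A j \<inter> C j)"
      using indep[of j] C_half[of j] mult_left_mono[of "1/2" "prob (C j)" "prob (A j)"] by auto
  qed
  also have "\<dots> = 2 * prob (\<Union>j\<in>{..N}. A j \<inter> C j)"
  proof -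
    have "disjoint_family_on (\<lambda>j. A j \<inter> C j) {..N}" using disj unfolding disjoint_family_on_def by blast
    then show ?thesis
      using A_sets C_sets by (subst finite_measure_finite_Union) (auto simp: sum_distrib_left)
  qed
  also have "\<dots> \<le> 2 * prob {\<omega> \<in> space M. a < \<bar>S N \<omega>\<bar>}"
  proof (intro mult_left_mono finite_measure_mono subsetI)
    fix \<omega> assume "\<omega> \<in> (\<Union>j\<in>{..N}. A j \<inter> C j)"
    then obtain j where j: "j \<le> N" "\<omega> \<in> space M" "2 * a < \<bar>S j \<omega>\<bar>" "\<bar>\<Sum>i\<in>{j..<N}. G i \<omega>\<bar> \<le> a"
      by (auto simp: A_def C_def)
    have "S N \<omega> = S j \<omega> + (\<Sum>i\<in>{j..<N}. G i \<omega>)"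
      unfolding S_def using j(1) sum.atLeastLessThan_concat[of 0 j N "\<lambda>i. G i \<omega>"] by (simp add: atLeast0LessThan)
    then show "\<omega> \<in> {\<omega> \<in> space M. a < \<bar>S N \<omega>\<bar>}" using j by auto
  qed auto
  finally show ?thesis by (simp add: S_def)
qed

text \<open>Chebyshev's inequality for the kind of second moment bound that
  \<open>block_approximation\<close> delivers.\<close>

lemma second_moment_tail:
  assumes [measurable]: "Z \<in> borel_measurable M" and "0 < b" "0 \<le> \<eta>"
    and m: "(\<integral>\<^sup>+\<omega>. ennreal ((Z \<omega>)\<^sup>2) \<partial>M) \<le> ennreal \<eta>"
  shows "prob {\<omega> \<in> space M. b < \<bar>Z \<omega>\<bar>} \<le> \<eta> / b\<^sup>2"
proof -
  have "ennreal (b\<^sup>2) * emeasure M {\<omega> \<in> space M. b < \<bar>Z \<omega>\<bar>}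
      = (\<integral>\<^sup>+\<omega>. ennreal (b\<^sup>2) * indicator {\<omega> \<in> space M. b < \<bar>Z \<omega>\<bar>} \<omega> \<partial>M)"
    by (subst nn_integral_cmult_indicator) auto
  also have "\<dots> \<le> (\<integral>\<^sup>+\<omega>. ennreal ((Z \<omega>)\<^sup>2) \<partial>M)"
  proof (rule nn_integral_mono)
    fix \<omega>
    show "ennreal (b\<^sup>2) * indicator {\<omega> \<in> space M. b < \<bar>Z \<omega>\<bar>} \<omega> \<le> ennreal ((Z \<omega>)\<^sup>2)"
    proof (cases "b < \<bar>Z \<omega>\<bar>")
      case True
      then have "b\<^sup>2 \<le> \<bar>Z \<omega>\<bar>\<^sup>2" using \<open>0 < b\<close> by (intro power_mono) auto
      then show ?thesis by (auto simp: indicator_def intro!: ennreal_leI)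
    qed auto
  qed
  also note m
  finally have "ennreal (b\<^sup>2 * prob {\<omega> \<in> space M. b < \<bar>Z \<omega>\<bar>}) \<le> ennreal \<eta>"
    by (simp add: emeasure_eq_measure ennreal_mult)
  then show ?thesis using \<open>0 < b\<close> \<open>0 \<le> \<eta>\<close> by (simp add: field_simps)
qed

end

section \<open>Upper half of the iterated logarithm\<close>

context ito_process begin

text \<open>Ottaviani's inequality for the normal sums accounts for 2 a, and the approximation
  errors get a further a. The block variances add up to at most 2 V (t 0), whence the exponent; a^2
  \<ge> 8 V (t 0) pushes each tail below 1/2. The bound depends neither on N nor on the mesh, so the
  grid can be refined.\<close>

lemma grid_maximal_inequality:
  fixes t :: "nat \<Rightarrow> real"
  assumes t: "strict_mono t" "0 \<le> t 0" and "0 < a" "8 * V (t 0) \<le> a\<^sup>2"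
  shows "prob {\<omega> \<in> space M. \<exists>j\<le>N. 3 * a < \<bar>J (t j) \<omega> - J (t 0) \<omega>\<bar>} \<le> 4 * exp (- a\<^sup>2 / (4 * V (t 0)))"
proof (rule field_le_epsilon)
  fix \<kappa> :: real assume "0 < \<kappa>"
  define W where "W = V (t 0)"
  have W: "0 < W" using V_pos t by (simp add: W_def)
  have t_ge: "0 \<le> t j" for j using t strict_mono_less_eq[OF t(1), of 0 j] by simp
  note [measurable] = J_measurable[OF t_ge]
  \<comment> \<open>The first bound keeps the total variance error below W. The second makes the N
    Chebyshev terms \<eta> (N + 1)^2 / a^2 sum to at most \<kappa>.\<close>
  define \<eta> where "\<eta> = min (W / (real N + 1)) (\<kappa> * a\<^sup>2 / (real N + 1)^3)"
  have \<eta>: "0 < \<eta>" "(real N + 1) * \<eta> \<le> W" "(real N + 1)^3 * \<eta> \<le> \<kappa> * a\<^sup>2"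
  proof -
    show "0 < \<eta>" using W \<open>0 < \<kappa>\<close> \<open>0 < a\<close> by (auto simp: \<eta>_def)
    have "\<eta> \<le> W / (real N + 1)" by (simp add: \<eta>_def)
    then show "(real N + 1) * \<eta> \<le> W" by (simp add: field_simps)
    have "\<eta> \<le> \<kappa> * a\<^sup>2 / (real N + 1)^3" by (simp add: \<eta>_def)
    then show "(real N + 1)^3 * \<eta> \<le> \<kappa> * a\<^sup>2" by (subst (asm) pos_le_divide_eq) (auto simp: mult.commute)
  qed
  obtain G where G: "indep_vars (\<lambda>_. borel) G {..<N}"
    "\<And>j. j < N \<Longrightarrow> \<exists>w>0. distributed M lborel (G j) (normal_density 0 w) \<and> \<bar>w\<^sup>2 - (V (t j) - V (t (Suc j)))\<bar> \<le> \<eta>"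
    "\<And>j. j < N \<Longrightarrow> (\<integral>\<^sup>+\<omega>. ennreal ((J (t (Suc j)) \<omega> - J (t j) \<omega> - G j \<omega>)\<^sup>2) \<partial>M) \<le> ennreal \<eta>"
    using block_approximation[OF t \<eta>(1), of N] by blast
  have Gm [measurable]: "G i \<in> borel_measurable M" if "i < N" for i
    using G(1) that by (auto simp: indep_vars_def)
  obtain w where w: "\<And>j. j < N \<Longrightarrow> 0 < w j" "\<And>j. j < N \<Longrightarrow> distributed M lborel (G j) (normal_density 0 (w j))"
    "\<And>j. j < N \<Longrightarrow> \<bar>(w j)\<^sup>2 - (V (t j) - V (t (Suc j)))\<bar> \<le> \<eta>"
    using G(2) by metis
  let ?e = "exp (- a\<^sup>2 / (4 * W))"
  have tail: "prob {\<omega> \<in> space M. a \<le> \<bar>\<Sum>i\<in>{j..<N}. G i \<omega>\<bar>} \<le> 2 * ?e" if "j \<le> N" for j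
  proof (cases "j = N")
    case True
    then show ?thesis using \<open>0 < a\<close> by simp
  next
    case False
    then have "j < N" using that by simp
    let ?s = "sqrt (\<Sum>i\<in>{j..<N}. (w i)\<^sup>2)"
    have D: "distributed M lborel (\<lambda>\<omega>. \<Sum>i\<in>{j..<N}. G i \<omega>) (normal_density (\<Sum>i\<in>{j..<N}. 0) ?s)"
      using \<open>j < N\<close> w by (intro sum_indep_normal indep_vars_subset[OF G(1)]) auto
    have pos: "0 < (\<Sum>i\<in>{j..<N}. (w i)\<^sup>2)"
    proof (intro sum_pos)
      show "0 < (w i)\<^sup>2" if "i \<in> {j..<N}" for i using w(1)[of i] that by (intro zero_less_power) auto
    qed (use \<open>j < N\<close> in auto)
    have "(\<Sum>i\<in>{j..<N}. (w i)\<^sup>2) \<le> (\<Sum>i\<in>{j..<N}. (V (t i) - V (t (Suc i))) + \<eta>)"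
      using w(3) by (intro sum_mono) (force simp: abs_le_iff)
    also have "\<dots> = V (t j) - V (t N) + real (N - j) * \<eta>"
      using \<open>j < N\<close> sum_Suc_diff'[of j N "\<lambda>i. - V (t i)"] by (simp add: sum.distrib)
    also have "\<dots> \<le> W + (real N + 1) * \<eta>"
      using V_antimono[of "t 0" "t j"] V_pos[of "t N"] t_ge t(1) \<eta>(1)
      by (intro add_mono mult_right_mono) (auto simp: W_def strict_mono_less_eq less_imp_le)
    finally have le: "(\<Sum>i\<in>{j..<N}. (w i)\<^sup>2) \<le> 2 * W" using \<eta>(2) by simp
    have "prob {\<omega> \<in> space M. a \<le> \<bar>\<Sum>i\<in>{j..<N}. G i \<omega>\<bar>} \<le> 2 * exp (- a\<^sup>2 / (2 * ?s\<^sup>2))"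
      using D pos \<open>0 < a\<close> by (intro normal_tail_upper) auto
    also have "\<dots> \<le> 2 * ?e"
    proof -
      have "a\<^sup>2 / (4 * W) \<le> a\<^sup>2 / (2 * ?s\<^sup>2)"
        using pos le W by (intro divide_left_mono) auto
      then show ?thesis by simp
    qed
    finally show ?thesis .
  qed
  have sub: "prob {\<omega> \<in> space M. a < \<bar>\<Sum>i\<in>{j..<N}. G i \<omega>\<bar>} \<le> 2 * ?e" if "j \<le> N" for j
  proof -
    have [measurable]: "(\<lambda>\<omega>. \<Sum>i\<in>{j..<N}. G i \<omega>) \<in> borel_measurable M" by (intro borel_measurable_sum Gm) auto
    have "prob {\<omega> \<in> space M. a < \<bar>\<Sum>i\<in>{j..<N}. G i \<omega>\<bar>} \<le> prob {\<omega> \<in> space M. a \<le> \<bar>\<Sum>i\<in>{j..<N}. G i \<omega>\<bar>}"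
      by (intro finite_measure_mono) auto
    then show ?thesis using tail[OF that] by simp
  qed
  \<comment> \<open>Here a^2 / (4 W) \<ge> 2, and the quadratic Taylor polynomial already shows that
    its exponential is at least 4.\<close>
  have half: "2 * ?e \<le> 1 / 2"
  proof -
    have "2 \<le> a\<^sup>2 / (4 * W)" using assms(4) W by (simp add: W_def field_simps)
    then have "4 \<le> 1 + a\<^sup>2 / (4 * W) + (a\<^sup>2 / (4 * W))\<^sup>2 / 2"
      using power_mono[of 2 "a\<^sup>2 / (4 * W)" 2] by simp
    also have "\<dots> \<le> exp (a\<^sup>2 / (4 * W))" using W by (intro exp_lower_Taylor_quadratic) auto
    finally show ?thesis by (simp add: exp_minus field_simps)
  qed
  let ?D = "\<lambda>i \<omega>. J (t (Suc i)) \<omega> - J (t i) \<omega> - G i \<omega>"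
  \<comment> \<open>At most N errors of this size add up to at most a.\<close>
  let ?b = "a / (real N + 1)"
  have E1: "{\<omega> \<in> space M. \<exists>j\<le>N. 2 * a < \<bar>\<Sum>i<j. G i \<omega>\<bar>} \<in> events"
  proof -
    have [measurable]: "(\<lambda>\<omega>. \<Sum>i<j. G i \<omega>) \<in> borel_measurable M" if "j \<in> {..N}" for j
      using that by (intro borel_measurable_sum Gm) auto
    have "{\<omega> \<in> space M. \<exists>j\<in>{..N}. 2 * a < \<bar>\<Sum>i<j. G i \<omega>\<bar>} \<in> events" by measurable
    then show ?thesis by (simp add: Bex_def)
  qed
  have E2: "{\<omega> \<in> space M. ?b < \<bar>?D i \<omega>\<bar>} \<in> events" if "i < N" for i
    using Gm[OF that] by measurable
  have "prob {\<omega> \<in> space M. \<exists>j\<le>N. 3 * a < \<bar>J (t j) \<omega> - J (t 0) \<omega>\<bar>}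
      \<le> prob ({\<omega> \<in> space M. \<exists>j\<le>N. 2 * a < \<bar>\<Sum>i<j. G i \<omega>\<bar>} \<union> (\<Union>i<N. {\<omega> \<in> space M. ?b < \<bar>?D i \<omega>\<bar>}))"
  proof (rule finite_measure_mono)
    show "{\<omega> \<in> space M. \<exists>j\<le>N. 3 * a < \<bar>J (t j) \<omega> - J (t 0) \<omega>\<bar>}
      \<subseteq> {\<omega> \<in> space M. \<exists>j\<le>N. 2 * a < \<bar>\<Sum>i<j. G i \<omega>\<bar>} \<union> (\<Union>i<N. {\<omega> \<in> space M. ?b < \<bar>?D i \<omega>\<bar>})"
    proof (rule subsetI, rule ccontr)
      fix \<omega> assume "\<omega> \<in> {\<omega> \<in> space M. \<exists>j\<le>N. 3 * a < \<bar>J (t j) \<omega> - J (t 0) \<omega>\<bar>}"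
        and n: "\<omega> \<notin> {\<omega> \<in> space M. \<exists>j\<le>N. 2 * a < \<bar>\<Sum>i<j. G i \<omega>\<bar>} \<union> (\<Union>i<N. {\<omega> \<in> space M. ?b < \<bar>?D i \<omega>\<bar>})"
      then obtain j where j: "\<omega> \<in> space M" "j \<le> N" "3 * a < \<bar>J (t j) \<omega> - J (t 0) \<omega>\<bar>" by auto
      have "J (t j) \<omega> - J (t 0) \<omega> = (\<Sum>i<j. J (t (Suc i)) \<omega> - J (t i) \<omega>)"
        by (rule sum_lessThan_telescope[symmetric])
      also have "\<dots> = (\<Sum>i<j. G i \<omega>) + (\<Sum>i<j. ?D i \<omega>)" by (simp add: sum.distrib[symmetric])
      finally have eq: "J (t j) \<omega> - J (t 0) \<omega> = (\<Sum>i<j. G i \<omega>) + (\<Sum>i<j. ?D i \<omega>)" .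
      have "\<bar>\<Sum>i<j. ?D i \<omega>\<bar> \<le> (\<Sum>i<j. ?b)"
        using n j by (intro order_trans[OF sum_abs] sum_mono) (auto simp: not_less)
      also have "\<dots> = real j * ?b" by simp
      also have "\<dots> \<le> (real N + 1) * ?b" using j \<open>0 < a\<close> by (intro mult_right_mono) auto
      also have "\<dots> = a" by simp
      finally have "\<bar>\<Sum>i<j. ?D i \<omega>\<bar> \<le> a" .
      moreover have "\<bar>\<Sum>i<j. G i \<omega>\<bar> \<le> 2 * a" using n j by (auto simp: not_less)
      ultimately show False using j(3) eq by linarith
    qed
    show "{\<omega> \<in> space M. \<exists>j\<le>N. 2 * a < \<bar>\<Sum>i<j. G i \<omega>\<bar>} \<union> (\<Union>i<N. {\<omega> \<in> space M. ?b < \<bar>?D i \<omega>\<bar>}) \<in> events"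
      using E1 E2 by (intro sets.Un sets.finite_UN) auto
  qed
  also have "\<dots> \<le> prob {\<omega> \<in> space M. \<exists>j\<le>N. 2 * a < \<bar>\<Sum>i<j. G i \<omega>\<bar>} + (\<Sum>i<N. prob {\<omega> \<in> space M. ?b < \<bar>?D i \<omega>\<bar>})"
    using E1 E2 by (intro order_trans[OF measure_Un_le] add_mono finite_measure_subadditive_finite sets.finite_UN) auto
  also have "\<dots> \<le> 2 * (2 * ?e) + (\<Sum>i<N. \<eta> / ?b\<^sup>2)"
  proof (intro add_mono sum_mono)
    show "prob {\<omega> \<in> space M. \<exists>j\<le>N. 2 * a < \<bar>\<Sum>i<j. G i \<omega>\<bar>} \<le> 2 * (2 * ?e)"
      using maximal_inequality[OF G(1), of a] \<open>0 < a\<close> sub half order_trans[OF sub half] sub[of 0]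
      by (fastforce simp: atLeast0LessThan)
    fix i assume "i \<in> {..<N}"
    then show "prob {\<omega> \<in> space M. ?b < \<bar>?D i \<omega>\<bar>} \<le> \<eta> / ?b\<^sup>2"
      using G(3)[of i] \<eta>(1) \<open>0 < a\<close> by (intro second_moment_tail) auto
  qed
  also have "(\<Sum>i<N. \<eta> / ?b\<^sup>2) \<le> \<kappa>"
  proof -
    have "(\<Sum>i<N. \<eta> / ?b\<^sup>2) = real N * (real N + 1)\<^sup>2 * \<eta> / a\<^sup>2" by (simp add: power_divide)
    also have "\<dots> \<le> (real N + 1)^3 * \<eta> / a\<^sup>2"
    proof (rule divide_right_mono)
      have "real N * (real N + 1)\<^sup>2 \<le> (real N + 1) * (real N + 1)\<^sup>2" by (intro mult_right_mono) auto
      also have "\<dots> = (real N + 1)^3" by (simp add: power3_eq_cube power2_eq_square)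
      finally show "real N * (real N + 1)\<^sup>2 * \<eta> \<le> (real N + 1)^3 * \<eta>"
        using \<eta>(1) by (intro mult_right_mono) auto
    qed simp
    also have "\<dots> \<le> \<kappa>" using \<eta>(3) \<open>0 < a\<close> by (simp add: divide_le_eq)
    finally show ?thesis .
  qed
  finally show "prob {\<omega> \<in> space M. \<exists>j\<le>N. 3 * a < \<bar>J (t j) \<omega> - J (t 0) \<omega>\<bar>} \<le> 4 * exp (- a\<^sup>2 / (4 * V (t 0))) + \<kappa>"
    by (simp add: W_def)
qed


text \<open>The points s + j / 2^p with j \<le> 4^p have mesh 2^(-p) and reach s + 2^p, so as p
  grows they become dense and cover every bounded range; continuity does the rest.\<close>

lemma dense_grid:
  fixes h :: "real \<Rightarrow> real"
  assumes "continuous_on {0..} h" "0 \<le> s"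
    and grid: "\<And>p j. j \<le> 4 ^ p \<Longrightarrow> \<bar>h (s + real j / 2 ^ p) - h s\<bar> \<le> b" and "s \<le> t"
  shows "\<bar>h t - h s\<bar> \<le> b"
proof -
  define u where "u p = s + real (nat \<lfloor>(t - s) * 2 ^ p\<rfloor>) / 2 ^ p" for p :: nat
  have fl: "real (nat \<lfloor>(t - s) * 2 ^ p\<rfloor>) \<le> (t - s) * 2 ^ p" "(t - s) * 2 ^ p - 1 \<le> real (nat \<lfloor>(t - s) * 2 ^ p\<rfloor>)" for p :: nat
  proof -
    have "0 \<le> (t - s) * 2 ^ p" using \<open>s \<le> t\<close> by simp
    then show "real (nat \<lfloor>(t - s) * 2 ^ p\<rfloor>) \<le> (t - s) * 2 ^ p" "(t - s) * 2 ^ p - 1 \<le> real (nat \<lfloor>(t - s) * 2 ^ p\<rfloor>)"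
      by linarith+
  qed
  have u: "t - (1 / 2) ^ p \<le> u p" "u p \<le> t" for p
    using divide_right_mono[OF fl(1)[of p], of "2 ^ p"] divide_right_mono[OF fl(2)[of p], of "2 ^ p"]
    by (simp_all add: u_def diff_divide_distrib power_one_over)
  have "u \<longlonglongrightarrow> t"
  proof (rule tendsto_sandwich[OF _ _ _ tendsto_const])
    have "(\<lambda>p. t - (1 / 2 :: real) ^ p) \<longlonglongrightarrow> t - 0" by (intro tendsto_intros LIMSEQ_power_zero) simp
    then show "(\<lambda>p. t - (1 / 2 :: real) ^ p) \<longlonglongrightarrow> t" by simp
  qed (use u in auto)
  moreover have su: "s \<le> u p" for p by (simp add: u_def)
  have "u p \<in> {0..}" for p using \<open>0 \<le> s\<close> su[of p] by simp
  ultimately have "(\<lambda>p. h (u p)) \<longlonglongrightarrow> h t"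
    using assms(2,4) by (intro continuous_on_tendsto_compose[OF assms(1)]) auto
  then have lim: "(\<lambda>p. \<bar>h (u p) - h s\<bar>) \<longlonglongrightarrow> \<bar>h t - h s\<bar>" by (intro tendsto_intros)
  obtain q :: nat where q: "t - s \<le> 2 ^ q" using real_arch_pow[of 2 "t - s"] by (auto intro: less_imp_le)
  have "\<bar>h (u p) - h s\<bar> \<le> b" if "q \<le> p" for p
  proof -
    have "(2::real) ^ q \<le> 2 ^ p" using that by (intro power_increasing) auto
    then have "t - s \<le> 2 ^ p" using q by linarith
    then have "(t - s) * 2 ^ p \<le> 2 ^ p * 2 ^ p" by (intro mult_right_mono) auto
    also have "\<dots> = real (4 ^ p)" by (simp add: power_mult_distrib[symmetric])
    finally have "nat \<lfloor>(t - s) * 2 ^ p\<rfloor> \<le> 4 ^ p" using fl(1)[of p] by linarith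
    from grid[OF this] show ?thesis by (simp add: u_def)
  qed
  then show ?thesis by (intro LIMSEQ_le_const2[OF lim]) auto
qed

text \<open>The grids are nested, as j / 2^p = 2 j / 2^(p + 1), so the events increase with p and
  the uniform bound passes to their union.\<close>

lemma maximal_inequality_tail:
  assumes "0 \<le> s" "0 < a" "8 * V s \<le> a\<^sup>2"
  defines "E \<equiv> {\<omega> \<in> space M. \<exists>p. \<exists>j\<le>4 ^ p. 3 * a < \<bar>J (s + real j / 2 ^ p) \<omega> - J s \<omega>\<bar>}"
  shows "E \<in> events" "prob E \<le> 4 * exp (- a\<^sup>2 / (4 * V s))"
proof -
  define A where "A p = {\<omega> \<in> space M. \<exists>j\<le>4 ^ p. 3 * a < \<bar>J (s + real j / 2 ^ p) \<omega> - J s \<omega>\<bar>}" for p :: nat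
  have [measurable]: "J (s + real j / 2 ^ p) \<in> borel_measurable M" "J s \<in> borel_measurable M" for j p
    using \<open>0 \<le> s\<close> by auto
  have A: "A p \<in> events" for p
  proof -
    have "{\<omega> \<in> space M. \<exists>j\<in>{..4 ^ p}. 3 * a < \<bar>J (s + real j / 2 ^ p) \<omega> - J s \<omega>\<bar>} \<in> events" by measurable
    then show ?thesis by (simp add: A_def Bex_def)
  qed
  have "A p \<subseteq> A (Suc p)" for p
  proof
    fix \<omega> assume "\<omega> \<in> A p"
    then obtain j where j: "\<omega> \<in> space M" "j \<le> 4 ^ p" "3 * a < \<bar>J (s + real j / 2 ^ p) \<omega> - J s \<omega>\<bar>"
      by (auto simp: A_def)
    have "real (2 * j) / 2 ^ Suc p = real j / 2 ^ p" by simp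
    then show "\<omega> \<in> A (Suc p)" using j unfolding A_def
      by (intro CollectI conjI exI[of _ "2 * j"]) (simp_all only:, auto)
  qed
  then have "incseq A" by (rule incseq_SucI)
  have E: "E = (\<Union>p. A p)" by (auto simp: E_def A_def)
  show "E \<in> events" unfolding E using A by auto
  have "prob (A p) \<le> 4 * exp (- a\<^sup>2 / (4 * V s))" for p
  proof -
    have "strict_mono (\<lambda>j. s + real j / 2 ^ p)" by (auto simp: strict_mono_def divide_strict_right_mono)
    from grid_maximal_inequality[OF this, of a "4 ^ p"] show ?thesis using assms by (simp add: A_def)
  qed
  then show "prob E \<le> 4 * exp (- a\<^sup>2 / (4 * V s))"
    unfolding E by (intro LIMSEQ_le_const2[OF finite_Lim_measure_incseq[OF _ \<open>incseq A\<close>]]) (use A in auto)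
qed

text \<open>With a^2 = 8 V ln (n + 3) the exponent a^2 / (4 V) is 2 ln (n + 3), so the failure
  probabilities are at most 4 / (n + 3)^2 and Borel-Cantelli applies. The shift by 3 makes the
  logarithm at least 1, hence a^2 \<ge> 8 V.\<close>

lemma iterated_logarithm_upper:
  fixes s :: "nat \<Rightarrow> real"
  assumes s: "\<And>n. 0 \<le> s n"
  shows "AE \<omega> in M. \<forall>\<^sub>F n in sequentially. \<forall>t\<ge>s n. \<bar>J t \<omega> - J (s n) \<omega>\<bar> \<le> 3 * sqrt (8 * V (s n) * ln (real n + 3))"
proof -
  define a where "a n = sqrt (8 * V (s n) * ln (real n + 3))" for n
  have ln1: "1 \<le> ln (real n + 3)" for n
  proof -
    have "exp 1 \<le> real n + 3" using exp_le by (rule order_trans) simp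
    then show ?thesis by (simp add: ln_ge_iff)
  qed
  have Vs: "0 < V (s n)" for n by (rule V_pos[OF s])
  have sq: "(a n)\<^sup>2 = 8 * V (s n) * ln (real n + 3)" for n
    using Vs[of n] ln1[of n] by (simp add: a_def)
  have a: "0 < a n" "8 * V (s n) \<le> (a n)\<^sup>2" for n
    unfolding sq using Vs[of n] ln1[of n] by (simp_all add: a_def)
  define E where "E n = {\<omega> \<in> space M. \<exists>p. \<exists>j\<le>4 ^ p. 3 * a n < \<bar>J (s n + real j / 2 ^ p) \<omega> - J (s n) \<omega>\<bar>}" for n
  note E = maximal_inequality_tail[OF s a, folded E_def]
  have bound: "prob (E n) \<le> 4 * inverse ((real (n + 3))\<^sup>2)" for n
  proof -
    have "- (a n)\<^sup>2 / (4 * V (s n)) = - 2 * ln (real n + 3)" unfolding sq using Vs[of n] by (simp add: field_simps)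
    also have "exp \<dots> = inverse ((real n + 3)\<^sup>2)"
      by (simp add: exp_minus exp_double)
    finally show ?thesis using E(2)[of n] by simp
  qed
  have "summable (\<lambda>n. inverse ((real (n + 3))\<^sup>2))"
    using inverse_power_summable[of 2, where 'a = real] summable_ignore_initial_segment[of "\<lambda>n. inverse ((real n)\<^sup>2)" 3] by simp
  then have "summable (\<lambda>n. 4 * inverse ((real (n + 3))\<^sup>2))" by (rule summable_mult)
  then have "summable (\<lambda>n. prob (E n))"
    by (rule summable_comparison_test'[of _ 0]) (use bound in auto)
  then have "AE \<omega> in M. \<forall>\<^sub>F n in sequentially. \<omega> \<in> space M - E n"
    by (intro borel_cantelli_AE1 E(1)) (auto simp: less_top[symmetric])
  with J_cont show ?thesis
  proof eventually_elim
    case (elim \<omega>)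
    from elim(2) show ?case
    proof eventually_elim
      case (elim n)
      then have "\<And>p j. j \<le> 4 ^ p \<Longrightarrow> \<bar>J (s n + real j / 2 ^ p) \<omega> - J (s n) \<omega>\<bar> \<le> 3 * a n"
        by (auto simp: E_def not_less)
      from dense_grid[OF \<open>continuous_on {0..} (\<lambda>t. J t \<omega>)\<close> s this] show ?case by (simp add: a_def)
    qed
  qed
qed

section \<open>Lower half of the iterated logarithm\<close>

text \<open>Unless some approximation error exceeds \<delta>, all block sums stay below 3/4 r n. For
  one block this fails with probability at least a multiple of 1 / (n + 1). Independence multiplies
  the complementary probabilities, and 1 - x \<le> exp (- x) turns the product into the exponential
  of a harmonic sum.\<close>

lemma block_increments_all_small:
  fixes t :: "nat \<Rightarrow> real"
  assumes t: "strict_mono t" "0 \<le> t 0" and v: "\<And>n. V (t (Suc n)) < V (t n)" and "1 \<le> K"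
  defines "r \<equiv> \<lambda>n. sqrt ((V (t n) - V (t (Suc n))) * ln (real n + 1))"
  shows "prob {\<omega> \<in> space M. \<forall>n\<in>{K..<N}. \<bar>J (t (Suc n)) \<omega> - J (t n) \<omega>\<bar> < r n / 2}
    \<le> exp (- (exp (-1) / sqrt (2 * pi)) * (\<Sum>n=K..<N. 1 / (real n + 1)))"
proof (cases "K < N")
  case False
  then show ?thesis by simp
next
  case True
  show ?thesis
  proof (rule field_le_epsilon)
    fix \<kappa> :: real assume "0 < \<kappa>"
    have t_ge: "0 \<le> t j" for j using t strict_mono_less_eq[OF t(1), of 0 j] by simp
    note [measurable] = J_measurable[OF t_ge]
    let ?v = "\<lambda>n. V (t n) - V (t (Suc n))"
    let ?l = "\<lambda>n. ln (real n + 1)"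
    have vp: "0 < ?v n" for n using v[of n] by simp
    have lp: "0 < ?l n" if "K \<le> n" for n using that \<open>1 \<le> K\<close> by simp
    have rp: "0 < r n" if "K \<le> n" for n using vp[of n] lp[OF that] by (simp add: r_def)
    \<comment> \<open>A quarter of the smallest threshold, so that r n / 2 + \<delta> \<le> 3/4 r n
      throughout.\<close>
    define \<delta> where "\<delta> = Min (r ` {K..<N}) / 4"
    have \<delta>: "0 < \<delta>" "\<And>n. n \<in> {K..<N} \<Longrightarrow> \<delta> \<le> r n / 4"
      unfolding \<delta>_def using True rp by (auto simp: Min_gr_iff)
    define u where "u = Min (?v ` {K..<N})"
    have u: "0 < u" "\<And>n. n \<in> {K..<N} \<Longrightarrow> u \<le> ?v n"
      unfolding u_def using True vp by (auto simp: Min_gr_iff)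
    \<comment> \<open>As 7/16 = 1 - 9/16, the variance of block n is at least 9/16 of its target, so
      3/4 r n \<le> sqrt (ln (n + 1)) w n. The other bound keeps the error probability at most
      \<kappa>.\<close>
    define \<eta> where "\<eta> = min (7 / 16 * u) (\<kappa> * \<delta>\<^sup>2 / N)"
    have \<eta>: "0 < \<eta>" "\<eta> \<le> 7 / 16 * u" "N * \<eta> \<le> \<kappa> * \<delta>\<^sup>2"
    proof -
      show "0 < \<eta>" using u \<delta> \<open>0 < \<kappa>\<close> True by (auto simp: \<eta>_def)
      show "\<eta> \<le> 7 / 16 * u" unfolding \<eta>_def by (rule min.cobounded1)
      have "\<eta> \<le> \<kappa> * \<delta>\<^sup>2 / N" by (simp add: \<eta>_def)
      then show "N * \<eta> \<le> \<kappa> * \<delta>\<^sup>2" using True by (subst (asm) pos_le_divide_eq) (auto simp: mult.commute)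
    qed
    obtain G where G: "indep_vars (\<lambda>_. borel) G {..<N}"
      "\<And>j. j < N \<Longrightarrow> \<exists>w>0. distributed M lborel (G j) (normal_density 0 w) \<and> \<bar>w\<^sup>2 - (V (t j) - V (t (Suc j)))\<bar> \<le> \<eta>"
      "\<And>j. j < N \<Longrightarrow> (\<integral>\<^sup>+\<omega>. ennreal ((J (t (Suc j)) \<omega> - J (t j) \<omega> - G j \<omega>)\<^sup>2) \<partial>M) \<le> ennreal \<eta>"
      using block_approximation[OF t \<eta>(1), of N] by blast
    have Gm [measurable]: "G i \<in> borel_measurable M" if "i < N" for i
      using G(1) that by (auto simp: indep_vars_def)
    obtain w where w: "\<And>j. j < N \<Longrightarrow> 0 < w j" "\<And>j. j < N \<Longrightarrow> distributed M lborel (G j) (normal_density 0 (w j))"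
      "\<And>j. j < N \<Longrightarrow> \<bar>(w j)\<^sup>2 - (V (t j) - V (t (Suc j)))\<bar> \<le> \<eta>"
      using G(2) by metis
    let ?D = "\<lambda>i \<omega>. J (t (Suc i)) \<omega> - J (t i) \<omega> - G i \<omega>"
    let ?S = "\<lambda>n. G n -` {x. \<bar>x\<bar> < 3 / 4 * r n} \<inter> space M"
    have open_S: "{x. \<bar>x\<bar> < c} \<in> sets borel" for c :: real by measurable
    have E1: "(\<Inter>n\<in>{K..<N}. ?S n) \<in> events"
      using True open_S by (intro sets.finite_INT measurable_sets[OF Gm]) auto
    have E2: "{\<omega> \<in> space M. \<delta> < \<bar>?D i \<omega>\<bar>} \<in> events" if "i < N" for i
      using Gm[OF that] by measurable
    have "prob {\<omega> \<in> space M. \<forall>n\<in>{K..<N}. \<bar>J (t (Suc n)) \<omega> - J (t n) \<omega>\<bar> < r n / 2}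
        \<le> prob ((\<Inter>n\<in>{K..<N}. ?S n) \<union> (\<Union>i<N. {\<omega> \<in> space M. \<delta> < \<bar>?D i \<omega>\<bar>}))"
    proof (rule finite_measure_mono)
      show "{\<omega> \<in> space M. \<forall>n\<in>{K..<N}. \<bar>J (t (Suc n)) \<omega> - J (t n) \<omega>\<bar> < r n / 2}
        \<subseteq> (\<Inter>n\<in>{K..<N}. ?S n) \<union> (\<Union>i<N. {\<omega> \<in> space M. \<delta> < \<bar>?D i \<omega>\<bar>})"
      proof
        fix \<omega> assume \<omega>: "\<omega> \<in> {\<omega> \<in> space M. \<forall>n\<in>{K..<N}. \<bar>J (t (Suc n)) \<omega> - J (t n) \<omega>\<bar> < r n / 2}"
        show "\<omega> \<in> (\<Inter>n\<in>{K..<N}. ?S n) \<union> (\<Union>i<N. {\<omega> \<in> space M. \<delta> < \<bar>?D i \<omega>\<bar>})"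
        proof (cases "\<exists>i<N. \<delta> < \<bar>?D i \<omega>\<bar>")
          case True
          then show ?thesis using \<omega> by blast
        next
          case False
          have "\<bar>G n \<omega>\<bar> < 3 / 4 * r n" if "n \<in> {K..<N}" for n
          proof -
            have "\<bar>J (t (Suc n)) \<omega> - J (t n) \<omega>\<bar> < r n / 2" using \<omega> that by blast
            moreover have "n < N" using that by simp
            then have "\<bar>?D n \<omega>\<bar> \<le> \<delta>" using False not_less by blast
            moreover note \<delta>(2)[OF that]
            ultimately show ?thesis by linarith
          qed
          then show ?thesis using \<omega> by blast
        qed
      qed
      show "(\<Inter>n\<in>{K..<N}. ?S n) \<union> (\<Union>i<N. {\<omega> \<in> space M. \<delta> < \<bar>?D i \<omega>\<bar>}) \<in> events"
        using E1 E2 by (intro sets.Un sets.finite_UN) auto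
    qed
    also have "\<dots> \<le> prob (\<Inter>n\<in>{K..<N}. ?S n) + (\<Sum>i<N. prob {\<omega> \<in> space M. \<delta> < \<bar>?D i \<omega>\<bar>})"
      using E1 E2 by (intro order_trans[OF measure_Un_le] add_mono finite_measure_subadditive_finite sets.finite_UN) auto
    also have "(\<Sum>i<N. prob {\<omega> \<in> space M. \<delta> < \<bar>?D i \<omega>\<bar>}) \<le> (\<Sum>i<N. \<eta> / \<delta>\<^sup>2)"
      using G(3) \<eta>(1) \<delta>(1) by (intro sum_mono second_moment_tail) auto
    also have "\<dots> \<le> \<kappa>" using \<eta>(3) \<delta>(1) by (simp add: divide_le_eq)
    also have "prob (\<Inter>n\<in>{K..<N}. ?S n) = (\<Prod>n\<in>{K..<N}. prob (?S n))"
      using True open_S by (intro indep_varsD[OF G(1)]) auto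
    also have "\<dots> \<le> (\<Prod>n\<in>{K..<N}. exp (- (exp (-1) / sqrt (2 * pi)) * (1 / (real n + 1))))"
    proof (intro prod_mono conjI)
      fix n assume n: "n \<in> {K..<N}"
      then have "n < N" "K \<le> n" by auto
      note [measurable] = Gm[OF \<open>n < N\<close>]
      let ?k = "exp (-1) / sqrt (2 * pi) * (1 / (real n + 1))"
      have wn: "0 < w n" by (rule w(1)[OF \<open>n < N\<close>])
      have "3 / 4 * r n \<le> sqrt (?l n) * w n"
      proof (rule power2_le_imp_le)
        have "(3 / 4 * r n)\<^sup>2 = 9 / 16 * ?v n * ?l n"
          using vp[of n] lp[OF \<open>K \<le> n\<close>] by (simp add: r_def power_mult_distrib power_divide)
        also have "\<dots> \<le> (w n)\<^sup>2 * ?l n"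
        proof (rule mult_right_mono)
          have "\<eta> \<le> 7 / 16 * ?v n" using \<eta>(2) mult_left_mono[OF u(2)[OF n], of "7 / 16"] by auto
          then show "9 / 16 * ?v n \<le> (w n)\<^sup>2" using w(3)[OF \<open>n < N\<close>] by (simp add: abs_le_iff field_simps)
        qed (use lp[OF \<open>K \<le> n\<close>] in simp)
        also have "\<dots> = (sqrt (?l n) * w n)\<^sup>2" using lp[OF \<open>K \<le> n\<close>] by (simp add: power_mult_distrib)
        finally show "(3 / 4 * r n)\<^sup>2 \<le> (sqrt (?l n) * w n)\<^sup>2" .
      qed (use lp[OF \<open>K \<le> n\<close>] wn in simp)
      then have "prob {\<omega> \<in> space M. sqrt (?l n) * w n \<le> \<bar>G n \<omega>\<bar>} \<le> prob (space M - ?S n)"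
        by (intro finite_measure_mono) (auto simp: open_S)
      also have "\<dots> = 1 - prob (?S n)" using open_S by (intro prob_compl measurable_sets[OF Gm[OF \<open>n < N\<close>]])
      finally have "prob (?S n) \<le> 1 - prob {\<omega> \<in> space M. sqrt (?l n) * w n \<le> \<bar>G n \<omega>\<bar>}" by simp
      moreover have "exp (- (sqrt (?l n) + 1)\<^sup>2 / 2) / sqrt (2 * pi) \<le> prob {\<omega> \<in> space M. sqrt (?l n) * w n \<le> \<bar>G n \<omega>\<bar>}"
        using lp[OF \<open>K \<le> n\<close>] by (intro normal_tail_lower w(2) wn \<open>n < N\<close>) auto
      moreover have "?k \<le> exp (- (sqrt (?l n) + 1)\<^sup>2 / 2) / sqrt (2 * pi)"
      proof -
        \<comment> \<open>With x^2 = ln (n + 1) this says (x + 1)^2 / 2 \<le> x^2 + 1, which turns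
          the Gaussian bound into a multiple of 1 / (n + 1).\<close>
        have "0 \<le> (sqrt (?l n) - 1)\<^sup>2" by simp
        then have "(sqrt (?l n) + 1)\<^sup>2 / 2 \<le> ?l n + 1"
          using lp[OF \<open>K \<le> n\<close>] by (simp add: power2_eq_square algebra_simps)
        then have "exp (- 1 - ?l n) \<le> exp (- (sqrt (?l n) + 1)\<^sup>2 / 2)" by simp
        moreover have "exp (- 1 - ?l n) = exp (-1) / (real n + 1)" by (simp add: exp_diff)
        ultimately have "exp (-1) / (real n + 1) / sqrt (2 * pi) \<le> exp (- (sqrt (?l n) + 1)\<^sup>2 / 2) / sqrt (2 * pi)"
          by (intro divide_right_mono) auto
        then show ?thesis by (simp add: mult.commute)
      qed
      ultimately have "prob (?S n) \<le> 1 + - ?k" by linarith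
      also have "\<dots> \<le> exp (- ?k)" by (rule exp_ge_add_one_self)
      finally show "prob (?S n) \<le> exp (- (exp (-1) / sqrt (2 * pi)) * (1 / (real n + 1)))" by simp
    qed simp
    also have "\<dots> = exp (- (exp (-1) / sqrt (2 * pi)) * (\<Sum>n=K..<N. 1 / (real n + 1)))"
      by (simp add: exp_sum[symmetric] sum_distrib_left)
    finally show "prob {\<omega> \<in> space M. \<forall>n\<in>{K..<N}. \<bar>J (t (Suc n)) \<omega> - J (t n) \<omega>\<bar> < r n / 2}
      \<le> exp (- (exp (-1) / sqrt (2 * pi)) * (\<Sum>n=K..<N. 1 / (real n + 1))) + \<kappa>" by simp
  qed
qed

text \<open>Divergence of the harmonic series makes the bound of
  \<open>block_increments_all_small\<close> tend to 0 as N grows. So from no index on can all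
  increments stay small with positive probability.\<close>

lemma iterated_logarithm_lower:
  fixes t :: "nat \<Rightarrow> real"
  assumes t: "strict_mono t" "0 \<le> t 0" and v: "\<And>n. V (t (Suc n)) < V (t n)"
  shows "AE \<omega> in M. \<exists>\<^sub>F n in sequentially.
    sqrt ((V (t n) - V (t (Suc n))) * ln (real n + 1)) / 2 \<le> \<bar>J (t (Suc n)) \<omega> - J (t n) \<omega>\<bar>"
proof -
  define r where "r n = sqrt ((V (t n) - V (t (Suc n))) * ln (real n + 1))" for n
  have t_ge: "0 \<le> t j" for j using t strict_mono_less_eq[OF t(1), of 0 j] by simp
  note [measurable] = J_measurable[OF t_ge]
  let ?E = "\<lambda>K. {\<omega> \<in> space M. \<forall>n\<in>{K..}. \<bar>J (t (Suc n)) \<omega> - J (t n) \<omega>\<bar> < r n / 2}"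
  have E: "?E K \<in> events" for K by measurable
  have diverge: "\<exists>N. C < (\<Sum>n=K..<N. 1 / (real n + 1))" for C K
  proof (rule ccontr)
    assume bounded: "\<not> (\<exists>N. C < (\<Sum>n=K..<N. 1 / (real n + 1)))"
    then have "summable (\<lambda>n. 1 / (real (n + K) + 1))"
    proof (intro summableI_nonneg_bounded[where x = C])
      fix n
      have "(\<Sum>i<n. 1 / (real (i + K) + 1)) = (\<Sum>i=K..<n + K. 1 / (real i + 1))"
        using sum.shift_bounds_nat_ivl[of "\<lambda>i. 1 / (real i + 1)" 0 K n] by (simp add: atLeast0LessThan)
      then show "(\<Sum>i<n. 1 / (real (i + K) + 1)) \<le> C" using bounded by (simp add: not_less)
    qed auto
    then have "summable (\<lambda>n. inverse (real (n + (K + 1))))" by (simp add: inverse_eq_divide add_ac)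
    then have "summable (\<lambda>n. inverse (real n))" by (rule summable_iff_shift[THEN iffD1])
    then show False using not_summable_harmonic[where 'a = real] by simp
  qed
  have "prob (?E K) = 0" if "1 \<le> K" for K
  proof (rule ccontr)
    let ?c = "exp (-1) / sqrt (2 * pi)"
    assume "prob (?E K) \<noteq> 0"
    then have p: "0 < prob (?E K)" by (simp add: zero_less_measure_iff)
    obtain N where N: "- ln (prob (?E K)) / ?c < (\<Sum>n=K..<N. 1 / (real n + 1))" using diverge by blast
    have "0 < ?c" by simp
    then have "- ln (prob (?E K)) < ?c * (\<Sum>n=K..<N. 1 / (real n + 1))"
      using N by (simp only: pos_divide_less_eq mult.commute)
    then have "exp (- ?c * (\<Sum>n=K..<N. 1 / (real n + 1))) < prob (?E K)"
      using p by (subst (2) exp_ln[symmetric]) (auto simp del: exp_ln)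
    moreover have "prob (?E K) \<le> prob {\<omega> \<in> space M. \<forall>n\<in>{K..<N}. \<bar>J (t (Suc n)) \<omega> - J (t n) \<omega>\<bar> < r n / 2}"
    proof (rule finite_measure_mono)
      show "{\<omega> \<in> space M. \<forall>n\<in>{K..<N}. \<bar>J (t (Suc n)) \<omega> - J (t n) \<omega>\<bar> < r n / 2} \<in> events" by measurable
    qed auto
    ultimately show False using block_increments_all_small[OF t v that, of N] by (simp add: r_def)
  qed
  then have "AE \<omega> in M. \<omega> \<notin> ?E (Suc K)" for K
    using E[of "Suc K"] by (intro AE_not_in) (simp add: null_sets_def emeasure_eq_measure)
  then have "AE \<omega> in M. \<forall>K. \<omega> \<notin> ?E (Suc K)" by (simp add: AE_all_countable)
  then show ?thesis using AE_space
  proof eventually_elim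
    case (elim \<omega>)
    have "\<exists>n\<ge>K. r n / 2 \<le> \<bar>J (t (Suc n)) \<omega> - J (t n) \<omega>\<bar>" for K
    proof -
      have "\<omega> \<notin> ?E (Suc K)" using elim by blast
      then obtain n where "Suc K \<le> n" "\<not> \<bar>J (t (Suc n)) \<omega> - J (t n) \<omega>\<bar> < r n / 2" using elim(2) by auto
      then show ?thesis by (intro exI[of _ n]) auto
    qed
    then show ?case by (simp add: frequently_sequentially r_def)
  qed
qed

end

section \<open>Comparison of the noise with the deterministic decay\<close>

locale scaled_noise = drift f + ito_process M B \<sigma> J
  for f M and B :: "real \<Rightarrow> 'a \<Rightarrow> real" and \<sigma> J
begin

definition L :: "real \<Rightarrow> real" where "L t = ln (ln (1 / (\<phi> t)\<^sup>2))"

lemma ln_inverse_\<phi>_at_top: "LIM t at_top. ln (1 / (\<phi> t)\<^sup>2) :> at_top"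
proof -
  have "LIM x at_right 0. ln (1 / x\<^sup>2) :> (at_top :: real filter)" by real_asymp
  from filterlim_compose[OF this \<phi>_at_right] show ?thesis .
qed

lemma L_at_top: "LIM t at_top. L t :> at_top"
  unfolding L_def by (rule filterlim_compose[OF ln_at_top ln_inverse_\<phi>_at_top])

text \<open>V is continuous, positive and tends to 0, so each value V 0 / 2^n is attained, at times
  that tend to infinity. There n is the binary logarithm of V 0 / V, which makes ln n an iterated
  logarithm of 1 / V.\<close>

lemma halving_times:
  obtains s :: "nat \<Rightarrow> real" where "strict_mono s" "0 \<le> s 0" "\<And>n. V (s n) = V 0 / 2 ^ n" "filterlim s at_top sequentially"
proof -
  have V0: "0 < V 0" by (rule V_pos) simp
  have "\<exists>x\<ge>0. V x = V 0 / 2 ^ n" for n :: nat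
  proof -
    have "\<forall>\<^sub>F t in at_top. V t < V 0 / 2 ^ n" using V0 by (intro order_tendstoD[OF V_tendsto_0]) auto
    with eventually_ge_at_top[of 0] have "\<forall>\<^sub>F t in at_top. 0 \<le> t \<and> V t < V 0 / 2 ^ n" by eventually_elim simp
    then obtain b where b: "0 \<le> b" "V b < V 0 / 2 ^ n" using eventually_happens'[of at_top] by force
    have "\<exists>x\<ge>0. x \<le> b \<and> V x = V 0 / 2 ^ n"
      using b V0 by (intro IVT2' V_cont) (auto simp: field_simps)
    then show ?thesis by blast
  qed
  then obtain s where s: "\<And>n. 0 \<le> s n" "\<And>n. V (s n) = V 0 / 2 ^ n" by metis
  have "strict_mono s"
  proof (rule strict_monoI)
    fix m n :: nat assume "m < n"
    then have "V (s n) < V (s m)" using V0 unfolding s(2) by (intro divide_strict_left_mono power_strict_increasing) auto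
    then show "s m < s n" using V_antimono[of "s n" "s m"] s(1) by force
  qed
  moreover have "filterlim s at_top sequentially"
    unfolding filterlim_at_top
  proof
    fix C
    have "(\<lambda>n. c / 2 ^ n) \<longlonglongrightarrow> 0" for c :: real by real_asymp
    from this[of "V 0"] have "\<forall>\<^sub>F n in sequentially. V 0 / 2 ^ n < V (max C 0)"
      by (rule order_tendstoD) (auto intro: V_pos)
    then show "\<forall>\<^sub>F n in sequentially. C \<le> s n"
    proof eventually_elim
      case (elim n)
      then show ?case using V_antimono[of "s n" "max C 0"] s by (cases "s n \<le> max C 0") auto
    qed
  qed
  ultimately show ?thesis using s that by blast
qed

text \<open>In the two comparisons below \<open>ln n\<close> has to be matched with \<open>L t = ln ln (1 / \<phi>\<^sup>2)\<close>. This works when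
  \<open>V\<close> is not too far from a power of \<open>\<phi>\<close>; in the remaining case \<open>V\<close> alone decides the inequality.\<close>

lemma scale_upper:
  fixes s :: "nat \<Rightarrow> real"
  assumes s: "strict_mono s" "0 \<le> s 0" "\<And>n. V (s n) = V 0 / 2 ^ n" "filterlim s at_top sequentially"
    and small: "\<And>\<epsilon>. 0 < \<epsilon> \<Longrightarrow> \<forall>\<^sub>F t in at_top. V t * L t \<le> \<epsilon> * (\<phi> t)\<^sup>2"
    and "0 < \<epsilon>"
  shows "\<forall>\<^sub>F n in sequentially. \<forall>t\<in>{s n..s (Suc n)}. V (s n) * ln (real n + 3) \<le> \<epsilon> * (\<phi> t)\<^sup>2"
proof -
  have V0: "0 < V 0" by (rule V_pos) simp
  have s_ge: "0 \<le> s n" for n using s strict_mono_less_eq[OF s(1), of 0 n] by simp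
  have "\<forall>\<^sub>F x in at_top. (c + 2 * x) / ln 2 + 3 \<le> x\<^sup>2" for c :: real by real_asymp
  from eventually_compose_filterlim[OF this ln_inverse_\<phi>_at_top]
  have "\<forall>\<^sub>F t in at_top. (ln (V 0) + 2 * ln (1 / (\<phi> t)\<^sup>2)) / ln 2 + 3 \<le> (ln (1 / (\<phi> t)\<^sup>2))\<^sup>2" .
  moreover have "\<forall>\<^sub>F t in at_top. V t * L t \<le> \<epsilon> / 4 * (\<phi> t)\<^sup>2" using small[of "\<epsilon> / 4"] \<open>0 < \<epsilon>\<close> by simp
  moreover have "\<forall>\<^sub>F t in at_top. 1 \<le> ln (1 / (\<phi> t)\<^sup>2)"
    using ln_inverse_\<phi>_at_top by (simp add: filterlim_at_top)
  moreover note eventually_ge_at_top[of 0]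
  ultimately have "\<forall>\<^sub>F t in at_top. (ln (V 0) + 2 * ln (1 / (\<phi> t)\<^sup>2)) / ln 2 + 3 \<le> (ln (1 / (\<phi> t)\<^sup>2))\<^sup>2
      \<and> V t * L t \<le> \<epsilon> / 4 * (\<phi> t)\<^sup>2 \<and> 1 \<le> ln (1 / (\<phi> t)\<^sup>2) \<and> 0 \<le> t" by eventually_elim simp
  then obtain T where T: "\<And>t. T \<le> t \<Longrightarrow> (ln (V 0) + 2 * ln (1 / (\<phi> t)\<^sup>2)) / ln 2 + 3 \<le> (ln (1 / (\<phi> t)\<^sup>2))\<^sup>2"
    "\<And>t. T \<le> t \<Longrightarrow> V t * L t \<le> \<epsilon> / 4 * (\<phi> t)\<^sup>2" "\<And>t. T \<le> t \<Longrightarrow> 1 \<le> ln (1 / (\<phi> t)\<^sup>2)" "\<And>t. T \<le> t \<Longrightarrow> 0 \<le> t"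
    unfolding eventually_at_top_linorder by blast
  have "0 < c \<Longrightarrow> (\<lambda>n. 2 * (c / 2 ^ n) * (ln (real n + 3))\<^sup>2) \<longlonglongrightarrow> 0" for c :: real by real_asymp
  from this[OF V0] have "\<forall>\<^sub>F n in sequentially. 2 * (V 0 / 2 ^ n) * (ln (real n + 3))\<^sup>2 < \<epsilon>\<^sup>2"
    by (rule order_tendstoD) (use \<open>0 < \<epsilon>\<close> in auto)
  moreover have "\<forall>\<^sub>F n in sequentially. T \<le> s n" using s(4) by (simp add: filterlim_at_top)
  ultimately show ?thesis
  proof eventually_elim
    case (elim n)
    have ln3: "0 \<le> ln (real n + 3)" by simp
    show ?case
    proof
      fix t assume t: "t \<in> {s n..s (Suc n)}"
      then have "T \<le> t" using elim by simp
      note Tt = T[OF this]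
      \<comment> \<open>Within one block V drops by a factor of at most 2, so V t and V (s n) are
        interchangeable up to constants.\<close>
      have Vle: "V (s n) \<le> 2 * V t" "V t \<le> V 0 / 2 ^ n"
      proof -
        have "V (s (Suc n)) \<le> V t" using t s_ge[of n] by (intro V_antimono) auto
        then show "V (s n) \<le> 2 * V t" by (simp add: s(3))
        show "V t \<le> V 0 / 2 ^ n" unfolding s(3)[symmetric] using t s_ge by (intro V_antimono) auto
      qed
      have p: "0 < \<phi> t" by (rule \<phi>_pos[OF Tt(4)])
      have Vt: "0 < V t" by (rule V_pos[OF Tt(4)])
      let ?x = "ln (1 / (\<phi> t)\<^sup>2)"
      show "V (s n) * ln (real n + 3) \<le> \<epsilon> * (\<phi> t)\<^sup>2"
      \<comment> \<open>In the first case n is bounded by an affine function of ln (1 / \<phi>^2),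
        so ln (n + 3) \<le> 2 L. In the second, one factor of (V ln)^2 is traded for \<phi>^4, and
        the other V still beats the squared logarithm.\<close>
      proof (cases "(\<phi> t) ^ 4 \<le> V t")
        case True
        then have "(\<phi> t) ^ 4 \<le> V 0 / 2 ^ n" using Vle by simp
        then have "ln ((\<phi> t) ^ 4) \<le> ln (V 0 / 2 ^ n)" using p V0 by (subst ln_le_cancel_iff) auto
        then have "real n * ln 2 \<le> ln (V 0) + 2 * ?x"
          using p V0 by (simp add: ln_div ln_realpow)
        then have "real n \<le> (ln (V 0) + 2 * ?x) / ln 2" by (simp add: pos_le_divide_eq)
        then have "real n + 3 \<le> ?x\<^sup>2" using Tt(1) by linarith
        then have "ln (real n + 3) \<le> ln (?x\<^sup>2)" by (intro ln_mono) auto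
        also have "\<dots> = 2 * L t" using Tt(3) by (simp add: L_def ln_realpow)
        finally have "V (s n) * ln (real n + 3) \<le> (2 * V t) * (2 * L t)"
          using Vle Vt by (intro mult_mono) auto
        also have "\<dots> \<le> \<epsilon> * (\<phi> t)\<^sup>2" using Tt(2) by simp
        finally show ?thesis .
      next
        case False
        have "(V (s n) * ln (real n + 3))\<^sup>2 = V (s n) * (V (s n) * (ln (real n + 3))\<^sup>2)"
          by (simp add: power2_eq_square)
        also have "\<dots> \<le> (2 * (\<phi> t) ^ 4) * (V (s n) * (ln (real n + 3))\<^sup>2)"
          using False Vle V_pos[OF s_ge[of n]] by (intro mult_right_mono) auto
        also have "\<dots> = (\<phi> t) ^ 4 * (2 * (V 0 / 2 ^ n) * (ln (real n + 3))\<^sup>2)" by (simp add: s(3))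
        also have "\<dots> \<le> (\<phi> t) ^ 4 * \<epsilon>\<^sup>2" using elim by (intro mult_left_mono) auto
        also have "\<dots> = (\<epsilon> * (\<phi> t)\<^sup>2)\<^sup>2" by (simp add: power_mult_distrib)
        finally show ?thesis by (rule power2_le_imp_le) (use \<open>0 < \<epsilon>\<close> in simp)
      qed
    qed
  qed
qed

lemma scale_lower:
  fixes s :: "nat \<Rightarrow> real"
  assumes s: "strict_mono s" "0 \<le> s 0" "\<And>n. V (s n) = V 0 / 2 ^ n" "filterlim s at_top sequentially"
    and large: "\<forall>\<^sub>F t in at_top. (\<phi> t)\<^sup>2 \<le> \<rho> * (V t * L t)" and "0 < \<rho>"
  shows "\<forall>\<^sub>F n in sequentially. (\<phi> (s n))\<^sup>2 \<le> 2 * \<rho> * (V (s n) * ln (real n + 1))"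
proof -
  have V0: "0 < V 0" by (rule V_pos) simp
  have s_ge: "0 \<le> s n" for n using s strict_mono_less_eq[OF s(1), of 0 n] by simp
  have "\<forall>\<^sub>F n in sequentially. (\<phi> (s n))\<^sup>2 \<le> \<rho> * (V (s n) * L (s n))"
    by (rule eventually_compose_filterlim[OF large s(4)])
  moreover have "\<forall>\<^sub>F n in sequentially. 1 \<le> ln (1 / (\<phi> (s n))\<^sup>2)"
    using filterlim_compose[OF ln_inverse_\<phi>_at_top s(4)] by (simp add: filterlim_at_top)
  moreover have "\<forall>\<^sub>F n in sequentially. 2 * (real n * ln 2 - c) \<le> (real n + 1)\<^sup>2" for c :: real by real_asymp
  note this[of "ln (V 0)"]
  moreover have "0 < c \<Longrightarrow> \<forall>\<^sub>F n in sequentially. c / 2 ^ n \<le> \<rho> * ln (real n + 1)" for c :: real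
    using \<open>0 < \<rho>\<close> by real_asymp
  note this[OF V0]
  ultimately show ?thesis
  proof eventually_elim
    case (elim n)
    have p: "0 < \<phi> (s n)" by (rule \<phi>_pos[OF s_ge])
    have Vs: "0 < V (s n)" by (rule V_pos[OF s_ge])
    let ?x = "ln (1 / (\<phi> (s n))\<^sup>2)"
    show ?case
    \<comment> \<open>If V \<le> \<phi>, then ln (1 / \<phi>^2) is at most affine in n, hence L
      \<le> 2 ln (n + 1). Otherwise \<phi>^2 \<le> V^2, and one factor V = V 0 / 2^n lies below
      \<rho> ln (n + 1).\<close>
    proof (cases "V (s n) \<le> \<phi> (s n)")
      case True
      then have "ln (V 0 / 2 ^ n) \<le> ln (\<phi> (s n))" unfolding s(3) using p V0 by (subst ln_le_cancel_iff) auto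
      then have "?x \<le> 2 * (real n * ln 2 - ln (V 0))"
        using p V0 by (simp add: ln_div ln_realpow)
      then have "?x \<le> (real n + 1)\<^sup>2" using elim(3) by linarith
      then have "ln ?x \<le> ln ((real n + 1)\<^sup>2)" using elim(2) by (intro ln_mono) auto
      then have "L (s n) \<le> 2 * ln (real n + 1)" by (simp add: L_def ln_realpow)
      then have "\<rho> * (V (s n) * L (s n)) \<le> \<rho> * (V (s n) * (2 * ln (real n + 1)))"
        using Vs \<open>0 < \<rho>\<close> by (intro mult_left_mono) auto
      then show ?thesis using elim(1) by simp
    next
      case False
      have "(\<phi> (s n))\<^sup>2 \<le> V (s n) * V (s n)"
        unfolding power2_eq_square using False p by (intro mult_mono) auto
      also have "\<dots> \<le> V (s n) * (\<rho> * ln (real n + 1))"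
        using elim(4) Vs by (intro mult_left_mono) (auto simp: s(3))
      also have "\<dots> \<le> 2 * \<rho> * (V (s n) * ln (real n + 1))" using Vs \<open>0 < \<rho>\<close> by simp
      finally show ?thesis .
    qed
  qed
qed

text \<open>The bounds b n on increments after s n tend to 0, so J is Cauchy along s n, and |l - J
  t| \<le> 2 b n from s n on. Since \<phi> may drop a lot within a block, \<open>scale_upper\<close>
  compares b n with \<phi> t at every t of the block.\<close>

lemma noise_limit:
  assumes small: "\<And>\<epsilon>. 0 < \<epsilon> \<Longrightarrow> \<forall>\<^sub>F t in at_top. V t * L t \<le> \<epsilon> * (\<phi> t)\<^sup>2"
  shows "AE \<omega> in M. \<exists>l. ((\<lambda>t. (l - J t \<omega>) / \<phi> t) \<longlongrightarrow> 0) at_top"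
proof -
  obtain s where s: "strict_mono s" "0 \<le> s 0" "\<And>n. V (s n) = V 0 / 2 ^ n" "filterlim s at_top sequentially"
    using halving_times by blast
  have s_ge: "0 \<le> s n" for n using s strict_mono_less_eq[OF s(1), of 0 n] by simp
  define b where "b n = 3 * sqrt (8 * V (s n) * ln (real n + 3))" for n
  have b_le: "\<forall>\<^sub>F n in sequentially. \<forall>t\<in>{s n..s (Suc n)}. b n \<le> \<epsilon> * \<phi> t" if "0 < \<epsilon>" for \<epsilon>
  proof -
    \<comment> \<open>As (\<epsilon> / 3)^2 / 8 = \<epsilon>^2 / 72, this undoes the factors 3 and 8
      in \<open>b\<close>.\<close>
    have "\<forall>\<^sub>F n in sequentially. \<forall>t\<in>{s n..s (Suc n)}. V (s n) * ln (real n + 3) \<le> \<epsilon>\<^sup>2 / 72 * (\<phi> t)\<^sup>2"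
      using that by (intro scale_upper[OF s] small) auto
    then show ?thesis
    proof eventually_elim
      case (elim n)
      show ?case
      proof
        fix t assume t: "t \<in> {s n..s (Suc n)}"
        have p: "0 < \<phi> t" using t s_ge[of n] by (intro \<phi>_pos) auto
        have "sqrt (8 * V (s n) * ln (real n + 3)) \<le> \<epsilon> / 3 * \<phi> t"
        proof (rule real_le_lsqrt)
          show "8 * V (s n) * ln (real n + 3) \<le> (\<epsilon> / 3 * \<phi> t)\<^sup>2"
          proof -
            have "V (s n) * ln (real n + 3) \<le> \<epsilon>\<^sup>2 / 72 * (\<phi> t)\<^sup>2" using elim t by blast
            then show ?thesis by (simp add: power_mult_distrib power_divide)
          qed
        qed (use p that in auto)
        then show "b n \<le> \<epsilon> * \<phi> t" by (simp add: b_def)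
      qed
    qed
  qed
  have b_0: "b \<longlonglongrightarrow> 0"
  proof (rule tendsto_sandwich[OF _ _ tendsto_const])
    show "\<forall>\<^sub>F n in sequentially. 0 \<le> b n" using V_pos[OF s_ge] by (auto simp: b_def intro!: always_eventually mult_nonneg_nonneg less_imp_le)
    show "\<forall>\<^sub>F n in sequentially. b n \<le> \<phi> (s n)"
      using b_le[OF zero_less_one] by (rule eventually_mono) (use s(1) in \<open>auto simp: strict_mono_less_eq\<close>)
    show "(\<lambda>n. \<phi> (s n)) \<longlonglongrightarrow> 0" by (rule filterlim_compose[OF \<phi>_tendsto_0 s(4)])
  qed
  from iterated_logarithm_upper[where s = s, OF s_ge] show ?thesis
  proof eventually_elim
    case (elim \<omega>)
    then obtain n0 where n0: "\<And>n t. n0 \<le> n \<Longrightarrow> s n \<le> t \<Longrightarrow> \<bar>J t \<omega> - J (s n) \<omega>\<bar> \<le> b n"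
      by (auto simp: eventually_sequentially b_def)
    have "Cauchy (\<lambda>n. J (s n) \<omega>)"
    proof (rule metric_CauchyI)
      fix e :: real assume "0 < e"
      then have "\<forall>\<^sub>F n in sequentially. b n < e / 2" by (intro order_tendstoD[OF b_0]) auto
      then obtain n1 where n1: "\<And>n. n1 \<le> n \<Longrightarrow> b n < e / 2" by (auto simp: eventually_sequentially)
      define k where "k = max n0 n1"
      have "\<bar>J (s n) \<omega> - J (s k) \<omega>\<bar> < e / 2" if "k \<le> n" for n
        using n0[of k "s n"] n1[of k] that s(1) by (auto simp: k_def strict_mono_less_eq intro: order_le_less_trans)
      then have "dist (J (s m) \<omega>) (J (s n) \<omega>) < e" if "k \<le> m" "k \<le> n" for m n
        using that by (smt (verit) dist_real_def field_sum_of_halves)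
      then show "\<exists>M. \<forall>m\<ge>M. \<forall>n\<ge>M. dist (J (s m) \<omega>) (J (s n) \<omega>) < e" by blast
    qed
    then obtain l where l: "(\<lambda>n. J (s n) \<omega>) \<longlonglongrightarrow> l" using Cauchy_convergent_iff convergent_def by blast
    have near: "\<bar>l - J t \<omega>\<bar> \<le> 2 * b n" if "n0 \<le> n" "s n \<le> t" for n t
    proof -
      have "\<bar>l - J (s n) \<omega>\<bar> \<le> b n"
      proof (rule LIMSEQ_le_const2)
        show "(\<lambda>m. \<bar>J (s m) \<omega> - J (s n) \<omega>\<bar>) \<longlonglongrightarrow> \<bar>l - J (s n) \<omega>\<bar>" by (intro tendsto_intros l)
        show "\<exists>N. \<forall>m\<ge>N. \<bar>J (s m) \<omega> - J (s n) \<omega>\<bar> \<le> b n"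
          using n0[OF that(1)] s(1) by (intro exI[of _ n]) (auto simp: strict_mono_less_eq)
      qed
      then show ?thesis using n0[OF that] by linarith
    qed
    have "((\<lambda>t. (l - J t \<omega>) / \<phi> t) \<longlongrightarrow> 0) at_top"
    proof (rule tendstoI)
      fix e :: real assume "0 < e"
      then have "0 < e / 4" by simp
      from b_le[OF this] obtain n1 where n1: "\<And>n t. n1 \<le> n \<Longrightarrow> t \<in> {s n..s (Suc n)} \<Longrightarrow> b n \<le> e / 4 * \<phi> t"
        unfolding eventually_sequentially by blast
      define k where "k = max n0 n1"
      have "dist ((l - J t \<omega>) / \<phi> t) 0 < e" if "s k \<le> t" for t
      proof -
        have "\<forall>\<^sub>F n in sequentially. t < s n" using s(4) by (simp add: filterlim_at_top_dense)
        \<comment> \<open>The first index with t < s m; its predecessor starts the block containing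
          t.\<close>
        then obtain m where m: "t < s m" "\<And>i. i < m \<Longrightarrow> \<not> t < s i"
          using eventually_happens'[of sequentially "\<lambda>n. t < s n"] exists_least_iff[of "\<lambda>n. t < s n"] by auto
        have "k < m" using m(1) that s(1) by (metis less_le_trans not_less strict_mono_less_eq)
        then obtain n where n: "m = Suc n" "k \<le> n" by (cases m) auto
        have t: "t \<in> {s n..s (Suc n)}" using m n by (auto simp: not_less)
        have p: "0 < \<phi> t" using t s_ge[of n] by (intro \<phi>_pos) auto
        have "\<bar>l - J t \<omega>\<bar> \<le> 2 * (e / 4 * \<phi> t)" using near[of n t] n1[of n t] n t by (auto simp: k_def)
        also have "\<dots> < e * \<phi> t" using p \<open>0 < e\<close> by simp
        finally show ?thesis using p by (simp add: dist_real_def abs_divide divide_less_eq)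
      qed
      then show "\<forall>\<^sub>F t in at_top. dist ((l - J t \<omega>) / \<phi> t) 0 < e" by (auto simp: eventually_at_top_linorder)
    qed
    then show ?case by blast
  qed
qed

text \<open>Infinitely often the squared increment over a block is at least V (s n) ln (n + 1) / 8,
  while (c \<phi> (s n))^2 is at most 2 \<rho> c^2 V (s n) ln (n + 1); hence the condition 16 c^2
  \<rho> < 1. The null set comes from the lower half alone, so it serves all \<rho> and c at
  once.\<close>

lemma noise_oscillation:
  assumes large: "\<And>\<rho>. \<rho> \<in> R \<Longrightarrow> 0 < \<rho> \<and> (\<forall>\<^sub>F t in at_top. (\<phi> t)\<^sup>2 \<le> \<rho> * (V t * L t))"
  shows "AE \<omega> in M. \<forall>\<rho>\<in>R. \<forall>c. 0 < c \<longrightarrow> 16 * c\<^sup>2 * \<rho> < 1 \<longrightarrow> \<not> (\<forall>\<^sub>F s in at_top. \<forall>t\<ge>s. \<bar>J t \<omega> - J s \<omega>\<bar> \<le> c * \<phi> s)"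
proof -
  obtain s where s: "strict_mono s" "0 \<le> s 0" "\<And>n. V (s n) = V 0 / 2 ^ n" "filterlim s at_top sequentially"
    using halving_times by blast
  have V0: "0 < V 0" by (rule V_pos) simp
  have s_ge: "0 \<le> s n" for n using s strict_mono_less_eq[OF s(1), of 0 n] by simp
  have v: "V (s (Suc n)) < V (s n)" for n using V0 by (simp add: s(3) field_simps)
  from iterated_logarithm_lower[OF s(1,2) v] show ?thesis
  proof eventually_elim
    case (elim \<omega>)
    show ?case
    proof (intro ballI allI impI notI)
      fix \<rho> c :: real
      assume "\<rho> \<in> R" "0 < c" and c: "16 * c\<^sup>2 * \<rho> < 1"
        and "\<forall>\<^sub>F s in at_top. \<forall>t\<ge>s. \<bar>J t \<omega> - J s \<omega>\<bar> \<le> c * \<phi> s"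
      from eventually_compose_filterlim[OF this(4) s(4)]
      have "\<forall>\<^sub>F n in sequentially. \<forall>t\<ge>s n. \<bar>J t \<omega> - J (s n) \<omega>\<bar> \<le> c * \<phi> (s n)" .
      moreover have "\<forall>\<^sub>F n in sequentially. (\<phi> (s n))\<^sup>2 \<le> 2 * \<rho> * (V (s n) * ln (real n + 1))"
        using large[OF \<open>\<rho> \<in> R\<close>] by (intro scale_lower s) auto
      ultimately have "\<forall>\<^sub>F n in sequentially.
          \<bar>J (s (Suc n)) \<omega> - J (s n) \<omega>\<bar> < sqrt ((V (s n) - V (s (Suc n))) * ln (real n + 1)) / 2"
        using eventually_gt_at_top[of 0]
      proof eventually_elim
        case (elim n)
        have Vs: "0 < V (s n)" by (rule V_pos[OF s_ge])
        have l: "0 < ln (real n + 1)" using elim(3) by simp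
        have half: "V (s n) - V (s (Suc n)) = V (s n) / 2" by (simp add: s(3))
        have "s n \<le> s (Suc n)" using s(1) by (simp add: strict_mono_less_eq)
        then have "\<bar>J (s (Suc n)) \<omega> - J (s n) \<omega>\<bar> \<le> c * \<phi> (s n)" using elim(1) by blast
        also have "\<dots> < sqrt (V (s n) / 2 * ln (real n + 1)) / 2"
        proof (rule power2_less_imp_less)
          have "(c * \<phi> (s n))\<^sup>2 \<le> c\<^sup>2 * (2 * \<rho> * (V (s n) * ln (real n + 1)))"
            unfolding power_mult_distrib using elim(2) by (intro mult_left_mono) auto
          also have "\<dots> = (16 * c\<^sup>2 * \<rho>) * (V (s n) * ln (real n + 1) / 8)" by simp
          also have "\<dots> < 1 * (V (s n) * ln (real n + 1) / 8)" using c Vs l by (intro mult_strict_right_mono) auto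
          also have "\<dots> = (sqrt (V (s n) / 2 * ln (real n + 1)) / 2)\<^sup>2" using Vs l by (simp add: power_divide)
          finally show "(c * \<phi> (s n))\<^sup>2 < (sqrt (V (s n) / 2 * ln (real n + 1)) / 2)\<^sup>2" .
        qed (use Vs l in simp)
        finally show ?case unfolding half .
      qed
      then show False using elim by (simp add: frequently_def not_le)
    qed
  qed
qed

end

lemma natural_algebra_mono:
  assumes "S \<subseteq> T" shows "borel_measurable (natural_algebra M B S) \<subseteq> borel_measurable (natural_algebra M B T)"
proof (rule measurable_mono)
  show "sets (natural_algebra M B S) \<subseteq> sets (natural_algebra M B T)"
    unfolding natural_algebra_def using assms
    by (subst (1 2) sets_measure_of) (auto intro!: sigma_sets_mono')
qed (simp_all add: natural_algebra_def space_measure_of_conv)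

section \<open>The three cases of \<mu>\<close>

theorem theorem15:
  fixes M :: "'a measure" and B X :: "real \<Rightarrow> 'a \<Rightarrow> real"
    and f \<sigma> :: "real \<Rightarrow> real" and \<xi> :: real and \<mu> :: ereal
  assumes "local_lipschitz (UNIV :: real set) UNIV (\<lambda>_. f)"
    and "mono f"
    and "\<forall>x. f (- x) = - f x"
    and "f 0 = 0"
    and "\<forall>x. x \<noteq> 0 \<longrightarrow> x * f x > 0"
    and "\<exists>\<epsilon>\<^sub>0\<in>{0<..<1}. \<forall>\<epsilon>\<in>{0<..<\<epsilon>\<^sub>0}. Phi_lower f \<epsilon> > 0"
    and "(Phi_lower f \<longlongrightarrow> 1) (at_right 0)"
    and "\<forall>\<nu>\<in>{0<..<1}. Limsup (at_right 0) (\<lambda>x. ereal (f (\<nu> * x) / f x)) < ereal \<nu>"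
    and "continuous_on {0..} \<sigma>"
    and "set_integrable lborel {0..} (\<lambda>s. (\<sigma> s)\<^sup>2)"
    and "\<forall>t\<ge>0. (LINT s:{t..}|lborel. (\<sigma> s)\<^sup>2) > 0"
    and "prob_space M"
    and "standard_brownian_motion M B"
    and "is_sde_solution M B f \<sigma> \<xi> X"
    and "0 \<le> \<mu>"
    and "((\<lambda>t. ereal ((LINT s:{t..}|lborel. (\<sigma> s)\<^sup>2) /
            ((F_inv f t)\<^sup>2 / ln (ln (1 / (F_inv f t)\<^sup>2))))) \<longlongrightarrow> \<mu>) at_top"
  shows "(\<mu> = 0 \<longrightarrow>
           (\<exists>\<Lambda> \<in> borel_measurable (natural_algebra M B {0..}).
              (AE \<omega> in M. \<Lambda> \<omega> \<in> {-1, 0, 1}) \<and>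
              (AE \<omega> in M. ((\<lambda>t. X t \<omega> / F_inv f t) \<longlongrightarrow> \<Lambda> \<omega>) at_top))) \<and>
         (0 < \<mu> \<and> \<mu> < \<infinity> \<longrightarrow>
           (AE \<omega> in M. \<not> (\<exists>l\<in>{-1, 0, 1}. ((\<lambda>t. X t \<omega> / F_inv f t) \<longlongrightarrow> l) at_top))) \<and>
         (\<mu> = \<infinity> \<longrightarrow>
           (AE \<omega> in M. Limsup at_top (\<lambda>t. ereal (\<bar>X t \<omega>\<bar> / F_inv f t)) = \<infinity>))"
proof -
  obtain J where X_adapted: "\<And>t. 0 \<le> t \<Longrightarrow> X t \<in> borel_measurable (natural_algebra M B {0..t})"
    and X_cont: "AE \<omega> in M. continuous_on {0..} (\<lambda>t. X t \<omega>)"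
    and J: "\<forall>t\<ge>0. is_stochastic_integral M B \<sigma> t (J t)" "AE \<omega> in M. continuous_on {0..} (\<lambda>t. J t \<omega>)"
    and X_eq: "AE \<omega> in M. X 0 \<omega> = \<xi> \<and> (\<forall>t\<ge>0. X t \<omega> = \<xi> - integral {0..t} (\<lambda>s. f (X s \<omega>)) + J t \<omega>)"
    using assms(14) unfolding is_sde_solution_def by blast
  interpret prob_space M by fact
  interpret scaled_noise f M B \<sigma> J
    by unfold_locales (use assms J in auto)
  note lim = assms(16)[folded V_def L_def]
  have L_pos: "\<forall>\<^sub>F t in at_top. 0 < L t" using L_at_top by (simp add: filterlim_at_top_dense)
  \<comment> \<open>\<open>1 / m\<close> becomes the constant \<rho> of
    \<open>noise_oscillation\<close>; it can be made arbitrarily small when \<mu> =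
    \<infinity>.\<close>
  have large: "\<forall>\<^sub>F t in at_top. (\<phi> t)\<^sup>2 \<le> 1 / m * (V t * L t)" if "0 < m" "ereal m < \<mu>" for m
    using order_tendstoD(1)[OF lim that(2)] L_pos eventually_ge_at_top[of 0]
  proof eventually_elim
    case (elim t)
    have "m < V t * L t / (\<phi> t)\<^sup>2" using elim by simp
    then show ?case using \<phi>_pos[OF elim(3)] that(1) by (simp add: field_simps)
  qed
  show ?thesis
  proof (intro conjI impI)
    assume "\<mu> = 0"
    have small: "\<forall>\<^sub>F t in at_top. V t * L t \<le> \<epsilon> * (\<phi> t)\<^sup>2" if "0 < \<epsilon>" for \<epsilon>
    proof -
      have "\<mu> < ereal \<epsilon>" using that \<open>\<mu> = 0\<close> by simp
      from order_tendstoD(2)[OF lim this] eventually_ge_at_top[of 0] show ?thesis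
      proof eventually_elim
        case (elim t)
        then show ?case using \<phi>_pos[OF elim(2)] by (simp add: field_simps)
      qed
    qed
    \<comment> \<open>A limit along the integers involves countably many adapted variables, so it is
      measurable for the raw natural filtration. Off the convergence set it takes whatever value
      \<open>lim\<close> has there.\<close>
    define \<Lambda> where "\<Lambda> \<omega> = lim (\<lambda>n. X (real n) \<omega> / \<phi> (real n))" for \<omega>
    have noise: "AE \<omega> in M. \<exists>l. ((\<lambda>t. (l - J t \<omega>) / \<phi> t) \<longlongrightarrow> 0) at_top"
      by (rule noise_limit) (rule small)
    have conv: "AE \<omega> in M. \<exists>l\<in>{-1, 0, 1}. ((\<lambda>t. X t \<omega> / \<phi> t) \<longlongrightarrow> l) at_top"
      using noise X_cont X_eq
    proof eventually_elim
      case (elim \<omega>)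
      from elim(1) obtain l where l: "((\<lambda>t. (l - J t \<omega>) / \<phi> t) \<longlongrightarrow> 0) at_top" by blast
      interpret perturbed_path f "\<lambda>t. X t \<omega>" "\<lambda>t. l - J t \<omega>" "\<xi> + l"
        by unfold_locales (use elim l in auto)
      show ?case by (rule ratio_converges)
    qed
    have \<Lambda>: "AE \<omega> in M. \<Lambda> \<omega> \<in> {-1, 0, 1} \<and> ((\<lambda>t. X t \<omega> / \<phi> t) \<longlongrightarrow> \<Lambda> \<omega>) at_top"
      using conv
    proof eventually_elim
      case (elim \<omega>)
      then obtain l where l: "l \<in> {-1, 0, 1}" "((\<lambda>t. X t \<omega> / \<phi> t) \<longlongrightarrow> l) at_top" by blast
      have "(\<lambda>n. X (real n) \<omega> / \<phi> (real n)) \<longlonglongrightarrow> l"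
        by (rule filterlim_compose[OF l(2) filterlim_real_sequentially])
      then have "\<Lambda> \<omega> = l" unfolding \<Lambda>_def by (rule limI)
      then show ?case using l by simp
    qed
    have "\<Lambda> \<in> borel_measurable (natural_algebra M B {0..})"
      unfolding \<Lambda>_def
    proof (intro borel_measurable_lim_metric borel_measurable_divide borel_measurable_const)
      fix n
      have "{0..real n} \<subseteq> {0..}" by auto
      from natural_algebra_mono[OF this] X_adapted[of "real n"]
      show "X (real n) \<in> borel_measurable (natural_algebra M B {0..})" by auto
    qed
    then show "\<exists>\<Lambda> \<in> borel_measurable (natural_algebra M B {0..}).
              (AE \<omega> in M. \<Lambda> \<omega> \<in> {-1, 0, 1}) \<and>
              (AE \<omega> in M. ((\<lambda>t. X t \<omega> / F_inv f t) \<longlongrightarrow> \<Lambda> \<omega>) at_top)"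
      using \<Lambda> by (intro bexI[of _ \<Lambda>]) (auto simp: AE_conj_iff)
  next
    assume \<mu>: "0 < \<mu> \<and> \<mu> < \<infinity>"
    then obtain m where m: "0 < m" "ereal m < \<mu>"
      using ereal_dense2[of 0 \<mu>] by auto
    have "AE \<omega> in M. \<forall>\<rho>\<in>{1 / m}. \<forall>c. 0 < c \<longrightarrow> 16 * c\<^sup>2 * \<rho> < 1 \<longrightarrow>
        \<not> (\<forall>\<^sub>F s in at_top. \<forall>t\<ge>s. \<bar>J t \<omega> - J s \<omega>\<bar> \<le> c * \<phi> s)"
      using m large[OF m] by (intro noise_oscillation) auto
    then show "AE \<omega> in M. \<not> (\<exists>l\<in>{-1, 0, 1}. ((\<lambda>t. X t \<omega> / F_inv f t) \<longlongrightarrow> l) at_top)"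
      using X_cont X_eq
    proof eventually_elim
      case (elim \<omega>)
      \<comment> \<open>Makes 16 c^2 / m equal to 1/2.\<close>
      define c where "c = sqrt (m / 32)"
      have "0 < c" "16 * c\<^sup>2 * (1 / m) < 1" using m(1) by (auto simp: c_def)
      then have "\<not> (\<forall>\<^sub>F s in at_top. \<forall>t\<ge>s. \<bar>J t \<omega> - J s \<omega>\<bar> \<le> c * \<phi> s)" using elim(1) by blast
      moreover have "\<forall>\<^sub>F s in at_top. \<forall>t\<ge>s. \<bar>J t \<omega> - J s \<omega>\<bar> \<le> c * \<phi> s"
        if "l \<in> {-1, 0, 1}" "((\<lambda>t. X t \<omega> / \<phi> t) \<longlongrightarrow> l) at_top" for l
      proof (rule noise_increment_small[OF elim(2) _ that(2,1) \<open>0 < c\<close>])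
        show "X t \<omega> = \<xi> - integral {0..t} (\<lambda>s. f (X s \<omega>)) + J t \<omega>" if "0 \<le> t" for t
          using elim(3) that by blast
      qed
      ultimately show ?case by blast
    qed
  next
    assume "\<mu> = \<infinity>"
    have "AE \<omega> in M. \<forall>\<rho>\<in>{0<..}. \<forall>c. 0 < c \<longrightarrow> 16 * c\<^sup>2 * \<rho> < 1 \<longrightarrow>
        \<not> (\<forall>\<^sub>F s in at_top. \<forall>t\<ge>s. \<bar>J t \<omega> - J s \<omega>\<bar> \<le> c * \<phi> s)"
    proof (rule noise_oscillation)
      fix \<rho> :: real assume "\<rho> \<in> {0<..}"
      then show "0 < \<rho> \<and> (\<forall>\<^sub>F t in at_top. (\<phi> t)\<^sup>2 \<le> \<rho> * (V t * L t))"
        using large[of "1 / \<rho>"] \<open>\<mu> = \<infinity>\<close> by simp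
    qed
    then show "AE \<omega> in M. Limsup at_top (\<lambda>t. ereal (\<bar>X t \<omega>\<bar> / F_inv f t)) = \<infinity>"
      using X_cont X_eq
    proof eventually_elim
      case (elim \<omega>)
      show ?case
      proof (rule ccontr)
        assume "Limsup at_top (\<lambda>t. ereal (\<bar>X t \<omega>\<bar> / \<phi> t)) \<noteq> \<infinity>"
        then obtain K where "Limsup at_top (\<lambda>t. ereal (\<bar>X t \<omega>\<bar> / \<phi> t)) < ereal K"
          using less_PInf_Ex_of_nat less_top by auto
        from Limsup_lessD[OF this] eventually_ge_at_top[of 0]
        have bound: "\<forall>\<^sub>F t in at_top. \<bar>X t \<omega>\<bar> \<le> max K 1 * \<phi> t"
        proof eventually_elim
          case (elim t)
          have "0 < \<phi> t" by (rule \<phi>_pos[OF elim(2)])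
          then have "\<bar>X t \<omega>\<bar> \<le> K * \<phi> t" using elim(1) by (simp add: divide_less_eq)
          also have "\<dots> \<le> max K 1 * \<phi> t" using \<open>0 < \<phi> t\<close> by (intro mult_right_mono) auto
          finally show ?case .
        qed
        have eq: "X t \<omega> = \<xi> - integral {0..t} (\<lambda>s. f (X s \<omega>)) + J t \<omega>" if "0 \<le> t" for t
          using elim(3) that by blast
        \<comment> \<open>C depends on the path, so \<rho> = 1 / (32 C^2) can be chosen only after
          \<omega>. This is where one null set for all \<rho> is used.\<close>
        obtain C where C: "0 < C" "\<forall>\<^sub>F s in at_top. \<forall>t\<ge>s. \<bar>J t \<omega> - J s \<omega>\<bar> \<le> C * \<phi> s"
        proof (rule noise_increment_bounded[OF elim(2) _ bound])
          show "X t \<omega> = \<xi> - integral {0..t} (\<lambda>s. f (X s \<omega>)) + J t \<omega>" if "0 \<le> t" for t by (rule eq[OF that])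
        qed (auto intro: that)
        have "16 * C\<^sup>2 * (1 / (32 * C\<^sup>2)) < 1" "0 < 1 / (32 * C\<^sup>2)" using C(1) by simp_all
        then show False using elim(1)[rule_format, of "1 / (32 * C\<^sup>2)" C] C by simp
      qed
    qed
  qed
qed

end
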